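(* Let $F:\Sigma\to\Sigma$, $F(x,y)=(f(x),G(x,y))$, be a transformation with $f\in\mathcal{T}$, $G$ satisfying (H1), and $F$ satisfying (H3). Let $\mu_0$ be the unique $F$-invariant probability measure in $S^1$. Then $\operatorname{Lip}(\Sigma)\subset\Theta^1_{\mu_0}$, where $\operatorname{Lip}(\Sigma)$ is the set of real Lipschitz functions on $\Sigma$. In particular, for all Lipschitz functions $u_1,u_2:\Sigma\to\mathbb R$, $$\left|\int (u_1\circ F^n)\,u_2\,d\mu_0-\int u_1\,d\mu_0\int u_2\,d\mu_0\right|\le \|u_2\mu_0\|_{S^1}\,U\,|u_1|_{\mathrm{Lip}}\,\lambda_0^n\qquad\text{for all }n\ge1,$$ where $|u|_{\mathrm{Lip}}=|u|_\infty+L(u)$ and $0\le\lambda_0<1$, $U\ge0$ are the spectral gap constants of $F_*$ on $S^1$.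
   Context: Setting. $I=[0,1]$, $m$ is Lebesgue measure on $I$, $d_1$ the Euclidean distance on $I$; $(K,d_2)$ is a compact metric space with $\operatorname{diam}(K)=1$; $\Sigma=I\times K$ with metric $d_1+d_2$. The map $F=(f,G)$ is assumed Borel measurable, with $f:I\to I$, $G:\Sigma\to K$. $L(u)$ denotes the best Lipschitz constant of $u$. Class $\mathcal{T}$. There is a countably infinite family $\mathcal P=\{I_i=(a_i,b_i)\}_{i\ge1}$ of pairwise disjoint open subintervals of $I$ with $m(I\setminus\bigcup_i I_i)=0$. $f\in\mathcal T$ means that $f:\bigcup_i I_i\to I$ satisfies: (1) each $f_i=f|_{I_i}$ is increasing, convex and differentiable with $\lim_{x\to a_i^+}f_i(x)=0$ (the values $f_i(a_i)=0$, $f_i(b_i)$ and $f_i'(a_i)$ are defined by continuity); (2) $\sum_{i\ge1}1/f_i'(a_i)<\infty$; (3) if $0$ is not a limit point of the partition points, then $f'(0)=1/\beta>1$ for some $0<\beta<1$. On the $m$-null set $I\setminus\bigcup_i I_i$, $f$ is given arbitrary (Borel) values. $\mathcal P^{(k)}$ is the partition (mod $m$) of $I$ into the open intervals of the branches of $f^k$, i.e. the nonempty sets $\bigcap_{j=0}^{k-1}f^{-j}(I_{i_j})$. (H1): there is $0\le\alpha<1$ such that for $m$-a.e. $x\in I$, $d_2(G(x,z_1),G(x,z_2))\le\alpha d_2(z_1,z_2)$ for all $z_1,z_2\in K$. (H3): there is $k\in\mathbb N$ such that, writing $F^k=(f^k,G_k)$, one has $\alpha^k\operatorname{ess\,sup}\frac1{|(f^k)'|}<1$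 (essential supremum with respect to $m$); for $m$-a.e. $x$, $G_k(x,\cdot)$ is $\alpha^k$-Lipschitz; and for each $J\in\mathcal P^{(k)}$, $\sup_{y\in K}\sup_{x_1\ne x_2\in J}\frac{d_2(G_k(x_1,y),G_k(x_2,y))}{d_1(x_1,x_2)}<\infty$, the maximum of these numbers over $J\in\mathcal P^{(k)}$ being assumed finite. Measures. $\pi_1(x,y)=x$. $\mathcal{AB}$ is the set of finite signed Borel measures $\mu$ on $\Sigma$, with Jordan decomposition $\mu=\mu^+-\mu^-$, such that $\pi_{1*}\mu^{\pm}\ll m$. For positive $\mu\in\mathcal{AB}$, disintegrate (Rokhlin) along the fibers $\gamma=\{x\}\times K$ (identified with $x\in I$) as $\mu=\int\mu_\gamma\,\phi_1(\gamma)\,dm(\gamma)$ with $\mu_\gamma$ probabilities on $\gamma$ and $\phi_1=d(\pi_{1*}\mu)/dm$; let $\mu|_\gamma$ be the positive measure on $K$ obtained by projecting $\phi_1(\gamma)\mu_\gamma$ to $K$. For signed $\mu\in\mathcal{AB}$, $\mu|_\gamma=\mu^+|_\gamma-\mu^-|_\gamma$ and $\phi_1=\phi_1^+-\phi_1^-=d(\pi_{1*}\mu)/dm$. For a signed measure $\nu$ on $K$, $\|\nu\|_W=\sup\{|\int h\,d\nu|: h:K\to\mathbb R \text{ Lipschitz}, L(h)\le1, |h|_\infty\le1\}$. $\mathcal L^1=\{\mu\in\mathcal{AB}:\|\mu\|_1:=\int\|\mu|_\gamma\|_W\,dm(\gamma)<\infty\}$. $BV_m$: for $h\in L^1_m$,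 $V(h)$ is the infimum, over all representatives $h^*$ of $h$, of the total variation of $h^*$ on $I$; $BV_m=\{h\in L^1_m: V(h)<\infty\}$ and $|h|_v=\int|h|\,dm+V(h)$. $S^1=\{\mu\in\mathcal L^1:\phi_1\in BV_m\}$ with norm $\|\mu\|_{S^1}=|\phi_1|_v+\|\mu\|_1$. $[F_*\mu](E)=\mu(F^{-1}(E))$; under the present hypotheses $F$ has a unique invariant probability measure $\mu_0\in S^1$. $\Theta^1_{\mu_0}=\{u:\Sigma\to\mathbb R:\ u\mu_0\in S^1\}$, where $(u\mu_0)(E)=\int_E u\,d\mu_0$. Spectral gap constants: $\lambda_0\in[0,1)$, $U\ge0$ are constants such that, with $P(\mu)=\mu(\Sigma)\mu_0$ and $N=F_*-P$ on $S^1$, $\|N^n\mu\|_{S^1}\le U\lambda_0^n\|\mu\|_{S^1}$ for all $\mu\in S^1$, $n\ge1$ (such constants exist under (H1) and $f\in\mathcal T$). *)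

theory Defs
  imports "HOL-Probability.Probability"
begin

section \<open>The phase space\<close>

text \<open>
  The interval is the set \<open>{0..1}\<close> of reals. The compact metric space \<open>K\<close> is a type \<open>'k\<close>, whose
  compactness is assumed where needed. The sort \<^class>\<open>polish_space\<close> loses no generality, because
  every compact metric space is complete and second countable.
  \<open>\<Sigma>\<close> is \<open>{0..1} \<times> UNIV\<close>. Its metric \<open>d\<^sub>1 + d\<^sub>2\<close> is not the metric of the
  product type (which is the Euclidean combination), so it is defined separately; the topology
  and the Borel sets are the same.
\<close>

definition Sig :: "(real \<times> 'k::polish_space) set" where
  "Sig = {0..1} \<times> UNIV"

definition borel_Sig :: "(real \<times> 'k::polish_space) measure" where
  "borel_Sig = restrict_space borel Sig"

definition leb_I :: "real measure" where
  "leb_I = restrict_space lborel {0..1}"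

definition d_Sig :: "real \<times> 'k::polish_space \<Rightarrow> real \<times> 'k \<Rightarrow> real" where
  "d_Sig p q = dist (fst p) (fst q) + dist (snd p) (snd q)"

definition skew :: "(real \<Rightarrow> real) \<Rightarrow> (real \<times> 'k \<Rightarrow> 'k) \<Rightarrow> real \<times> 'k \<Rightarrow> real \<times> 'k" where
  "skew f G = (\<lambda>(x, y). (f x, G (x, y)))"

section \<open>Lipschitz functions on the phase space\<close>

definition lip_bound :: "real \<Rightarrow> (real \<times> 'k::polish_space \<Rightarrow> real) \<Rightarrow> bool" where
  "lip_bound C u \<longleftrightarrow> 0 \<le> C \<and> (\<forall>p\<in>Sig. \<forall>q\<in>Sig. \<bar>u p - u q\<bar> \<le> C * d_Sig p q)"

definition Lip_Sig :: "(real \<times> 'k::polish_space \<Rightarrow> real) set" where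
  "Lip_Sig = {u. \<exists>C. lip_bound C u}"

definition lip_const :: "(real \<times> 'k::polish_space \<Rightarrow> real) \<Rightarrow> real" where
  "lip_const u = Inf {C. lip_bound C u}"

definition lip_norm :: "(real \<times> 'k::polish_space \<Rightarrow> real) \<Rightarrow> real" where
  "lip_norm u = (SUP p\<in>Sig. \<bar>u p\<bar>) + lip_const u"

section \<open>Piecewise convex maps\<close>

text \<open>
  \<open>slope0 a f i\<close> is \<open>f\<^sub>i'(a\<^sub>i)\<close>, defined by continuity. For a convex, differentiable,
  increasing branch, \<open>f'\<close> is nondecreasing and nonnegative, so the limit exists.
\<close>

definition slope0 :: "(nat \<Rightarrow> real) \<Rightarrow> (real \<Rightarrow> real) \<Rightarrow> nat \<Rightarrow> real" where
  "slope0 a f i = Lim (at_right (a i)) (deriv f)"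

text \<open>
  Positivity of the slopes is part of the finiteness of \<open>\<Sum>\<^sub>i 1 / f\<^sub>i'(a\<^sub>i)\<close>; it has to be spelt out
  because \<open>1 / 0 = 0\<close> in HOL.
\<close>

definition class_T :: "(nat \<Rightarrow> real) \<Rightarrow> (nat \<Rightarrow> real) \<Rightarrow> (real \<Rightarrow> real) \<Rightarrow> bool" where
  "class_T a b f \<longleftrightarrow>
     (\<forall>i. 0 \<le> a i \<and> a i < b i \<and> b i \<le> 1) \<and>
     disjoint_family (\<lambda>i. {a i<..<b i}) \<and>
     emeasure lborel ({0..1} - (\<Union>i. {a i<..<b i})) = 0 \<and>
     (\<forall>i. f ` {a i<..<b i} \<subseteq> {0..1} \<and>
          strict_mono_on {a i<..<b i} f \<and>
          convex_on {a i<..<b i} f \<and>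
          (\<forall>x\<in>{a i<..<b i}. f differentiable (at x)) \<and>
          (f \<longlongrightarrow> 0) (at_right (a i))) \<and>
     (\<forall>i. 0 < slope0 a f i) \<and> summable (\<lambda>i. 1 / slope0 a f i) \<and>
     (\<not> 0 islimpt (range a \<union> range b) \<longrightarrow>
        (\<exists>\<beta>. 0 < \<beta> \<and> \<beta> < 1 \<and> (deriv f \<longlongrightarrow> 1 / \<beta>) (at_right 0)))"

definition branch_partition ::
    "(nat \<Rightarrow> real) \<Rightarrow> (nat \<Rightarrow> real) \<Rightarrow> (real \<Rightarrow> real) \<Rightarrow> nat \<Rightarrow> real set set" where
  "branch_partition a b f k =
     {J. J \<noteq> {} \<and>
         (\<exists>\<iota>::nat \<Rightarrow> nat. J = {x\<in>{0..1}. \<forall>j<k. (f ^^ j) x \<in> {a (\<iota> j)<..<b (\<iota> j)}})}"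

definition H1 :: "real \<Rightarrow> (real \<times> 'k::polish_space \<Rightarrow> 'k) \<Rightarrow> bool" where
  "H1 \<alpha> G \<longleftrightarrow> 0 \<le> \<alpha> \<and> \<alpha> < 1 \<and>
     (AE x in leb_I. \<forall>z1 z2. dist (G (x, z1)) (G (x, z2)) \<le> \<alpha> * dist z1 z2)"

text \<open>
  The essential supremum is taken in the completed measure: \<^const>\<open>esssup\<close> is \<open>\<top>\<close> on functions that
  are not measurable, and on the null set outside the branches \<open>f\<close> is arbitrary, so that
  \<open>deriv (f ^^ k)\<close> need only be Lebesgue measurable.
\<close>

definition H3 ::
    "(nat \<Rightarrow> real) \<Rightarrow> (nat \<Rightarrow> real) \<Rightarrow> real \<Rightarrow> (real \<Rightarrow> real) \<Rightarrow> (real \<times> 'k::polish_space \<Rightarrow> 'k) \<Rightarrow> bool"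
  where
  "H3 a b \<alpha> f G \<longleftrightarrow> (\<exists>k\<ge>1.
     ereal (\<alpha> ^ k) * esssup (lebesgue_on {0..1}) (\<lambda>x. ereal (1 / \<bar>deriv (f ^^ k) x\<bar>)) < 1 \<and>
     (AE x in leb_I. lipschitz_on (\<alpha> ^ k) UNIV (\<lambda>y. snd ((skew f G ^^ k) (x, y)))) \<and>
     (\<exists>C. \<forall>J\<in>branch_partition a b f k. \<forall>y.
        lipschitz_on C J (\<lambda>x. snd ((skew f G ^^ k) (x, y)))))"

section \<open>Signed measures\<close>

text \<open>
  A finite signed measure is a real-valued countably additive set function on a \<open>\<sigma>\<close>-algebra
  \<open>sets M\<close>; its values on other sets are irrelevant. The Jordan decomposition is given by the
  upper and lower variation.
\<close>

definition signed_measure :: "'a measure \<Rightarrow> ('a set \<Rightarrow> real) \<Rightarrow> bool" where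
  "signed_measure M \<mu> \<longleftrightarrow> \<mu> {} = 0 \<and>
     (\<forall>A::nat \<Rightarrow> 'a set. range A \<subseteq> sets M \<longrightarrow> disjoint_family A \<longrightarrow>
        (\<lambda>n. \<mu> (A n)) sums \<mu> (\<Union>n. A n))"

definition jordan_pos :: "'a measure \<Rightarrow> ('a set \<Rightarrow> real) \<Rightarrow> 'a measure" where
  "jordan_pos M \<mu> = measure_of (space M) (sets M) (\<lambda>A. SUP B\<in>{B\<in>sets M. B \<subseteq> A}. ennreal (\<mu> B))"

definition jordan_neg :: "'a measure \<Rightarrow> ('a set \<Rightarrow> real) \<Rightarrow> 'a measure" where
  "jordan_neg M \<mu> = jordan_pos M (\<lambda>A. - \<mu> A)"

definition signed_integral :: "'a measure \<Rightarrow> ('a set \<Rightarrow> real) \<Rightarrow> ('a \<Rightarrow> real) \<Rightarrow> real" where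
  "signed_integral M \<mu> h = (\<integral>x. h x \<partial>jordan_pos M \<mu>) - (\<integral>x. h x \<partial>jordan_neg M \<mu>)"

definition W_norm :: "('k::polish_space set \<Rightarrow> real) \<Rightarrow> ennreal" where
  "W_norm \<nu> = (SUP h\<in>{h. lipschitz_on 1 UNIV h \<and> (\<forall>y. \<bar>h y\<bar> \<le> 1)}.
     ennreal \<bar>signed_integral borel \<nu> h\<bar>)"

section \<open>Disintegration along the vertical fibres\<close>

text \<open>
  The next three definitions are meant for finite positive measures \<open>\<mu>\<close> whose marginal
  \<open>distr \<mu> leb_I fst\<close> is absolutely continuous with respect to \<open>leb_I\<close>.
\<close>

definition marginal_density :: "(real \<times> 'k::polish_space) measure \<Rightarrow> real \<Rightarrow> real" where
  "marginal_density \<mu> x = enn2real (RN_deriv leb_I (distr \<mu> leb_I fst) x)"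

definition disintegration ::
    "(real \<times> 'k::polish_space) measure \<Rightarrow> (real \<Rightarrow> 'k measure) \<Rightarrow> bool" where
  "disintegration \<mu> \<kappa> \<longleftrightarrow> \<kappa> \<in> leb_I \<rightarrow>\<^sub>M prob_algebra borel \<and>
     (\<forall>E\<in>sets borel_Sig.
        emeasure \<mu> E = (\<integral>\<^sup>+x. emeasure (\<kappa> x) (Pair x -` E) * ennreal (marginal_density \<mu> x) \<partial>leb_I))"

text \<open>
  By Rokhlin's theorem a disintegration exists and the measures \<open>\<phi>\<^sub>1(\<gamma>)\<mu>\<^sub>\<gamma>\<close> are unique for almost
  every fibre, so no integral over the fibres below depends on the choice.
\<close>

definition fibre_measure :: "(real \<times> 'k::polish_space) measure \<Rightarrow> real \<Rightarrow> 'k measure" where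
  "fibre_measure \<mu> x =
     scale_measure (ennreal (marginal_density \<mu> x)) ((SOME \<kappa>. disintegration \<mu> \<kappa>) x)"

definition signed_density :: "((real \<times> 'k::polish_space) set \<Rightarrow> real) \<Rightarrow> real \<Rightarrow> real" where
  "signed_density \<mu> x =
     marginal_density (jordan_pos borel_Sig \<mu>) x - marginal_density (jordan_neg borel_Sig \<mu>) x"

definition fibre :: "((real \<times> 'k::polish_space) set \<Rightarrow> real) \<Rightarrow> real \<Rightarrow> 'k set \<Rightarrow> real" where
  "fibre \<mu> x = (\<lambda>B. measure (fibre_measure (jordan_pos borel_Sig \<mu>) x) B -
                     measure (fibre_measure (jordan_neg borel_Sig \<mu>) x) B)"

section \<open>The spaces of measures\<close>

definition AB :: "((real \<times> 'k::polish_space) set \<Rightarrow> real) set" where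
  "AB = {\<mu>. signed_measure borel_Sig \<mu> \<and>
            absolutely_continuous leb_I (distr (jordan_pos borel_Sig \<mu>) leb_I fst) \<and>
            absolutely_continuous leb_I (distr (jordan_neg borel_Sig \<mu>) leb_I fst)}"

definition L1_norm :: "((real \<times> 'k::polish_space) set \<Rightarrow> real) \<Rightarrow> ennreal" where
  "L1_norm \<mu> = (\<integral>\<^sup>+x. W_norm (fibre \<mu> x) \<partial>leb_I)"

definition L1_space :: "((real \<times> 'k::polish_space) set \<Rightarrow> real) set" where
  "L1_space = {\<mu>\<in>AB. L1_norm \<mu> < \<infinity>}"

definition total_variation :: "(real \<Rightarrow> real) \<Rightarrow> ennreal" where
  "total_variation g = (SUP xs\<in>{xs. sorted xs \<and> set xs \<subseteq> {0..1}}.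
     \<Sum>i<length xs - 1. ennreal \<bar>g (xs ! Suc i) - g (xs ! i)\<bar>)"

definition ess_variation :: "(real \<Rightarrow> real) \<Rightarrow> ennreal" where
  "ess_variation h = (INF g\<in>{g. AE x in leb_I. g x = h x}. total_variation g)"

definition BV_m :: "(real \<Rightarrow> real) set" where
  "BV_m = {h. integrable leb_I h \<and> ess_variation h < \<infinity>}"

definition BV_norm :: "(real \<Rightarrow> real) \<Rightarrow> ennreal" where
  "BV_norm h = (\<integral>\<^sup>+x. ennreal \<bar>h x\<bar> \<partial>leb_I) + ess_variation h"

definition S1 :: "((real \<times> 'k::polish_space) set \<Rightarrow> real) set" where
  "S1 = {\<mu>\<in>L1_space. signed_density \<mu> \<in> BV_m}"

definition S1_norm :: "((real \<times> 'k::polish_space) set \<Rightarrow> real) \<Rightarrow> ennreal" where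
  "S1_norm \<mu> = BV_norm (signed_density \<mu>) + L1_norm \<mu>"

section \<open>Invariant measure and spectral gap\<close>

definition invariant_S1 ::
    "(real \<times> 'k::polish_space \<Rightarrow> real \<times> 'k) \<Rightarrow> (real \<times> 'k) measure \<Rightarrow> bool" where
  "invariant_S1 F \<mu> \<longleftrightarrow> prob_space \<mu> \<and> sets \<mu> = sets borel_Sig \<and>
     distr \<mu> borel_Sig F = \<mu> \<and> measure \<mu> \<in> S1"

definition times_measure ::
    "(real \<times> 'k::polish_space \<Rightarrow> real) \<Rightarrow> (real \<times> 'k) measure \<Rightarrow> (real \<times> 'k) set \<Rightarrow> real" where
  "times_measure u \<mu> = (\<lambda>E. set_lebesgue_integral \<mu> E u)"

text \<open>
  Integrability expresses that \<open>u \<mu>\<close> is defined; the Bochner integral of a nonintegrable function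
  is \<open>0\<close>.
\<close>

definition Theta1 :: "(real \<times> 'k::polish_space) measure \<Rightarrow> (real \<times> 'k \<Rightarrow> real) set" where
  "Theta1 \<mu> = {u. integrable \<mu> u \<and> times_measure u \<mu> \<in> S1}"

definition push ::
    "(real \<times> 'k::polish_space \<Rightarrow> real \<times> 'k) \<Rightarrow> ((real \<times> 'k) set \<Rightarrow> real) \<Rightarrow> (real \<times> 'k) set \<Rightarrow> real"
  where
  "push F \<mu> = (\<lambda>E. \<mu> (F -` E \<inter> Sig))"

definition N_op ::
    "(real \<times> 'k::polish_space \<Rightarrow> real \<times> 'k) \<Rightarrow> (real \<times> 'k) measure \<Rightarrow>
     ((real \<times> 'k) set \<Rightarrow> real) \<Rightarrow> (real \<times> 'k) set \<Rightarrow> real" where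
  "N_op F \<mu>0 \<mu> = (\<lambda>E. push F \<mu> E - \<mu> Sig * measure \<mu>0 E)"

definition spectral_gap ::
    "(real \<times> 'k::polish_space \<Rightarrow> real \<times> 'k) \<Rightarrow> (real \<times> 'k) measure \<Rightarrow> real \<Rightarrow> real \<Rightarrow> bool" where
  "spectral_gap F \<mu>0 l U \<longleftrightarrow> 0 \<le> l \<and> l < 1 \<and> 0 \<le> U \<and>
     (\<forall>\<mu>\<in>S1. \<forall>n\<ge>1. S1_norm ((N_op F \<mu>0 ^^ n) \<mu>) \<le> ennreal (U * l ^ n) * S1_norm \<mu>)"

end

theory Submission
  imports Defs
begin

text \<open>
  The correlation of \<open>u\<^sub>1\<close> and \<open>u\<^sub>2\<close> at time \<open>n\<close> is the integral of \<open>u\<^sub>1\<close> against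
  \<open>N\<^sup>n (u\<^sub>2 \<mu>\<^sub>0)\<close>. All signed measures involved are differences of finite measures dominated by
  \<open>\<mu>\<^sub>0\<close>, and disintegrating their Jordan parts bounds such an integral by \<open>|u\<^sub>1|\<^sub>L\<^sub>i\<^sub>p\<close> times the
  \<open>L\<^sup>1\<close> norm, so that the decay follows from the spectral gap as soon as \<open>u\<^sub>2 \<mu>\<^sub>0 \<in> S\<^sup>1\<close>.

  The point is that the marginal density of \<open>u \<mu>\<^sub>0\<close> has bounded variation for Lipschitz \<open>u\<close>.
  Let \<open>\<phi>\<close> be the marginal density of \<open>\<mu>\<^sub>0\<close>, which is in \<open>BV\<close> and fixed by the transfer operator of
  \<open>f\<close>, and push \<open>\<phi> m \<times> \<delta>\<^sub>y\<close> forward by the iterates of \<open>F\<^sup>k\<close>. All these measures have marginal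
  \<open>\<phi> m\<close>, so the contraction of the fibres makes them converge to \<open>\<mu>\<^sub>0\<close>, without any appeal to the
  spectral gap or to uniqueness. Each of them is a path of measures on \<open>K\<close> indexed by the base, and
  (H3) gives a Lasota--Yorke inequality for the variation of this path, measured by Lipschitz test
  functions that vanish at \<open>y\<close>: one step multiplies it by at most
  \<open>\<theta> = \<alpha>\<^sup>k ess sup 1 / |(f\<^sup>k)'| < 1\<close> and adds a constant. The full left branches of \<open>f\<^sup>k\<close> have
  nonincreasing weights \<open>1 / (f\<^sup>k)'\<close> with summable suprema, which takes care of the infinitely many
  jumps. The uniform bound on the variations passes to the limit.
\<close>

section \<open>Borel structure of the phase space\<close>

text \<open>A Lasota--Yorke inequality for \<open>\<mu>0\<close> itself would be empty as long as
  the variation of its path of fibre measures is not known to be finite, and these fibre measures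
  are determined only almost everywhere. The push-forwards avoid both: they are explicit sums over
  inverse branches, and the path of \<open>\<phi> m \<times> \<delta>\<^sub>y\<close> vanishes on
  test functions that are 0 at \<open>y\<close>, so the iteration starts from variation 0 and stays
  below a fixed constant. The normalisation at \<open>y\<close> is forced by the fibre maps: a
  contraction shrinks the oscillation of a test function but not its values, and the constant left
  over has to be paired with \<open>\<phi>\<close>, whose variation is known. The doubling of
  \<theta> in the classical inequality for piecewise expanding maps does not occur: all branch
  images begin at 0 and the weights decrease, so the jump at the right end of an image is part of a
  monotone decrease, which is charged to the additive constant. Hence the single \<open>k\<close> of
  (H3) is enough. To iterate estimates that hold almost everywhere, everything is done on a set
  \<open>D\<close> of full measure preserved by the inverse branches.\<close>

lemma space_leb_I [simp]: "space leb_I = {0..1}"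
  by (simp add: leb_I_def space_restrict_space)

lemma space_borel_Sig: "space borel_Sig = Sig"
  by (simp add: borel_Sig_def space_restrict_space)

lemma measurable_fst_borel: "fst \<in> (borel :: (real \<times> 'k::polish_space) measure) \<rightarrow>\<^sub>M borel"
  and measurable_snd_borel: "snd \<in> (borel :: (real \<times> 'k::polish_space) measure) \<rightarrow>\<^sub>M borel"
  by (subst borel_prod[symmetric], simp)+

lemma sets_leb_I: "sets leb_I = sets (restrict_space borel {0..1})"
  by (simp add: leb_I_def sets_restrict_space)

lemma measurable_into_leb_I:
  assumes "f \<in> borel_measurable M" "\<And>x. x \<in> space M \<Longrightarrow> f x \<in> {0..1}"
  shows "f \<in> M \<rightarrow>\<^sub>M leb_I"
  unfolding measurable_cong_sets[OF refl sets_leb_I]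
  by (rule measurable_restrict_space2) (use assms in auto)

lemma borel_measurable_leb_I: "f \<in> borel_measurable borel \<Longrightarrow> f \<in> borel_measurable leb_I"
  unfolding measurable_cong_sets[OF sets_leb_I refl] by (rule measurable_restrict_space1)

text \<open>Each inclusion is measurability of the identity map. Second countability enters through
  \<open>borel_prod\<close>, which identifies the Borel sets of the product type with the product
  \<sigma>-algebra.\<close>

lemma sets_borel_Sig: "sets (borel_Sig :: (real \<times> 'k::polish_space) measure) = sets (leb_I \<Otimes>\<^sub>M borel)"
proof (rule antisym)
  let ?S = "borel_Sig :: (real \<times> 'k) measure" and ?P = "leb_I \<Otimes>\<^sub>M (borel :: 'k measure)"
  have sp: "space ?P = space ?S" by (simp add: space_borel_Sig Sig_def space_pair_measure)
  have fst: "fst \<in> ?P \<rightarrow>\<^sub>M (borel :: real measure)"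
    by (rule measurable_compose[OF measurable_fst]) (rule borel_measurable_leb_I, simp)
  have "(\<lambda>p. (fst p, snd p)) \<in> ?P \<rightarrow>\<^sub>M (borel \<Otimes>\<^sub>M borel :: (real \<times> 'k) measure)"
    using fst by (intro measurable_Pair) auto
  then have "(\<lambda>p. p) \<in> ?P \<rightarrow>\<^sub>M ?S"
    unfolding borel_Sig_def
    by (intro measurable_restrict_space2) (auto simp: borel_prod Sig_def space_pair_measure)
  then have m: "(\<lambda>p. p) \<in> ?P \<rightarrow>\<^sub>M ?S" .
  show "sets ?S \<subseteq> sets ?P"
  proof
    fix E assume E: "E \<in> sets ?S"
    have "(\<lambda>p. p) -` E \<inter> space ?P = E" using sets.sets_into_space[OF E] sp by auto
    then show "E \<in> sets ?P" using measurable_sets[OF m E] by simp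
  qed
  have id: "(\<lambda>p. p) \<in> ?S \<rightarrow>\<^sub>M (borel :: (real \<times> 'k) measure)"
    unfolding borel_Sig_def by (rule measurable_restrict_space1) simp
  have "(\<lambda>p. (fst p, snd p)) \<in> ?S \<rightarrow>\<^sub>M ?P"
  proof (rule measurable_Pair)
    show "fst \<in> ?S \<rightarrow>\<^sub>M leb_I"
      by (rule measurable_into_leb_I[OF measurable_compose[OF id measurable_fst_borel]])
         (auto simp: space_borel_Sig Sig_def)
    show "snd \<in> ?S \<rightarrow>\<^sub>M borel" by (rule measurable_compose[OF id measurable_snd_borel])
  qed
  then have m: "(\<lambda>p. p) \<in> ?S \<rightarrow>\<^sub>M ?P" by simp
  show "sets ?P \<subseteq> sets ?S"
  proof
    fix E assume E: "E \<in> sets ?P"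
    have "(\<lambda>p. p) -` E \<inter> space ?S = E" using sets.sets_into_space[OF E] sp by auto
    then show "E \<in> sets ?S" using measurable_sets[OF m E] by simp
  qed
qed

lemma measurable_borel_Sig: "measurable borel_Sig N = measurable (leb_I \<Otimes>\<^sub>M borel) N"
  by (rule measurable_cong_sets[OF sets_borel_Sig refl])

lemma measurable_to_borel_Sig: "measurable N borel_Sig = measurable N (leb_I \<Otimes>\<^sub>M borel)"
  by (rule measurable_cong_sets[OF refl sets_borel_Sig])

lemma sigma_finite_leb_I: "sigma_finite_measure leb_I"
  unfolding leb_I_def
  by (rule finite_measure.axioms(1)) (auto intro!: finite_measureI simp: emeasure_restrict_space space_restrict_space)

section \<open>Jordan decompositions of differences of finite measures\<close>

text \<open>An equality of two differences of measures is written with sums because subtraction of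
  \<open>ennreal\<close> is truncated; every step of the induction on \<open>h\<close> then
  preserves it.\<close>

lemma nn_integral_measure_sum_eq:
  assumes sets: "sets B = sets A" "sets C = sets A" "sets D = sets A"
    and eq: "\<And>E. E \<in> sets A \<Longrightarrow> emeasure A E + emeasure B E = emeasure C E + emeasure D E"
    and h: "h \<in> borel_measurable A"
  shows "(\<integral>\<^sup>+x. h x \<partial>A) + (\<integral>\<^sup>+x. h x \<partial>B) = (\<integral>\<^sup>+x. h x \<partial>C) + (\<integral>\<^sup>+x. h x \<partial>D)"
  using h
proof (induction rule: borel_measurable_induct)
  case (cong f g)
  have sp: "space B = space A" "space C = space A" "space D = space A"
    using sets by (auto dest: sets_eq_imp_space_eq)
  have "(\<integral>\<^sup>+x. f x \<partial>X) = (\<integral>\<^sup>+x. g x \<partial>X)" if "space X = space A" for X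
    by (rule nn_integral_cong) (use cong that in auto)
  then show ?case using cong sp by simp
next
  case (set E)
  then show ?case using eq[of E] sets by simp
next
  case (mult u c)
  have *: "(\<integral>\<^sup>+x. c * u x \<partial>X) = c * (\<integral>\<^sup>+x. u x \<partial>X)" if "sets X = sets A" for X
    using mult that by (intro nn_integral_cmult) (auto cong: measurable_cong_sets)
  show ?case using mult.IH
    unfolding *[OF refl] *[OF sets(1)] *[OF sets(2)] *[OF sets(3)] by (metis distrib_left)
next
  case (add u v)
  have *: "(\<integral>\<^sup>+x. v x + u x \<partial>X) = (\<integral>\<^sup>+x. v x \<partial>X) + (\<integral>\<^sup>+x. u x \<partial>X)" if "sets X = sets A" for X
    using add that by (intro nn_integral_add) (auto cong: measurable_cong_sets)
  have "(a + b) + (c + d) = (a + c) + (b + d)" for a b c d :: ennreal by (simp add: ac_simps)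
  then show ?case using add.IH
    unfolding *[OF refl] *[OF sets(1)] *[OF sets(2)] *[OF sets(3)] by metis
next
  case (seq U)
  have *: "(\<integral>\<^sup>+x. Sup (range U) x \<partial>X) = (SUP i. \<integral>\<^sup>+x. U i x \<partial>X)" if "sets X = sets A" for X
    unfolding SUP_apply
    by (rule nn_integral_monotone_convergence_SUP) (use seq that in \<open>auto cong: measurable_cong_sets\<close>)
  have inc: "incseq (\<lambda>i. \<integral>\<^sup>+x. U i x \<partial>X)" for X
    using seq(3) by (auto simp: incseq_def le_fun_def intro!: nn_integral_mono)
  show ?case
    unfolding *[OF refl] *[OF sets(1)] *[OF sets(2)] *[OF sets(3)]
    using seq.IH by (simp add: ennreal_SUP_add[OF inc inc, symmetric])
qed

text \<open>Adding \<open>\<bar>K\<bar>\<close> makes \<open>h\<close> nonnegative, so that the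
  \<open>ennreal\<close> identity applies; the identity for the total masses cancels the
  shift.\<close>

lemma integral_measure_diff_eq:
  fixes h :: "'a \<Rightarrow> real"
  assumes sets: "sets B = sets A" "sets C = sets A" "sets D = sets A"
    and fin: "finite_measure A" "finite_measure B" "finite_measure C" "finite_measure D"
    and eq: "\<And>E. E \<in> sets A \<Longrightarrow> emeasure A E + emeasure B E = emeasure C E + emeasure D E"
    and h: "h \<in> borel_measurable A" and bound: "\<And>x. x \<in> space A \<Longrightarrow> \<bar>h x\<bar> \<le> K"
  shows "(\<integral>x. h x \<partial>A) - (\<integral>x. h x \<partial>D) = (\<integral>x. h x \<partial>C) - (\<integral>x. h x \<partial>B)"
proof -
  have K0: "0 \<le> \<bar>K\<bar>" by simp
  have X: "space X = space A" "h \<in> borel_measurable X" if "sets X = sets A" for X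
    using h that sets_eq_imp_space_eq[OF that] by (auto cong: measurable_cong_sets)
  have int: "integrable X h" if "sets X = sets A" "finite_measure X" for X
    by (rule finite_measure.integrable_const_bound[OF that(2), where B=K])
       (use X[OF that(1)] bound in auto)
  have I: "(\<integral>x. h x \<partial>X) = enn2real (\<integral>\<^sup>+x. ennreal (h x + \<bar>K\<bar>) \<partial>X) - \<bar>K\<bar> * measure X (space A)"
    and F: "(\<integral>\<^sup>+x. ennreal (h x + \<bar>K\<bar>) \<partial>X) < \<infinity>"
    if "sets X = sets A" "finite_measure X" for X
  proof -
    interpret finite_measure X by fact
    have nn: "AE x in X. 0 \<le> h x + \<bar>K\<bar>" using bound X[OF that(1)] by (intro AE_I2) force
    have i: "integrable X (\<lambda>x. h x + \<bar>K\<bar>)" using int[OF that] by simp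
    have "(\<integral>x. h x + \<bar>K\<bar> \<partial>X) = (\<integral>x. h x \<partial>X) + \<bar>K\<bar> * measure X (space A)"
      using int[OF that] X[OF that(1)] by simp
    moreover have "(\<integral>x. h x + \<bar>K\<bar> \<partial>X) = enn2real (\<integral>\<^sup>+x. ennreal (h x + \<bar>K\<bar>) \<partial>X)"
      using i nn by (intro integral_eq_nn_integral) auto
    ultimately show "(\<integral>x. h x \<partial>X) = enn2real (\<integral>\<^sup>+x. ennreal (h x + \<bar>K\<bar>) \<partial>X) - \<bar>K\<bar> * measure X (space A)" by simp
    show "(\<integral>\<^sup>+x. ennreal (h x + \<bar>K\<bar>) \<partial>X) < \<infinity>"
      using nn_integral_eq_integral[OF i nn] by simp
  qed
  have nnI: "(\<integral>\<^sup>+x. ennreal (h x + \<bar>K\<bar>) \<partial>A) + (\<integral>\<^sup>+x. ennreal (h x + \<bar>K\<bar>) \<partial>B)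
     = (\<integral>\<^sup>+x. ennreal (h x + \<bar>K\<bar>) \<partial>C) + (\<integral>\<^sup>+x. ennreal (h x + \<bar>K\<bar>) \<partial>D)"
    by (rule nn_integral_measure_sum_eq[OF sets eq]) (use h in auto)
  then have 1: "enn2real (\<integral>\<^sup>+x. ennreal (h x + \<bar>K\<bar>) \<partial>A) + enn2real (\<integral>\<^sup>+x. ennreal (h x + \<bar>K\<bar>) \<partial>B)
     = enn2real (\<integral>\<^sup>+x. ennreal (h x + \<bar>K\<bar>) \<partial>C) + enn2real (\<integral>\<^sup>+x. ennreal (h x + \<bar>K\<bar>) \<partial>D)"
    using F[OF refl fin(1)] F[OF sets(1) fin(2)] F[OF sets(2) fin(3)] F[OF sets(3) fin(4)]
    by (simp add: enn2real_plus[symmetric])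
  have "emeasure A (space A) + emeasure B (space A) = emeasure C (space A) + emeasure D (space A)"
    by (rule eq) simp
  then have 2: "measure A (space A) + measure B (space A) = measure C (space A) + measure D (space A)"
    using fin by (simp add: finite_measure.emeasure_eq_measure ennreal_plus[symmetric] del: ennreal_plus)
  show ?thesis
    using 1 I[OF refl fin(1)] I[OF sets(1) fin(2)] I[OF sets(2) fin(3)] I[OF sets(3) fin(4)]
      arg_cong[OF 2, of "\<lambda>t. \<bar>K\<bar> * t"] by (simp add: distrib_left)
qed

text \<open>\<open>measure_of\<close> yields the intended values only for a set function that is
  already a measure. The upper variation is therefore recognised as the genuine measure
  \<open>P\<close>, the difference of \<open>M1\<close> and \<open>M2\<close> restricted to the Hahn
  set \<open>Y\<close>.\<close>

lemma jordan_pos_of_Hahn: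
  fixes M1 M2 :: "'a measure"
  assumes fin: "finite_measure M1" "finite_measure M2" and sets: "sets M1 = sets M" "sets M2 = sets M"
    and \<nu>: "\<forall>A\<in>sets M. \<nu> A = measure M1 A - measure M2 A"
    and Y: "Y \<in> sets M" "\<forall>X\<in>sets M. X \<subseteq> Y \<longrightarrow> measure M2 X \<le> measure M1 X"
      "\<forall>X\<in>sets M. X \<inter> Y = {} \<longrightarrow> measure M1 X \<le> measure M2 X"
  shows "finite_measure (jordan_pos M \<nu>)" "sets (jordan_pos M \<nu>) = sets M"
    "\<And>A. A \<in> sets M \<Longrightarrow> measure (jordan_pos M \<nu>) A = measure M1 (A \<inter> Y) - measure M2 (A \<inter> Y)"
proof -
  interpret M1: finite_measure M1 by fact
  interpret M2: finite_measure M2 by fact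
  define R1 R2 where "R1 = density M1 (indicator Y)" and "R2 = density M2 (indicator Y)"
  have R: "emeasure R1 A = emeasure M1 (A \<inter> Y)" "emeasure R2 A = emeasure M2 (A \<inter> Y)" if "A \<in> sets M" for A
    using that Y sets by (simp_all add: R1_def R2_def emeasure_restricted Int_commute)
  have Rs: "sets R1 = sets M" "sets R2 = sets M" by (simp_all add: R1_def R2_def sets)
  have le: "emeasure R2 A \<le> emeasure R1 A" if "A \<in> sets M" for A
    using Y(2)[rule_format, of "A \<inter> Y"] that Y(1) R by (simp add: M1.emeasure_eq_measure M2.emeasure_eq_measure)
  define P where "P = diff_measure R1 R2"
  have fR: "finite_measure R1" "finite_measure R2"
    using R[of "space M"] sets_eq_imp_space_eq[OF Rs(1)] sets_eq_imp_space_eq[OF Rs(2)]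
    by (auto intro!: finite_measureI)
  have P: "emeasure P A = ennreal (measure M1 (A \<inter> Y) - measure M2 (A \<inter> Y))" if "A \<in> sets M" for A
    using emeasure_diff_measure[of R1 R2 A] fR Rs le that R
    by (simp add: P_def M1.emeasure_eq_measure M2.emeasure_eq_measure ennreal_minus)
  have Ps: "sets P = sets M" by (simp add: P_def sets_diff_measure Rs)
  \<comment> \<open>The supremum is attained at \<open>A \<inter> Y\<close>: removing
    \<open>B - Y\<close> from \<open>B\<close> and then adding \<open>A \<inter> Y - B\<close> can
    only increase the value.\<close>
  have sup: "(SUP B\<in>{B\<in>sets M. B \<subseteq> A}. ennreal (\<nu> B)) = emeasure P A" if A: "A \<in> sets M" for A
  proof (rule antisym)
    show "emeasure P A \<le> (SUP B\<in>{B\<in>sets M. B \<subseteq> A}. ennreal (\<nu> B))"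
      by (rule SUP_upper2[of "A \<inter> Y"]) (use A Y(1) P \<nu> in auto)
    show "(SUP B\<in>{B\<in>sets M. B \<subseteq> A}. ennreal (\<nu> B)) \<le> emeasure P A"
    proof (rule SUP_least)
      fix B assume "B \<in> {B\<in>sets M. B \<subseteq> A}"
      then have B: "B \<in> sets M" "B \<subseteq> A" by auto
      have split: "measure X E = measure X (E \<inter> Y) + measure X (E - Y)" if "finite_measure X" "sets X = sets M" "E \<in> sets M" for X E
        using finite_measure.finite_measure_Union[OF that(1), of "E \<inter> Y" "E - Y"] that Y(1)
        by (simp add: Int_Diff_Un Int_Diff_disjoint)
      have 1: "measure M1 (B - Y) \<le> measure M2 (B - Y)" using Y(3)[rule_format, of "B - Y"] B Y(1) by auto
      have 2: "measure M2 (A \<inter> Y - B) \<le> measure M1 (A \<inter> Y - B)" using Y(2)[rule_format, of "A \<inter> Y - B"] A B Y(1) by auto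
      have 3: "measure X (A \<inter> Y) = measure X (B \<inter> Y) + measure X (A \<inter> Y - B)" if "finite_measure X" "sets X = sets M" for X
      proof -
        have "measure X ((B \<inter> Y) \<union> (A \<inter> Y - B)) = measure X (B \<inter> Y) + measure X (A \<inter> Y - B)"
          by (rule finite_measure.finite_measure_Union[OF that(1)]) (use that A B Y(1) in auto)
        moreover have "(B \<inter> Y) \<union> (A \<inter> Y - B) = A \<inter> Y" using B by auto
        ultimately show ?thesis by simp
      qed
      have "\<nu> B \<le> measure M1 (A \<inter> Y) - measure M2 (A \<inter> Y)"
        using 1 2 3[OF fin(1) sets(1)] 3[OF fin(2) sets(2)] split[OF fin(1) sets(1) B(1)] split[OF fin(2) sets(2) B(1)] bspec[OF \<nu> B(1)]
        by linarith
      then show "ennreal (\<nu> B) \<le> emeasure P A" using P[OF A] by (simp add: ennreal_leI)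
    qed
  qed
  have eq: "jordan_pos M \<nu> = P"
  proof -
    have "jordan_pos M \<nu> = measure_of (space M) (sets M) (emeasure P)"
      unfolding jordan_pos_def
      by (rule measure_of_eq) (use sup sets.space_closed in \<open>auto simp: sets.sigma_sets_eq\<close>)
    also have "\<dots> = P" using measure_of_of_measure[of P] Ps sets_eq_imp_space_eq[OF Ps] by simp
    finally show ?thesis .
  qed
  show "sets (jordan_pos M \<nu>) = sets M" by (simp add: eq Ps)
  show "finite_measure (jordan_pos M \<nu>)"
    unfolding eq by (rule finite_measureI) (use P[of "space M"] sets_eq_imp_space_eq[OF Ps] in auto)
  show "measure (jordan_pos M \<nu>) A = measure M1 (A \<inter> Y) - measure M2 (A \<inter> Y)" if "A \<in> sets M" for A
    using P[OF that] Y(2)[rule_format, of "A \<inter> Y"] Y(1) that by (simp add: eq measure_def)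
qed

text \<open>\<open>M1\<close> and \<open>M2\<close> are any representation of \<open>\<nu>\<close>,
  and the Jordan parts are the minimal one. The resulting domination is what carries null sets, and
  so absolute continuity of marginals, over to the Jordan parts. The negative part uses the
  complement of the Hahn set.\<close>

lemma jordan_difference:
  fixes M1 M2 :: "'a measure"
  assumes fin: "finite_measure M1" "finite_measure M2" and sets: "sets M1 = sets M" "sets M2 = sets M"
    and \<nu>: "\<forall>A\<in>sets M. \<nu> A = measure M1 A - measure M2 A"
  shows "finite_measure (jordan_pos M \<nu>)" "finite_measure (jordan_neg M \<nu>)"
    and "sets (jordan_pos M \<nu>) = sets M" "sets (jordan_neg M \<nu>) = sets M"
    and "\<And>A. A \<in> sets M \<Longrightarrow> measure (jordan_pos M \<nu>) A \<le> measure M1 A"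
      "\<And>A. A \<in> sets M \<Longrightarrow> measure (jordan_neg M \<nu>) A \<le> measure M2 A"
    and "\<And>A. A \<in> sets M \<Longrightarrow> measure (jordan_pos M \<nu>) A - measure (jordan_neg M \<nu>) A = \<nu> A"
proof -
  interpret M1: finite_measure M1 by fact
  interpret M2: finite_measure M2 by fact
  obtain Y where Y: "Y \<in> sets M" "\<forall>X\<in>sets M. X \<subseteq> Y \<longrightarrow> measure M2 X \<le> measure M1 X"
      "\<forall>X\<in>sets M. X \<inter> Y = {} \<longrightarrow> measure M1 X \<le> measure M2 X"
  proof -
    have "sets M2 = sets M1" using sets by simp
    from finite_unsigned_Hahn_decomposition[OF fin this] obtain Y where "Y \<in> sets M1"
      "\<forall>X\<in>sets M1. X \<subseteq> Y \<longrightarrow> emeasure M2 X \<le> emeasure M1 X"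
      "\<forall>X\<in>sets M1. X \<inter> Y = {} \<longrightarrow> emeasure M1 X \<le> emeasure M2 X" by blast
    then show ?thesis
      by (intro that[of Y]) (simp_all add: M1.emeasure_eq_measure M2.emeasure_eq_measure sets)
  qed
  note P = jordan_pos_of_Hahn[OF fin sets \<nu> Y]
  let ?Z = "space M - Y"
  have N: "finite_measure (jordan_neg M \<nu>)" "sets (jordan_neg M \<nu>) = sets M"
    "\<And>A. A \<in> sets M \<Longrightarrow> measure (jordan_neg M \<nu>) A = measure M2 (A \<inter> ?Z) - measure M1 (A \<inter> ?Z)"
    unfolding jordan_neg_def
  proof -
    have a: "\<forall>A\<in>sets M. - \<nu> A = measure M2 A - measure M1 A" using \<nu> by simp
    have b: "\<forall>X\<in>sets M. X \<subseteq> ?Z \<longrightarrow> measure M1 X \<le> measure M2 X"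
      using Y(3) by blast
    have c: "\<forall>X\<in>sets M. X \<inter> ?Z = {} \<longrightarrow> measure M2 X \<le> measure M1 X"
      using Y(2) sets.sets_into_space by blast
    have Z: "?Z \<in> sets M" using Y(1) by auto
    note H = jordan_pos_of_Hahn[OF fin(2,1) sets(2,1), where \<nu>="\<lambda>A. - \<nu> A", OF a Z b c]
    show "finite_measure (jordan_pos M (\<lambda>A. - \<nu> A))" by (rule H(1))
    show "sets (jordan_pos M (\<lambda>A. - \<nu> A)) = sets M" by (rule H(2))
    show "\<And>A. A \<in> sets M \<Longrightarrow> measure (jordan_pos M (\<lambda>A. - \<nu> A)) A = measure M2 (A \<inter> ?Z) - measure M1 (A \<inter> ?Z)"
      by (rule H(3))
  qed
  show "finite_measure (jordan_pos M \<nu>)" by (rule P(1))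
  show "sets (jordan_pos M \<nu>) = sets M" by (rule P(2))
  show "finite_measure (jordan_neg M \<nu>)" by (rule N(1))
  show "sets (jordan_neg M \<nu>) = sets M" by (rule N(2))
  fix A assume A: "A \<in> sets M"
  have Z: "A \<inter> ?Z = A - Y" using sets.sets_into_space[OF A] by auto
  have split: "measure X A = measure X (A \<inter> Y) + measure X (A - Y)" if "finite_measure X" "sets X = sets M" for X
    using finite_measure.finite_measure_Union[OF that(1), of "A \<inter> Y" "A - Y"] that Y(1) A
    by (simp add: Int_Diff_Un Int_Diff_disjoint)
  note S = split[OF fin(1) sets(1)] split[OF fin(2) sets(2)]
  show "measure (jordan_pos M \<nu>) A - measure (jordan_neg M \<nu>) A = \<nu> A"
    using P(3)[OF A] N(3)[OF A] S bspec[OF \<nu> A] by (simp add: Z)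
  have nn: "0 \<le> measure X E" for X E by simp
  show "measure (jordan_pos M \<nu>) A \<le> measure M1 A"
    using P(3)[OF A] S nn[of M1 "A - Y"] nn[of M2 "A \<inter> Y"] by linarith
  show "measure (jordan_neg M \<nu>) A \<le> measure M2 A"
    using N(3)[OF A] S nn[of M1 "A - Y"] nn[of M2 "A \<inter> Y"] unfolding Z by linarith
qed

lemma signed_measure_difference:
  assumes fin: "finite_measure M1" "finite_measure M2" and sets: "sets M1 = sets M" "sets M2 = sets M"
    and \<nu>: "\<forall>A\<in>sets M. \<nu> A = measure M1 A - measure M2 A"
  shows "signed_measure M \<nu>"
  unfolding signed_measure_def
proof (intro conjI allI impI)
  show "\<nu> {} = 0" by (simp add: \<nu>)
  fix A :: "nat \<Rightarrow> 'a set" assume A: "range A \<subseteq> sets M" "disjoint_family A"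
  have "(\<lambda>n. measure M1 (A n) - measure M2 (A n)) sums (measure M1 (\<Union>n. A n) - measure M2 (\<Union>n. A n))"
    by (intro sums_diff finite_measure.finite_measure_UNION fin) (use A sets in auto)
  moreover have "\<nu> (A n) = measure M1 (A n) - measure M2 (A n)" for n using A \<nu> by auto
  moreover have "\<nu> (\<Union>n. A n) = measure M1 (\<Union>n. A n) - measure M2 (\<Union>n. A n)"
    using A \<nu> by (simp add: sets.countable_UN)
  ultimately show "(\<lambda>n. \<nu> (A n)) sums \<nu> (\<Union>n. A n)" by simp
qed

text \<open>Integration against \<open>\<nu>\<close> may be done with whichever pair of measures is
  convenient, since that pair and the Jordan parts satisfy the four-measure identity.\<close>

lemma integral_jordan_difference:
  fixes h :: "'a \<Rightarrow> real"
  assumes fin: "finite_measure M1" "finite_measure M2" and sets: "sets M1 = sets M" "sets M2 = sets M"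
    and \<nu>: "\<forall>A\<in>sets M. \<nu> A = measure M1 A - measure M2 A"
    and h: "h \<in> borel_measurable M" "\<And>x. x \<in> space M \<Longrightarrow> \<bar>h x\<bar> \<le> K"
  shows "signed_integral M \<nu> h = (\<integral>x. h x \<partial>M1) - (\<integral>x. h x \<partial>M2)"
proof -
  note J = jordan_difference[OF fin sets \<nu>]
  have eq: "emeasure (jordan_pos M \<nu>) E + emeasure M2 E = emeasure M1 E + emeasure (jordan_neg M \<nu>) E"
    if "E \<in> sets M" for E
    using J(7)[OF that] bspec[OF \<nu> that] J(1,2) fin
    by (simp add: finite_measure.emeasure_eq_measure ennreal_plus[symmetric] del: ennreal_plus)
  show ?thesis unfolding signed_integral_def
    by (rule integral_measure_diff_eq[where K=K])
       (use J(1-4) fin sets eq h sets_eq_imp_space_eq[OF J(3)] in \<open>auto cong: measurable_cong_sets\<close>)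
qed

lemma W_norm_difference_le:
  fixes M1 M2 :: "'k::polish_space measure"
  assumes fin: "finite_measure M1" "finite_measure M2" and sets: "sets M1 = sets borel" "sets M2 = sets borel"
  shows "W_norm (\<lambda>A. measure M1 A - measure M2 A) \<le> ennreal (measure M1 UNIV + measure M2 UNIV)"
  unfolding W_norm_def
proof (rule SUP_least)
  fix h :: "'k \<Rightarrow> real" assume "h \<in> {h. lipschitz_on 1 UNIV h \<and> (\<forall>y. \<bar>h y\<bar> \<le> 1)}"
  then have h: "h \<in> borel_measurable borel" "\<And>y. \<bar>h y\<bar> \<le> 1"
    by (auto intro: borel_measurable_continuous_onI lipschitz_on_continuous_on)
  have b: "\<bar>\<integral>x. h x \<partial>X\<bar> \<le> measure X UNIV" if "finite_measure X" "sets X = sets borel" for X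
  proof -
    interpret finite_measure X by fact
    have "space X = UNIV" using sets_eq_imp_space_eq[OF that(2)] by simp
    moreover have "integrable X h"
      by (rule integrable_const_bound[where B=1]) (use h that in \<open>auto cong: measurable_cong_sets\<close>)
    ultimately show ?thesis
      using order_trans[OF integral_abs_bound[of X h] integral_mono[of X "\<lambda>x. \<bar>h x\<bar>" "\<lambda>_. 1"]] h by simp
  qed
  have "signed_integral borel (\<lambda>A. measure M1 A - measure M2 A) h = (\<integral>x. h x \<partial>M1) - (\<integral>x. h x \<partial>M2)"
    by (rule integral_jordan_difference[OF fin sets, where K=1]) (use h in auto)
  then have "\<bar>signed_integral borel (\<lambda>A. measure M1 A - measure M2 A) h\<bar> \<le> measure M1 UNIV + measure M2 UNIV"
    using b[OF fin(1) sets(1)] b[OF fin(2) sets(2)] by linarith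
  then show "ennreal \<bar>signed_integral borel (\<lambda>A. measure M1 A - measure M2 A) h\<bar> \<le> ennreal (measure M1 UNIV + measure M2 UNIV)"
    by (rule ennreal_leI)
qed

text \<open>Duality with the admissible test function \<open>h / c\<close>; for \<open>c = 0\<close>
  the function \<open>h\<close> vanishes.\<close>

lemma W_norm_difference_ge:
  fixes M1 M2 :: "'k::polish_space measure"
  assumes fin: "finite_measure M1" "finite_measure M2" and sets: "sets M1 = sets borel" "sets M2 = sets borel"
    and h: "0 \<le> c" "\<And>y. \<bar>h y\<bar> \<le> c" "\<And>y z. \<bar>h y - h z\<bar> \<le> c * dist y z"
  shows "ennreal \<bar>(\<integral>y. h y \<partial>M1) - (\<integral>y. h y \<partial>M2)\<bar> \<le> ennreal c * W_norm (\<lambda>A. measure M1 A - measure M2 A)"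
proof (cases "c = 0")
  case True
  then have "h y = 0" for y using h(2)[of y] by simp
  then show ?thesis by simp
next
  case False
  then have c: "0 < c" using h(1) by simp
  define h' where "h' y = h y / c" for y
  have lip: "lipschitz_on 1 UNIV h'"
  proof (rule lipschitz_onI)
    show "dist (h' y) (h' z) \<le> 1 * dist y z" for y z
      using h(3)[of y z] c by (simp add: h'_def dist_real_def diff_divide_distrib[symmetric] divide_le_eq mult.commute)
  qed simp
  have b: "\<bar>h' y\<bar> \<le> 1" for y using h(2)[of y] c by (simp add: h'_def divide_le_eq)
  have meas: "h' \<in> borel_measurable borel"
    using lip by (intro borel_measurable_continuous_onI lipschitz_on_continuous_on)
  have "ennreal \<bar>signed_integral borel (\<lambda>A. measure M1 A - measure M2 A) h'\<bar> \<le> W_norm (\<lambda>A. measure M1 A - measure M2 A)"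
    unfolding W_norm_def by (rule SUP_upper) (use lip b in auto)
  moreover have "signed_integral borel (\<lambda>A. measure M1 A - measure M2 A) h' = (\<integral>y. h' y \<partial>M1) - (\<integral>y. h' y \<partial>M2)"
    by (rule integral_jordan_difference[OF fin sets, where K=1]) (use meas b in auto)
  moreover have "\<dots> = ((\<integral>y. h y \<partial>M1) - (\<integral>y. h y \<partial>M2)) / c"
    by (simp add: h'_def diff_divide_distrib)
  ultimately have "ennreal (\<bar>(\<integral>y. h y \<partial>M1) - (\<integral>y. h y \<partial>M2)\<bar> / c) \<le> W_norm (\<lambda>A. measure M1 A - measure M2 A)"
    using c by simp
  then have "ennreal c * ennreal (\<bar>(\<integral>y. h y \<partial>M1) - (\<integral>y. h y \<partial>M2)\<bar> / c) \<le> ennreal c * W_norm (\<lambda>A. measure M1 A - measure M2 A)"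
    by (rule mult_left_mono) simp
  then show ?thesis using c by (simp add: ennreal_mult'[symmetric])
qed

section \<open>Existence of disintegrations\<close>

text \<open>The point of the Cantor set with ternary digits 0 and 2. Unlike binary expansions, these
  codes determine their digits, because sequences that differ in the first digit are separated by
  the middle gap.\<close>

definition cantor_encode :: "(nat \<Rightarrow> bool) \<Rightarrow> real" where
  "cantor_encode b = (\<Sum>n. if b n then 2 / 3 ^ Suc n else 0)"

text \<open>The \<open>n\<close>-th iterate of the expanding map of the Cantor set, which deletes
  the leading digit. The threshold 1/2 lies in the gap between 1/3 and 2/3; the map is defined on
  all reals so as to be plainly Borel.\<close>

primrec cantor_shift :: "nat \<Rightarrow> real \<Rightarrow> real" where
  "cantor_shift 0 t = t"
| "cantor_shift (Suc n) t =
     3 * cantor_shift n t - (if 1 / 2 \<le> cantor_shift n t then 2 else 0)"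

lemma cantor_geometric: "(\<lambda>n. 2 / 3 ^ Suc n :: real) sums 1"
proof -
  have "(\<lambda>n. (2/3) * (1/3) ^ n :: real) sums ((2/3) * (1 / (1 - 1/3)))"
    by (intro sums_mult geometric_sums) simp
  then show ?thesis by (simp add: power_one_over field_simps)
qed

lemma cantor_summable: "summable (\<lambda>n. if b n then 2 / 3 ^ Suc n else 0 :: real)"
  by (rule summable_comparison_test'[OF sums_summable[OF cantor_geometric]]) auto

lemma cantor_encode_range: "0 \<le> cantor_encode b" "cantor_encode b \<le> 1"
proof -
  show "0 \<le> cantor_encode b"
    unfolding cantor_encode_def by (rule suminf_nonneg[OF cantor_summable]) auto
  have "cantor_encode b \<le> (\<Sum>n. 2 / 3 ^ Suc n)"
    unfolding cantor_encode_def
    by (rule suminf_le[OF _ cantor_summable sums_summable[OF cantor_geometric]]) auto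
  then show "cantor_encode b \<le> 1" using cantor_geometric by (simp add: sums_iff)
qed

lemma cantor_encode_step:
  "cantor_encode b = (if b 0 then 2 / 3 else 0) + cantor_encode (\<lambda>n. b (Suc n)) / 3"
proof -
  have "cantor_encode b = (\<Sum>n. if b (n + 1) then 2 / 3 ^ Suc (n + 1) else 0) + (if b 0 then 2 / 3 else 0)"
    unfolding cantor_encode_def by (subst suminf_split_initial_segment[OF cantor_summable, of _ 1]) simp
  also have "(\<Sum>n. if b (n + 1) then 2 / 3 ^ Suc (n + 1) else (0::real))
     = (\<Sum>n. (if b (Suc n) then 2 / 3 ^ Suc n else 0) / 3)"
    by (rule suminf_cong) simp
  also have "\<dots> = cantor_encode (\<lambda>n. b (Suc n)) / 3"
    unfolding cantor_encode_def by (rule suminf_divide[OF cantor_summable])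
  finally show ?thesis by simp
qed

lemma cantor_encode_digit: "1 / 2 \<le> cantor_encode b \<longleftrightarrow> b 0"
  using cantor_encode_step[of b] cantor_encode_range[of "\<lambda>n. b (Suc n)"] by auto

lemma cantor_shift_encode: "cantor_shift n (cantor_encode b) = cantor_encode (\<lambda>i. b (i + n))"
proof (induction n)
  case (Suc n)
  show ?case
    using Suc cantor_encode_digit[of "\<lambda>i. b (i + n)"] cantor_encode_step[of "\<lambda>i. b (i + n)"] by simp
qed simp

lemma cantor_shift_measurable [measurable]: "cantor_shift n \<in> borel_measurable borel"
proof (induction n)
  case (Suc n)
  have [measurable]: "cantor_shift n \<in> borel_measurable borel" by fact
  show ?case unfolding cantor_shift.simps by measurable
qed simp

text \<open>
  A point is coded by the balls of radius \<open>2\<^sup>-\<^sup>j\<close> around a dense sequence that contain it; decoding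
  takes the first such centre for each \<open>j\<close> and passes to the limit.
\<close>

lemma real_coding_exists:
  obtains \<sigma> :: "'k::polish_space \<Rightarrow> real" and g :: "real \<Rightarrow> 'k"
  where "\<sigma> \<in> borel_measurable borel" "g \<in> borel_measurable borel" "\<And>y. g (\<sigma> y) = y"
    "\<And>y. 0 \<le> \<sigma> y" "\<And>y. \<sigma> y \<le> 1"
proof -
  obtain X :: "'k set" where X: "countable X" "\<And>U. open U \<Longrightarrow> U \<noteq> {} \<Longrightarrow> \<exists>d\<in>X. d \<in> U"
    using countable_dense_setE by blast
  have "X \<noteq> {}" using X(2)[of UNIV] by auto
  define d where "d = from_nat_into X"
  have dense: "\<exists>i. dist y (d i) < e" if "0 < e" for y e
  proof -
    have "ball y e \<noteq> {}" using that by auto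
    then obtain x where x: "x \<in> X" "x \<in> ball y e" using X(2)[OF open_ball] by blast
    then obtain i where "d i = x" using from_nat_into_surj[OF X(1)] unfolding d_def by blast
    then show ?thesis using x by auto
  qed
  define bit where "bit y n = (dist y (d (fst (prod_decode n))) < (1/2) ^ snd (prod_decode n))" for y n
  define \<sigma> where "\<sigma> y = cantor_encode (bit y)" for y
  define idx where "idx j t = (LEAST i. 1 / 2 \<le> cantor_shift (prod_encode (i, j)) t)" for j t
  define g0 where "g0 j t = d (idx j t)" for j t
  \<comment> \<open>Freezing the sequence where it is not Cauchy makes the limit exist at every
    real, also at those that code no point, so \<open>g\<close> is an everywhere limit of measurable
    functions.\<close>
  define g1 where "g1 j t = (if Cauchy (\<lambda>j. g0 j t) then g0 j t else d 0)" for j t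
  define g where "g t = lim (\<lambda>j. g1 j t)" for t
  have bm: "Measurable.pred borel (\<lambda>y. bit y n)" for n
    unfolding bit_def by measurable
  have \<sigma>m: "\<sigma> \<in> borel_measurable borel"
    unfolding \<sigma>_def cantor_encode_def
    by (intro borel_measurable_suminf measurable_If borel_measurable_const bm[unfolded pred_def])
  have idxm: "idx j \<in> measurable borel (count_space UNIV)" for j
    unfolding idx_def by measurable
  have g0m [measurable]: "g0 j \<in> borel_measurable borel" for j
    unfolding g0_def by (rule measurable_compose[OF idxm]) simp
  have g1m: "g1 j \<in> borel_measurable borel" for j
    unfolding g1_def using sets_Collect_Cauchy[of g0 borel] by (intro measurable_If) auto
  have "Cauchy (\<lambda>j. g1 j t)" for t
    by (cases "Cauchy (\<lambda>j. g0 j t)") (simp_all add: g1_def LIMSEQ_imp_Cauchy[OF tendsto_const])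
  then have lim: "(\<lambda>j. g1 j t) \<longlonglongrightarrow> g t" for t
    unfolding g_def using Cauchy_convergent convergent_LIMSEQ_iff by blast
  have gm: "g \<in> borel_measurable borel"
    by (rule borel_measurable_LIMSEQ_metric[OF g1m lim])
  have "g (\<sigma> y) = y" for y
  proof -
    have b: "1 / 2 \<le> cantor_shift n (\<sigma> y) \<longleftrightarrow> bit y n" for n
      using cantor_encode_digit[of "\<lambda>i. bit y (i + n)"] by (simp add: \<sigma>_def cantor_shift_encode)
    have close: "dist (g0 j (\<sigma> y)) y < (1/2) ^ j" for j
    proof -
      have "\<exists>i. bit y (prod_encode (i, j))" using dense[of "(1/2) ^ j" y] by (simp add: bit_def)
      then have "bit y (prod_encode (idx j (\<sigma> y), j))" unfolding idx_def b by (rule LeastI_ex)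
      then show ?thesis by (simp add: bit_def g0_def dist_commute)
    qed
    have "(\<lambda>j. dist (g0 j (\<sigma> y)) y) \<longlonglongrightarrow> 0"
    proof (rule tendsto_sandwich[where f="\<lambda>_. 0" and h="\<lambda>j. (1/2::real) ^ j"])
      show "(\<lambda>j. (1/2::real) ^ j) \<longlonglongrightarrow> 0" by (rule LIMSEQ_realpow_zero) auto
      show "eventually (\<lambda>j. dist (g0 j (\<sigma> y)) y \<le> (1/2) ^ j) sequentially"
        using close by (intro always_eventually allI less_imp_le)
    qed simp_all
    then have l0: "(\<lambda>j. g0 j (\<sigma> y)) \<longlonglongrightarrow> y" by (rule tendsto_dist_iff[THEN iffD2])
    then have "Cauchy (\<lambda>j. g0 j (\<sigma> y))" by (rule LIMSEQ_imp_Cauchy)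
    then have "(\<lambda>j. g1 j (\<sigma> y)) = (\<lambda>j. g0 j (\<sigma> y))" by (simp add: g1_def)
    then have "(\<lambda>j. g0 j (\<sigma> y)) \<longlonglongrightarrow> g (\<sigma> y)" using lim[of "\<sigma> y"] by simp
    then show ?thesis using l0 by (rule LIMSEQ_unique)
  qed
  moreover have "0 \<le> \<sigma> y" "\<sigma> y \<le> 1" for y unfolding \<sigma>_def by (rule cantor_encode_range)+
  ultimately show ?thesis by (rule that[OF \<sigma>m gm])
qed

text \<open>The inequality is tested on the set where \<open>H < K\<close>; finiteness of the
  integral of \<open>K\<close> permits subtraction there, and a nonnegative function with integral 0
  vanishes almost everywhere.\<close>

lemma AE_le_of_set_nn_integral_le:
  assumes fin: "finite_measure \<rho>"
    and m [measurable]: "K \<in> borel_measurable \<rho>" "H \<in> borel_measurable \<rho>"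
    and K: "(\<integral>\<^sup>+x. K x \<partial>\<rho>) < \<infinity>"
    and le: "\<And>A. A \<in> sets \<rho> \<Longrightarrow> (\<integral>\<^sup>+x. K x * indicator A x \<partial>\<rho>) \<le> (\<integral>\<^sup>+x. H x * indicator A x \<partial>\<rho>)"
  shows "AE x in \<rho>. K x \<le> H x"
proof -
  define B where "B = {x\<in>space \<rho>. H x < K x}"
  have B [measurable]: "B \<in> sets \<rho>" unfolding B_def by measurable
  have HK: "H x * indicator B x \<le> K x * indicator B x" for x
    by (auto simp: B_def split: split_indicator)
  have fK: "(\<integral>\<^sup>+x. K x * indicator B x \<partial>\<rho>) < \<infinity>"
    by (rule le_less_trans[OF nn_integral_mono K]) (auto split: split_indicator)
  have fH: "(\<integral>\<^sup>+x. H x * indicator B x \<partial>\<rho>) < \<infinity>"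
    by (rule le_less_trans[OF nn_integral_mono fK]) (rule HK)
  have "(\<integral>\<^sup>+x. K x * indicator B x - H x * indicator B x \<partial>\<rho>)
     = (\<integral>\<^sup>+x. K x * indicator B x \<partial>\<rho>) - (\<integral>\<^sup>+x. H x * indicator B x \<partial>\<rho>)"
    by (rule nn_integral_diff) (use fH HK in auto)
  also have "\<dots> = 0" using le[OF B] fH by (simp add: diff_eq_0_iff_ennreal)
  finally have "AE x in \<rho>. K x * indicator B x - H x * indicator B x = 0"
    by (subst (asm) nn_integral_0_iff_AE) auto
  then show ?thesis using AE_space
  proof (eventually_elim)
    case (elim x)
    show ?case
    proof (rule ccontr)
      assume n: "\<not> K x \<le> H x"
      then have "x \<in> B" using elim by (simp add: B_def)
      then show False using elim n by (simp add: diff_eq_0_iff_ennreal)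
    qed
  qed
qed

text \<open>
  The conditional distribution function is \<open>F x t = inf {G r x | r rational, r > t}\<close>, where \<open>G r\<close> is a
  version of the conditional probability of \<open>Y \<le> r\<close>. It is nondecreasing and right-continuous for
  every \<open>x\<close>, whatever the versions.
\<close>

lemma conditional_distribution_exists:
  fixes X :: "'a \<Rightarrow> 'b" and Y :: "'a \<Rightarrow> real"
  assumes fin: "finite_measure \<mu>" and X [measurable]: "X \<in> \<mu> \<rightarrow>\<^sub>M N"
    and Y [measurable]: "Y \<in> borel_measurable \<mu>" and range: "\<And>\<omega>. \<omega> \<in> space \<mu> \<Longrightarrow> 0 \<le> Y \<omega> \<and> Y \<omega> \<le> 1"
    and ne: "space N \<noteq> {}"
  obtains \<kappa> where "\<kappa> \<in> N \<rightarrow>\<^sub>M prob_algebra borel"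
    "\<And>E. E \<in> sets (N \<Otimes>\<^sub>M borel) \<Longrightarrow> emeasure \<mu> {\<omega>\<in>space \<mu>. (X \<omega>, Y \<omega>) \<in> E}
       = (\<integral>\<^sup>+x. emeasure (\<kappa> x) (Pair x -` E) \<partial>distr \<mu> N X)"
proof -
  interpret \<mu>: finite_measure \<mu> by fact
  define \<rho> where "\<rho> = distr \<mu> N X"
  interpret \<rho>: finite_measure \<rho> unfolding \<rho>_def by (rule \<mu>.finite_measure_distr) fact
  have s\<rho>: "sets \<rho> = sets N" "space \<rho> = space N" by (simp_all add: \<rho>_def)
  define R where "R r = {\<omega>\<in>space \<mu>. Y \<omega> \<le> r}" for r
  have Rm [measurable]: "R r \<in> sets \<mu>" for r unfolding R_def by measurable
  define \<nu> where "\<nu> r = distr (density \<mu> (indicator (R r))) N X" for r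
  have \<nu>e: "emeasure (\<nu> r) A = emeasure \<mu> (R r \<inter> (X -` A \<inter> space \<mu>))" if A: "A \<in> sets N" for r A
    using A measurable_sets[OF X A] by (simp add: \<nu>_def emeasure_distr emeasure_restricted)
  have \<rho>e: "emeasure \<rho> A = emeasure \<mu> (X -` A \<inter> space \<mu>)" if "A \<in> sets N" for A
    using that by (simp add: \<rho>_def emeasure_distr)
  have s\<nu>: "sets (\<nu> r) = sets \<rho>" for r by (simp add: \<nu>_def s\<rho>)
  have ac: "absolutely_continuous \<rho> (\<nu> r)" for r
    unfolding absolutely_continuous_def
  proof
    fix A assume "A \<in> null_sets \<rho>"
    then have "A \<in> sets N" "emeasure \<rho> A = 0" using s\<rho> by auto
    then have A: "A \<in> sets N" "emeasure \<mu> (X -` A \<inter> space \<mu>) = 0" using \<rho>e by simp_all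
    then have "emeasure (\<nu> r) A \<le> 0" unfolding \<nu>e[OF A(1)] A(2)[symmetric]
      by (intro emeasure_mono measurable_sets[OF X]) auto
    then show "A \<in> null_sets (\<nu> r)" using A(1) s\<nu> s\<rho> by (auto simp: null_sets_def)
  qed
  define H where "H r = RN_deriv \<rho> (\<nu> r)" for r
  have Hm [measurable]: "H r \<in> borel_measurable \<rho>" for r by (simp add: H_def)
  have Hint: "(\<integral>\<^sup>+x. H r x * indicator A x \<partial>\<rho>) = emeasure (\<nu> r) A" if A: "A \<in> sets N" for r A
    using \<rho>.density_RN_deriv[OF ac s\<nu>, of r] emeasure_density[of "H r" \<rho> A] A s\<rho> by (simp add: H_def)
  have \<nu>mono: "emeasure (\<nu> r) A \<le> emeasure (\<nu> r') A" if "r \<le> r'" "A \<in> sets N" for r r' A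
    unfolding \<nu>e[OF that(2)] using measurable_sets[OF X that(2)] that(1)
    by (intro emeasure_mono) (auto simp: R_def)
  have \<nu>le: "emeasure (\<nu> r) A \<le> emeasure \<rho> A" if "A \<in> sets N" for r A
    unfolding \<nu>e[OF that] \<rho>e[OF that] by (intro emeasure_mono measurable_sets[OF X that]) auto
  have H1: "AE x in \<rho>. H r x \<le> 1" for r
  proof (rule AE_le_of_set_nn_integral_le[OF \<rho>.finite_measure_axioms])
    have "(\<integral>\<^sup>+x. H r x \<partial>\<rho>) = (\<integral>\<^sup>+x. H r x * indicator (space N) x \<partial>\<rho>)"
      by (rule nn_integral_cong) (simp add: s\<rho>)
    also have "\<dots> \<le> emeasure \<rho> (space N)" using Hint[of "space N" r] \<nu>le[of "space N" r] by simp
    also have "emeasure \<rho> (space N) < \<infinity>"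
      using \<rho>.emeasure_finite[of "space N"] by (simp add: less_top[symmetric])
    finally show "(\<integral>\<^sup>+x. H r x \<partial>\<rho>) < \<infinity>" .
  qed (use Hint \<nu>le s\<rho> in auto)
  \<comment> \<open>The values outside \<open>[0, 1)\<close> and the truncation at 1 are imposed for
    every \<open>x\<close>, so that \<open>F x\<close> below is a distribution function of a
    probability on \<open>[0, 1]\<close> with no exceptional points.\<close>
  define G where "G r x = (if r < 0 then 0 else if 1 \<le> r then 1 else min 1 (enn2real (H r x)))" for r x
  have G01: "0 \<le> G r x" "G r x \<le> 1" for r x by (auto simp: G_def)
  have Gm [measurable]: "G r \<in> borel_measurable \<rho>" for r unfolding G_def by measurable
  have Gint: "(\<integral>\<^sup>+x. ennreal (G r x) * indicator A x \<partial>\<rho>) = emeasure (\<nu> r) A" if A: "A \<in> sets N" for r A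
  proof -
    consider "r < 0" | "1 \<le> r" | "0 \<le> r" "r < 1" by linarith
    then show ?thesis
    proof cases
      case 1
      then have "R r = {}" using range by (force simp: R_def)
      then show ?thesis using 1 \<nu>e[OF A] by (simp add: G_def)
    next
      case 2
      then have "R r = space \<mu>" using range by (force simp: R_def)
      then have "emeasure (\<nu> r) A = emeasure \<rho> A" using \<nu>e[OF A] \<rho>e[OF A] by (simp add: Int_absorb1)
      then show ?thesis using 2 A s\<rho> by (simp add: G_def)
    next
      case 3
      have "AE x in \<rho>. ennreal (G r x) * indicator A x = H r x * indicator A x"
        using H1[of r]
      proof eventually_elim
        case (elim x)
        then have "enn2real (H r x) \<le> 1" "ennreal (enn2real (H r x)) = H r x"
          by (auto simp: enn2real_leI ennreal_enn2real_if top_unique)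
        then show ?case using 3 by (simp add: G_def min_absorb2)
      qed
      then show ?thesis using nn_integral_cong_AE Hint[OF A] by metis
    qed
  qed
  have Gtot: "(\<integral>\<^sup>+x. ennreal (G r x) \<partial>\<rho>) < \<infinity>" for r
  proof -
    have "(\<integral>\<^sup>+x. ennreal (G r x) \<partial>\<rho>) \<le> (\<integral>\<^sup>+x. 1 \<partial>\<rho>)" by (intro nn_integral_mono) (simp add: G01)
    also have "\<dots> < \<infinity>" using \<rho>.emeasure_finite[of "space \<rho>"] by (simp add: less_top[symmetric])
    finally show ?thesis .
  qed
  have GG: "AE x in \<rho>. G t x \<le> G r x" if "t \<le> r" for t r
  proof -
    have "AE x in \<rho>. ennreal (G t x) \<le> ennreal (G r x)"
      by (rule AE_le_of_set_nn_integral_le[OF \<rho>.finite_measure_axioms])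
         (use Gtot Gint \<nu>mono[OF that] s\<rho> in auto)
    then show ?thesis by eventually_elim (simp add: G01)
  qed
  define Q where "Q t = {r\<in>\<rat>. t < (r::real)}" for t
  have Qc: "countable (Q t)" for t unfolding Q_def
    by (rule countable_subset[OF _ countable_rat]) auto
  have Qne: "Q t \<noteq> {}" for t using Rats_dense_in_real[of t "t + 1"] by (auto simp: Q_def)
  define F where "F x t = (INF r\<in>Q t. G r x)" for x t
  have bdd: "bdd_below ((\<lambda>r. G r x) ` S)" for x S by (rule bdd_belowI2[where m=0]) (rule G01)
  have Fle: "F x t \<le> G r x" if "r \<in> Q t" for x t r
    unfolding F_def by (rule cINF_lower[OF bdd that])
  have F0: "0 \<le> F x t" for x t unfolding F_def by (rule cINF_greatest[OF Qne]) (rule G01)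
  have F1: "F x t \<le> 1" for x t
  proof -
    obtain r where "r \<in> Q t" using Qne by blast
    then show ?thesis using Fle[of r t x] G01(2)[of r x] by linarith
  qed
  have Fmono: "F x t \<le> F x t'" if "t \<le> t'" for x t t'
    unfolding F_def by (rule cINF_superset_mono[OF Qne bdd]) (use that in \<open>auto simp: Q_def\<close>)
  have Fbot: "(F x \<longlongrightarrow> 0) at_bot" for x
  proof (rule tendsto_eventually)
    have "F x t = 0" if "t < 0" for t
    proof -
      obtain r where "r \<in> \<rat>" "t < r" "r < 0" using Rats_dense_in_real[OF \<open>t < 0\<close>] by blast
      then show ?thesis using Fle[of r t x] F0[of x t] by (simp add: Q_def G_def)
    qed
    then show "eventually (\<lambda>t. F x t = 0) at_bot"
      by (rule eventually_mono[OF eventually_gt_at_bot[of "0::real"]])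
  qed
  have Ftop: "(F x \<longlongrightarrow> 1) at_top" for x
  proof (rule tendsto_eventually)
    have "F x t = 1" if "1 \<le> t" for t
    proof -
      have "1 \<le> F x t" unfolding F_def
        by (rule cINF_greatest[OF Qne]) (use that in \<open>auto simp: Q_def G_def\<close>)
      then show ?thesis using F1[of x t] by simp
    qed
    then show "eventually (\<lambda>t. F x t = 1) at_top"
      by (rule eventually_mono[OF eventually_ge_at_top[of "1::real"]])
  qed
  have Frc: "continuous (at_right t) (F x)" for x t
    unfolding continuous_within
  proof (rule decreasing_tendsto)
    show "eventually (\<lambda>s. F x t \<le> F x s) (at t within {t<..})"
      unfolding eventually_at_filter by (rule always_eventually) (auto intro: Fmono)
    fix c assume "F x t < c"
    then obtain r where r: "r \<in> Q t" "G r x < c"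
      unfolding F_def using cINF_less_iff[OF Qne bdd] by blast
    have "F x s < c" if "s < r" for s
      using Fle[of r s x] r that by (auto simp: Q_def)
    moreover have "t < r" using r by (simp add: Q_def)
    ultimately show "eventually (\<lambda>s. F x s < c) (at t within {t<..})"
      unfolding eventually_at_right_field by blast
  qed
  have Fm [measurable]: "(\<lambda>x. F x t) \<in> borel_measurable \<rho>" for t
    unfolding F_def by (rule borel_measurable_cINF[OF Qc Gm bdd])
  define \<kappa> where "\<kappa> x = interval_measure (F x)" for x
  have \<kappa>p: "real_distribution (\<kappa> x)" for x
    unfolding \<kappa>_def by (rule real_distribution_interval_measure[OF Fmono Frc Fbot Ftop])
  have \<kappa>e: "emeasure (\<kappa> x) {..t} = ennreal (F x t)" for x t
    unfolding \<kappa>_def by (rule emeasure_interval_measure_Iic[OF Fmono Frc Fbot])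
  have gen: "sets (borel :: real measure) = sigma_sets UNIV (range atMost)"
    by (subst borel_eq_atMost) (simp add: image_def)
  have stable: "Int_stable (range (atMost :: real \<Rightarrow> _))"
    by (auto simp: Int_stable_def)
  have \<kappa>m': "\<kappa> \<in> \<rho> \<rightarrow>\<^sub>M prob_algebra borel"
  proof (rule measurable_prob_algebra_generated[OF gen stable])
    show "prob_space (\<kappa> x)" "sets (\<kappa> x) = sets borel" for x
      using \<kappa>p[of x] by (auto simp: real_distribution_def real_distribution_axioms_def)
    show "(\<lambda>x. emeasure (\<kappa> x) A) \<in> borel_measurable \<rho>" if "A \<in> range atMost" for A
      using that by (auto simp: \<kappa>e)
  qed auto
  then have \<kappa>m: "\<kappa> \<in> N \<rightarrow>\<^sub>M prob_algebra borel" using measurable_cong_sets[OF s\<rho>(1) refl] by blast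
  have \<kappa>sub: "\<kappa> \<in> \<rho> \<rightarrow>\<^sub>M subprob_algebra borel" using \<kappa>m' by (rule measurable_prob_algebraD)
  \<comment> \<open>From above, \<open>F x t\<close> is at most \<open>G r x\<close> for rationals
    \<open>r\<close> just beyond \<open>t\<close>, and the events \<open>R r\<close> decrease to
    \<open>R t\<close>. From below, almost surely \<open>G t x\<close> is at most all the countably
    many \<open>G r x\<close> that define \<open>F x t\<close>.\<close>
  have Fint: "(\<integral>\<^sup>+x. ennreal (F x t) * indicator A x \<partial>\<rho>) = emeasure (\<nu> t) A" if A: "A \<in> sets N" for t A
  proof (rule antisym)
    have ub: "(\<integral>\<^sup>+x. ennreal (F x t) * indicator A x \<partial>\<rho>) \<le> emeasure (\<nu> (t + inverse (real (Suc n)))) A" for n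
    proof -
      obtain r where r: "r \<in> \<rat>" "t < r" "r < t + inverse (real (Suc n))"
        using Rats_dense_in_real[of t "t + inverse (real (Suc n))"] by auto
      have "(\<integral>\<^sup>+x. ennreal (F x t) * indicator A x \<partial>\<rho>) \<le> (\<integral>\<^sup>+x. ennreal (G r x) * indicator A x \<partial>\<rho>)"
        using Fle[of r t] r by (intro nn_integral_mono mult_right_mono ennreal_leI) (auto simp: Q_def)
      also have "\<dots> = emeasure (\<nu> r) A" by (rule Gint[OF A])
      also have "\<dots> \<le> emeasure (\<nu> (t + inverse (real (Suc n)))) A" by (rule \<nu>mono) (use r A in auto)
      finally show ?thesis .
    qed
    define S where "S n = R (t + inverse (real (Suc n))) \<inter> (X -` A \<inter> space \<mu>)" for n
    have "(\<lambda>n. emeasure \<mu> (S n)) \<longlonglongrightarrow> emeasure \<mu> (\<Inter>n. S n)"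
    proof (rule Lim_emeasure_decseq)
      show "range S \<subseteq> sets \<mu>" using measurable_sets[OF X A] by (auto simp: S_def)
      show "decseq S"
      proof (rule decseq_SucI)
        fix n
        have "inverse (real (Suc (Suc n))) \<le> inverse (real (Suc n))" by (rule le_imp_inverse_le) auto
        then have "t + inverse (real (Suc (Suc n))) \<le> t + inverse (real (Suc n))" by simp
        then show "S (Suc n) \<subseteq> S n" unfolding S_def R_def using order_trans by blast
      qed
    qed simp
    moreover have "(\<Inter>n. S n) = R t \<inter> (X -` A \<inter> space \<mu>)"
    proof -
      have "Y \<omega> \<le> t" if "\<And>n. Y \<omega> \<le> t + inverse (real (Suc n))" for \<omega>
        using LIMSEQ_le_const[OF LIMSEQ_inverse_real_of_nat_add[of t], of "Y \<omega>"] that by blast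
      moreover have "Y \<omega> \<le> t \<Longrightarrow> Y \<omega> \<le> t + inverse (real (Suc n))" for n \<omega>
        by (rule order_trans[of _ t]) auto
      ultimately have "(\<forall>n. Y \<omega> \<le> t + inverse (real (Suc n))) \<longleftrightarrow> Y \<omega> \<le> t" for \<omega> by metis
      then show ?thesis unfolding S_def R_def by blast
    qed
    ultimately have "(\<lambda>n. emeasure (\<nu> (t + inverse (real (Suc n)))) A) \<longlonglongrightarrow> emeasure (\<nu> t) A"
      by (simp add: \<nu>e[OF A] S_def)
    then show "(\<integral>\<^sup>+x. ennreal (F x t) * indicator A x \<partial>\<rho>) \<le> emeasure (\<nu> t) A"
      by (rule LIMSEQ_le_const) (use ub in auto)
    have "AE x in \<rho>. \<forall>r\<in>Q t. G t x \<le> G r x"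
      unfolding AE_ball_countable[OF Qc] by (intro ballI GG) (simp add: Q_def)
    then have tF: "AE x in \<rho>. G t x \<le> F x t"
      by eventually_elim (unfold F_def, rule cINF_greatest[OF Qne], blast)
    have "(\<integral>\<^sup>+x. ennreal (G t x) * indicator A x \<partial>\<rho>) \<le> (\<integral>\<^sup>+x. ennreal (F x t) * indicator A x \<partial>\<rho>)"
      by (rule nn_integral_mono_AE, rule eventually_mono[OF tF]) (intro mult_right_mono ennreal_leI, simp_all)
    then show "emeasure (\<nu> t) A \<le> (\<integral>\<^sup>+x. ennreal (F x t) * indicator A x \<partial>\<rho>)" by (simp add: Gint[OF A])
  qed
  \<comment> \<open>For fixed \<open>A\<close> both sides are finite measures in \<open>B\<close>,
    and half-lines, where they agree by \<open>Fint\<close>, form a generator stable under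
    intersection.\<close>
  have rect: "emeasure \<mu> {\<omega>\<in>space \<mu>. X \<omega> \<in> A \<and> Y \<omega> \<in> B} = (\<integral>\<^sup>+x. emeasure (\<kappa> x) B * indicator A x \<partial>\<rho>)"
    if A: "A \<in> sets N" and B: "B \<in> sets borel" for A B
  proof -
    have XA: "X -` A \<inter> space \<mu> \<in> sets \<mu>" by (rule measurable_sets[OF X A])
    define m1 where "m1 = distr (density \<mu> (indicator (X -` A \<inter> space \<mu>))) borel Y"
    define m2 where "m2 = density \<rho> (indicator A) \<bind> \<kappa>"
    have m1: "emeasure m1 B = emeasure \<mu> {\<omega>\<in>space \<mu>. X \<omega> \<in> A \<and> Y \<omega> \<in> B}" if "B \<in> sets borel" for B
    proof -
      have "emeasure m1 B = emeasure \<mu> ((X -` A \<inter> space \<mu>) \<inter> (Y -` B \<inter> space \<mu>))"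
        using XA measurable_sets[OF Y that] that by (simp add: m1_def emeasure_distr emeasure_restricted)
      also have "(X -` A \<inter> space \<mu>) \<inter> (Y -` B \<inter> space \<mu>) = {\<omega>\<in>space \<mu>. X \<omega> \<in> A \<and> Y \<omega> \<in> B}" by auto
      finally show ?thesis .
    qed
    have m2: "emeasure m2 B = (\<integral>\<^sup>+x. emeasure (\<kappa> x) B * indicator A x \<partial>\<rho>)" if B: "B \<in> sets borel" for B
    proof -
      have [measurable]: "(\<lambda>x. emeasure (\<kappa> x) B) \<in> borel_measurable \<rho>"
        by (rule measurable_compose[OF \<kappa>sub measurable_emeasure_subprob_algebra[OF B]])
      have "emeasure m2 B = (\<integral>\<^sup>+x. emeasure (\<kappa> x) B \<partial>density \<rho> (indicator A))"
        unfolding m2_def by (rule emeasure_bind[where N=borel]) (use \<kappa>sub ne s\<rho> B in auto)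
      also have "\<dots> = (\<integral>\<^sup>+x. indicator A x * emeasure (\<kappa> x) B \<partial>\<rho>)"
        by (rule nn_integral_density) (use A s\<rho> in auto)
      finally show ?thesis by (simp add: mult.commute)
    qed
    have "m1 = m2"
    proof (rule measure_eqI_generator_eq[OF stable, where A="\<lambda>i. {..real i}" and \<Omega>=UNIV])
      fix Z assume "Z \<in> range (atMost :: real \<Rightarrow> _)"
      then obtain t where Z: "Z = {..t}" by auto
      have "{\<omega>\<in>space \<mu>. X \<omega> \<in> A \<and> Y \<omega> \<in> {..t}} = R t \<inter> (X -` A \<inter> space \<mu>)" by (auto simp: R_def)
      then show "emeasure m1 Z = emeasure m2 Z"
        using m1[of Z] m2[of Z] Fint[OF A, of t] \<nu>e[OF A, of t] by (simp add: Z \<kappa>e)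
    next
      show "sets m1 = sigma_sets UNIV (range atMost)" by (simp add: m1_def gen)
      show "sets m2 = sigma_sets UNIV (range atMost)" unfolding m2_def gen[symmetric]
        by (rule sets_bind[where N=borel]) (use \<kappa>sub ne s\<rho> in \<open>auto dest: sets_kernel\<close>)
      show "(\<Union>i. {..real i}) = UNIV" using real_arch_simple by auto
      show "emeasure m1 {..real i} \<noteq> \<infinity>" for i by (simp add: m1)
    qed auto
    then show ?thesis using m1[OF B] m2[OF B] by simp
  qed
  \<comment> \<open>\<open>L1\<close> is the joint law of \<open>X\<close> and \<open>Y\<close>, and
    \<open>L2\<close> is the mixture built from the kernel; they agree on rectangles by
    \<open>rect\<close>, hence on the product \<sigma>-algebra.\<close>
  define L1 where "L1 = distr \<mu> (N \<Otimes>\<^sub>M borel) (\<lambda>\<omega>. (X \<omega>, Y \<omega>))"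
  define k2 where "k2 x = distr (\<kappa> x) (N \<Otimes>\<^sub>M borel) (Pair x)" for x
  define L2 where "L2 = \<rho> \<bind> k2"
  have k2m: "k2 \<in> \<rho> \<rightarrow>\<^sub>M subprob_algebra (N \<Otimes>\<^sub>M borel)"
  proof -
    have "k2 \<in> N \<rightarrow>\<^sub>M prob_algebra (N \<Otimes>\<^sub>M borel)"
      unfolding k2_def by (rule measurable_distr_prob_space2[OF \<kappa>m]) measurable
    then show ?thesis using measurable_cong_sets[OF s\<rho>(1) refl] measurable_prob_algebraD by blast
  qed
  have k2e: "emeasure (k2 x) E = emeasure (\<kappa> x) (Pair x -` E)" if "E \<in> sets (N \<Otimes>\<^sub>M borel)" "x \<in> space N" for x E
  proof -
    have sk: "sets (\<kappa> x) = sets borel" using \<kappa>p[of x] by (auto simp: real_distribution_def real_distribution_axioms_def)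
    then have "Pair x \<in> \<kappa> x \<rightarrow>\<^sub>M (N \<Otimes>\<^sub>M borel)" using that(2) by (simp add: measurable_cong_sets[OF sk refl])
    moreover have "space (\<kappa> x) = UNIV" using sets_eq_imp_space_eq[OF sk] by simp
    ultimately show ?thesis using that unfolding k2_def by (subst emeasure_distr) auto
  qed
  have L2e: "emeasure L2 E = (\<integral>\<^sup>+x. emeasure (\<kappa> x) (Pair x -` E) \<partial>\<rho>)" if E: "E \<in> sets (N \<Otimes>\<^sub>M borel)" for E
  proof -
    have "emeasure L2 E = (\<integral>\<^sup>+x. emeasure (k2 x) E \<partial>\<rho>)"
      unfolding L2_def by (rule emeasure_bind[OF _ k2m E]) (simp add: s\<rho> ne)
    also have "\<dots> = (\<integral>\<^sup>+x. emeasure (\<kappa> x) (Pair x -` E) \<partial>\<rho>)"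
      by (rule nn_integral_cong) (simp add: k2e[OF E] s\<rho>)
    finally show ?thesis .
  qed
  have L1e: "emeasure L1 E = emeasure \<mu> {\<omega>\<in>space \<mu>. (X \<omega>, Y \<omega>) \<in> E}" if "E \<in> sets (N \<Otimes>\<^sub>M borel)" for E
    using that unfolding L1_def by (subst emeasure_distr) (auto intro!: arg_cong[where f="emeasure \<mu>"])
  have "L1 = L2"
  proof (rule measure_eqI_generator_eq[OF Int_stable_pair_measure_generator[of N borel], where A="\<lambda>_. space N \<times> UNIV" and \<Omega>="space N \<times> UNIV"])
    show "{a \<times> b |a b. a \<in> sets N \<and> b \<in> sets borel} \<subseteq> Pow (space N \<times> (UNIV :: real set))"
      using sets.sets_into_space by fastforce
    fix E assume "E \<in> {a \<times> b |a b. a \<in> sets N \<and> b \<in> sets (borel :: real measure)}"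
    then obtain A B where AB: "E = A \<times> B" "A \<in> sets N" "B \<in> sets borel" by auto
    have E: "E \<in> sets (N \<Otimes>\<^sub>M borel)" using AB by auto
    have "emeasure (\<kappa> x) (Pair x -` E) = emeasure (\<kappa> x) B * indicator A x" for x
      by (simp add: AB split: split_indicator)
    then show "emeasure L1 E = emeasure L2 E"
      using L1e[OF E] L2e[OF E] rect[OF AB(2,3)] by (simp add: AB(1))
  next
    show "sets L1 = sigma_sets (space N \<times> UNIV) {a \<times> b |a b. a \<in> sets N \<and> b \<in> sets borel}"
      using sets_pair_measure[of N "borel :: real measure"] by (simp add: L1_def)
    have "sets L2 = sets (N \<Otimes>\<^sub>M (borel :: real measure))" unfolding L2_def
      by (rule sets_bind) (use k2m ne s\<rho> in \<open>auto dest: sets_kernel\<close>)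
    then show "sets L2 = sigma_sets (space N \<times> UNIV) {a \<times> b |a b. a \<in> sets N \<and> b \<in> sets borel}"
      using sets_pair_measure[of N "borel :: real measure"] by simp
    show "emeasure L1 (space N \<times> UNIV) \<noteq> \<infinity>" by (subst L1e) auto
    have "space N \<times> UNIV \<in> {a \<times> b |a b. a \<in> sets N \<and> b \<in> sets (borel :: real measure)}"
      by (intro CollectI exI[of _ "space N"] exI[of _ UNIV]) auto
    then show "range (\<lambda>_::nat. space N \<times> UNIV) \<subseteq> {a \<times> b |a b. a \<in> sets N \<and> b \<in> sets (borel :: real measure)}"
      by (simp only: image_subset_iff) simp
    show "(\<Union>i::nat. space N \<times> UNIV) = space N \<times> (UNIV :: real set)" by simp
  qed
  then show ?thesis using that[OF \<kappa>m] L1e L2e by (simp add: \<rho>_def)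
qed

text \<open>The fibre coordinate is coded by a real, so that conditional distributions exist through
  distribution functions, and the kernel is carried back by the decoder \<open>g\<close>.\<close>

lemma disintegration_exists:
  fixes \<mu> :: "(real \<times> 'k::polish_space) measure"
  assumes fin: "finite_measure \<mu>" and sets: "sets \<mu> = sets borel_Sig"
    and ac: "absolutely_continuous leb_I (distr \<mu> leb_I fst)"
  shows "\<exists>\<kappa>. disintegration \<mu> \<kappa>"
proof -
  interpret finite_measure \<mu> by fact
  obtain \<sigma> :: "'k \<Rightarrow> real" and g where \<sigma> [measurable]: "\<sigma> \<in> borel_measurable borel"
    and g [measurable]: "g \<in> borel_measurable borel"
    and g\<sigma>: "\<And>y. g (\<sigma> y) = y" and r: "\<And>y. 0 \<le> \<sigma> y" "\<And>y. \<sigma> y \<le> 1"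
    using real_coding_exists by blast
  have sp: "space \<mu> = Sig" using sets_eq_imp_space_eq[OF sets] by (simp add: space_borel_Sig)
  have s2: "sets \<mu> = sets (leb_I \<Otimes>\<^sub>M (borel :: 'k measure))" using sets sets_borel_Sig by simp
  have fstm: "fst \<in> \<mu> \<rightarrow>\<^sub>M leb_I"
    unfolding measurable_cong_sets[OF s2 refl] by simp
  have sndm: "(\<lambda>p. \<sigma> (snd p)) \<in> borel_measurable \<mu>"
    unfolding measurable_cong_sets[OF s2 refl] by simp
  obtain \<kappa> where \<kappa>: "\<kappa> \<in> leb_I \<rightarrow>\<^sub>M prob_algebra borel"
    and eq: "\<And>E. E \<in> sets (leb_I \<Otimes>\<^sub>M borel) \<Longrightarrow> emeasure \<mu> {\<omega>\<in>space \<mu>. (fst \<omega>, \<sigma> (snd \<omega>)) \<in> E}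
       = (\<integral>\<^sup>+x. emeasure (\<kappa> x) (Pair x -` E) \<partial>distr \<mu> leb_I fst)"
    by (rule conditional_distribution_exists[OF fin fstm sndm]) (use r sp in auto)
  define \<kappa>' where "\<kappa>' x = distr (\<kappa> x) borel g" for x
  have \<kappa>': "\<kappa>' \<in> leb_I \<rightarrow>\<^sub>M prob_algebra borel"
    unfolding \<kappa>'_def by (rule measurable_compose[OF \<kappa> measurable_distr_prob_space[OF g]])
  have dens: "distr \<mu> leb_I fst = density leb_I (\<lambda>x. ennreal (marginal_density \<mu> x))"
  proof -
    interpret L: sigma_finite_measure leb_I by (rule sigma_finite_leb_I)
    interpret D: finite_measure "distr \<mu> leb_I fst" by (rule finite_measure_distr[OF fstm])
    have "AE x in leb_I. RN_deriv leb_I (distr \<mu> leb_I fst) x \<noteq> \<infinity>"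
      by (rule L.RN_deriv_finite[OF D.sigma_finite_measure_axioms ac]) simp
    then have "AE x in leb_I. RN_deriv leb_I (distr \<mu> leb_I fst) x = ennreal (marginal_density \<mu> x)"
      by eventually_elim (simp add: marginal_density_def less_top)
    then have "density leb_I (RN_deriv leb_I (distr \<mu> leb_I fst)) = density leb_I (\<lambda>x. ennreal (marginal_density \<mu> x))"
      by (intro density_cong) (auto simp: marginal_density_def)
    then show ?thesis using L.density_RN_deriv[OF ac] by simp
  qed
  have "disintegration \<mu> \<kappa>'"
    unfolding disintegration_def
  proof (intro conjI ballI)
    fix E :: "(real \<times> 'k) set" assume E: "E \<in> sets borel_Sig"
    \<comment> \<open>\<open>E'\<close> is described by decoding the second coordinate. Since
      decoding inverts coding, the coded image of a point lies in \<open>E'\<close> exactly when the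
      point lies in \<open>E\<close>.\<close>
    define E' where "E' = (\<lambda>(x, t). (x, g t)) -` E \<inter> space (leb_I \<Otimes>\<^sub>M borel)"
    have "(\<lambda>(x, t). (x, g t)) \<in> leb_I \<Otimes>\<^sub>M borel \<rightarrow>\<^sub>M (borel_Sig :: (real \<times> 'k) measure)"
      unfolding measurable_to_borel_Sig by measurable
    then have E': "E' \<in> sets (leb_I \<Otimes>\<^sub>M borel)" unfolding E'_def using E by (rule measurable_sets)
    have EsubS: "E \<subseteq> Sig" using sets.sets_into_space[OF E] by (simp add: borel_Sig_def space_restrict_space)
    then have "{\<omega>\<in>space \<mu>. (fst \<omega>, \<sigma> (snd \<omega>)) \<in> E'} = E"
      by (auto simp: E'_def g\<sigma> space_pair_measure sp Sig_def)
    then have "emeasure \<mu> E = (\<integral>\<^sup>+x. emeasure (\<kappa> x) (Pair x -` E') \<partial>distr \<mu> leb_I fst)"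
      using eq[OF E'] by simp
    also have "\<dots> = (\<integral>\<^sup>+x. emeasure (\<kappa>' x) (Pair x -` E) \<partial>distr \<mu> leb_I fst)"
    proof (rule nn_integral_cong)
      fix x assume "x \<in> space (distr \<mu> leb_I fst)"
      then have x: "x \<in> space leb_I" by simp
      have sk: "sets (\<kappa> x) = sets borel" using measurable_space[OF \<kappa> x] by (simp add: space_prob_algebra)
      have gk: "g \<in> \<kappa> x \<rightarrow>\<^sub>M borel" using g measurable_cong_sets[OF sk refl] by blast
      have Ex: "Pair x -` E \<in> sets borel"
        using E unfolding sets_borel_Sig by (rule sets_Pair1)
      have "Pair x -` E' = g -` (Pair x -` E) \<inter> space (\<kappa> x)"
        using x sets_eq_imp_space_eq[OF sk] by (auto simp: E'_def space_pair_measure)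
      then show "emeasure (\<kappa> x) (Pair x -` E') = emeasure (\<kappa>' x) (Pair x -` E)"
        unfolding \<kappa>'_def by (simp add: emeasure_distr[OF gk Ex])
    qed
    also have "\<dots> = (\<integral>\<^sup>+x. ennreal (marginal_density \<mu> x) * emeasure (\<kappa>' x) (Pair x -` E) \<partial>leb_I)"
      unfolding dens
    proof (rule nn_integral_density)
      show "(\<lambda>x. ennreal (marginal_density \<mu> x)) \<in> borel_measurable leb_I"
        unfolding marginal_density_def by measurable
      show "(\<lambda>x. emeasure (\<kappa>' x) (Pair x -` E)) \<in> borel_measurable leb_I"
      proof (rule emeasure_measurable_subprob_algebra2[OF _ measurable_prob_algebraD[OF \<kappa>']])
        have "(SIGMA x:space leb_I. Pair x -` E) = E" using EsubS by (auto simp: Sig_def)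
        then show "(SIGMA x:space leb_I. Pair x -` E) \<in> sets (leb_I \<Otimes>\<^sub>M borel)"
          using E by (simp only: sets_borel_Sig)
      qed
    qed
    finally show "emeasure \<mu> E = (\<integral>\<^sup>+x. emeasure (\<kappa>' x) (Pair x -` E) * ennreal (marginal_density \<mu> x) \<partial>leb_I)"
      by (simp add: mult.commute)
  qed (rule \<kappa>')
  then show ?thesis by blast
qed

section \<open>Integration along the fibres\<close>

context
  fixes \<mu> :: "(real \<times> 'k::polish_space) measure"
  assumes fin: "finite_measure \<mu>" and sets: "sets \<mu> = sets borel_Sig"
    and ac: "absolutely_continuous leb_I (distr \<mu> leb_I fst)"
begin

lemma some_disintegration: "disintegration \<mu> (SOME \<kappa>. disintegration \<mu> \<kappa>)"
  by (rule someI_ex[OF disintegration_exists[OF fin sets ac]])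

lemma some_kernel: "(SOME \<kappa>. disintegration \<mu> \<kappa>) \<in> leb_I \<rightarrow>\<^sub>M prob_algebra borel"
  by (rule some_disintegration[unfolded disintegration_def[of _ "SOME \<kappa>. disintegration \<mu> \<kappa>"], THEN conjunct1])

lemma marginal_density_nonneg: "0 \<le> marginal_density \<mu> x"
  by (simp add: marginal_density_def)

lemma marginal_density_measurable [measurable]: "marginal_density \<mu> \<in> borel_measurable leb_I"
  unfolding marginal_density_def by measurable

lemma fibre_measure_sets: "x \<in> {0..1} \<Longrightarrow> sets (fibre_measure \<mu> x) = sets borel"
  using measurable_space[OF some_kernel, of x] by (simp add: fibre_measure_def space_prob_algebra)

lemma fibre_measure_space: "x \<in> {0..1} \<Longrightarrow> space (fibre_measure \<mu> x) = UNIV"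
  using sets_eq_imp_space_eq[OF fibre_measure_sets] by simp

lemma emeasure_fibre_measure_UNIV:
  assumes "x \<in> {0..1}"
  shows "emeasure (fibre_measure \<mu> x) UNIV = ennreal (marginal_density \<mu> x)"
proof -
  let ?k = "(SOME \<kappa>. disintegration \<mu> \<kappa>) x"
  have k: "sets ?k = sets borel" "prob_space ?k"
    using measurable_space[OF some_kernel, of x] assms by (auto simp: space_prob_algebra)
  have "emeasure ?k UNIV = 1"
    using prob_space.emeasure_space_1[OF k(2)] sets_eq_imp_space_eq[OF k(1)] by simp
  then show ?thesis by (simp add: fibre_measure_def)
qed

lemma fibre_measure_finite: "x \<in> {0..1} \<Longrightarrow> finite_measure (fibre_measure \<mu> x)"
  by (rule finite_measureI) (simp add: fibre_measure_space emeasure_fibre_measure_UNIV)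

lemma measure_fibre_measure_UNIV:
  "x \<in> {0..1} \<Longrightarrow> measure (fibre_measure \<mu> x) UNIV = marginal_density \<mu> x"
  by (simp add: measure_def emeasure_fibre_measure_UNIV marginal_density_nonneg)

text \<open>\<open>\<mu>\<close> is the monadic bind of its marginal \<open>L\<close> with the
  kernel \<open>K\<close>, which places the conditional law on the fibre over \<open>x\<close>; the
  rules for bind then give both claims. The density is a factor of \<open>fibre_measure\<close>,
  hence the rescaling.\<close>

lemma nn_integral_fibre:
  assumes h: "h \<in> borel_measurable (leb_I \<Otimes>\<^sub>M borel)"
  shows "(\<integral>\<^sup>+p. h p \<partial>\<mu>) = (\<integral>\<^sup>+x. (\<integral>\<^sup>+y. h (x, y) \<partial>fibre_measure \<mu> x) \<partial>leb_I)"
    and "(\<lambda>x. \<integral>\<^sup>+y. h (x, y) \<partial>fibre_measure \<mu> x) \<in> borel_measurable leb_I"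
proof -
  define \<kappa> where "\<kappa> = (SOME \<kappa>. disintegration \<mu> \<kappa>)"
  have k [measurable]: "\<kappa> \<in> leb_I \<rightarrow>\<^sub>M prob_algebra borel" unfolding \<kappa>_def by (rule some_kernel)
  have dis: "disintegration \<mu> \<kappa>" unfolding \<kappa>_def by (rule some_disintegration)
  have ks: "sets (\<kappa> x) = sets borel" if "x \<in> {0..1}" for x
    using measurable_space[OF k, of x] that by (simp add: space_prob_algebra)
  define K where "K x = distr (\<kappa> x) (leb_I \<Otimes>\<^sub>M borel) (Pair x)" for x
  have K: "K \<in> leb_I \<rightarrow>\<^sub>M subprob_algebra (leb_I \<Otimes>\<^sub>M borel)"
    unfolding K_def by (rule measurable_prob_algebraD, rule measurable_distr_prob_space2[OF k]) measurable
  define L where "L = density leb_I (\<lambda>x. ennreal (marginal_density \<mu> x))"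
  have K': "K \<in> L \<rightarrow>\<^sub>M subprob_algebra (leb_I \<Otimes>\<^sub>M borel)"
    using K by (simp add: L_def)
  have P: "Pair x \<in> \<kappa> x \<rightarrow>\<^sub>M (leb_I \<Otimes>\<^sub>M borel)" if "x \<in> {0..1}" for x
    using that by (simp add: measurable_cong_sets[OF ks refl])
  have ne: "space L \<noteq> {}" by (simp add: L_def)
  have eq: "\<mu> = L \<bind> K"
  proof (rule measure_eqI)
    show s: "sets \<mu> = sets (L \<bind> K)"
      using sets sets_borel_Sig sets_bind[OF _ ne, of K "leb_I \<Otimes>\<^sub>M borel"] sets_kernel[OF K'] by simp
    fix E assume "E \<in> sets \<mu>"
    then have E: "E \<in> sets (leb_I \<Otimes>\<^sub>M borel)" "E \<in> sets borel_Sig" using sets sets_borel_Sig by auto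
    have Ksub: "(\<lambda>x. emeasure (K x) E) \<in> borel_measurable leb_I"
      by (rule measurable_compose[OF K measurable_emeasure_subprob_algebra[OF E(1)]])
    have "emeasure (L \<bind> K) E = (\<integral>\<^sup>+x. emeasure (K x) E \<partial>L)" by (rule emeasure_bind[OF ne K' E(1)])
    also have "\<dots> = (\<integral>\<^sup>+x. ennreal (marginal_density \<mu> x) * emeasure (K x) E \<partial>leb_I)"
      unfolding L_def by (rule nn_integral_density[OF _ Ksub]) simp
    also have "\<dots> = (\<integral>\<^sup>+x. emeasure (\<kappa> x) (Pair x -` E) * ennreal (marginal_density \<mu> x) \<partial>leb_I)"
    proof (rule nn_integral_cong)
      fix x :: real assume "x \<in> space leb_I"
      then have x: "x \<in> {0..1}" by simp
      have "emeasure (K x) E = emeasure (\<kappa> x) (Pair x -` E)"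
        using emeasure_distr[OF P[OF x] E(1)] sets_eq_imp_space_eq[OF ks[OF x]] by (simp add: K_def)
      then show "ennreal (marginal_density \<mu> x) * emeasure (K x) E
         = emeasure (\<kappa> x) (Pair x -` E) * ennreal (marginal_density \<mu> x)" by (simp add: mult.commute)
    qed
    also have "\<dots> = emeasure \<mu> E"
      using dis E(2) unfolding disintegration_def by simp
    finally show "emeasure \<mu> E = emeasure (L \<bind> K) E" by simp
  qed
  have f: "(\<integral>\<^sup>+y. h (x, y) \<partial>fibre_measure \<mu> x) = ennreal (marginal_density \<mu> x) * (\<integral>\<^sup>+p. h p \<partial>K x)"
    if x: "x \<in> {0..1}" for x
  proof -
    have hx: "(\<lambda>y. h (x, y)) \<in> borel_measurable (\<kappa> x)"
      by (rule measurable_compose[OF P[OF x] h])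
    show ?thesis unfolding fibre_measure_def \<kappa>_def[symmetric]
      by (subst nn_integral_scale_measure[OF hx]) (simp add: K_def nn_integral_distr[OF P[OF x]] h)
  qed
  have Km: "(\<lambda>x. \<integral>\<^sup>+p. h p \<partial>K x) \<in> borel_measurable leb_I"
    by (rule measurable_compose[OF K nn_integral_measurable_subprob_algebra[OF h]])
  have "(\<integral>\<^sup>+p. h p \<partial>\<mu>) = (\<integral>\<^sup>+x. (\<integral>\<^sup>+p. h p \<partial>K x) \<partial>L)"
    by (subst eq) (rule nn_integral_bind[OF h K'])
  also have "\<dots> = (\<integral>\<^sup>+x. ennreal (marginal_density \<mu> x) * (\<integral>\<^sup>+p. h p \<partial>K x) \<partial>leb_I)"
    unfolding L_def by (rule nn_integral_density[OF _ Km]) simp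
  also have "\<dots> = (\<integral>\<^sup>+x. (\<integral>\<^sup>+y. h (x, y) \<partial>fibre_measure \<mu> x) \<partial>leb_I)"
    by (rule nn_integral_cong) (simp add: f)
  finally show "(\<integral>\<^sup>+p. h p \<partial>\<mu>) = (\<integral>\<^sup>+x. (\<integral>\<^sup>+y. h (x, y) \<partial>fibre_measure \<mu> x) \<partial>leb_I)" .
  have "(\<lambda>x. ennreal (marginal_density \<mu> x) * (\<integral>\<^sup>+p. h p \<partial>K x)) \<in> borel_measurable leb_I"
    using Km by simp
  then show "(\<lambda>x. \<integral>\<^sup>+y. h (x, y) \<partial>fibre_measure \<mu> x) \<in> borel_measurable leb_I"
    by (rule measurable_cong[THEN iffD1, rotated]) (simp add: f)
qed

lemma nn_integral_marginal_density:
  "A \<in> sets leb_I \<Longrightarrow>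
    (\<integral>\<^sup>+x. ennreal (marginal_density \<mu> x) * indicator A x \<partial>leb_I) = emeasure \<mu> (A \<times> UNIV)"
proof -
  assume A: "A \<in> sets leb_I"
  then have A': "A \<times> UNIV \<in> sets (leb_I \<Otimes>\<^sub>M (borel :: 'k measure))" by auto
  have "emeasure \<mu> (A \<times> UNIV) = (\<integral>\<^sup>+p. indicator (A \<times> UNIV) p \<partial>\<mu>)"
    using A' sets sets_borel_Sig by (subst nn_integral_indicator) auto
  also have "\<dots> = (\<integral>\<^sup>+x. (\<integral>\<^sup>+y. indicator (A \<times> UNIV) (x, y) \<partial>fibre_measure \<mu> x) \<partial>leb_I)"
    by (rule nn_integral_fibre(1)) (use A' in simp)
  also have "\<dots> = (\<integral>\<^sup>+x. ennreal (marginal_density \<mu> x) * indicator A x \<partial>leb_I)"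
  proof (rule nn_integral_cong)
    fix x :: real assume "x \<in> space leb_I"
    then show "(\<integral>\<^sup>+y. indicator (A \<times> UNIV) (x, y) \<partial>fibre_measure \<mu> x) = ennreal (marginal_density \<mu> x) * indicator A x"
      by (simp add: indicator_times fibre_measure_space emeasure_fibre_measure_UNIV mult.commute)
  qed
  finally show ?thesis by simp
qed

lemma marginal_density_integrable: "integrable leb_I (marginal_density \<mu>)"
proof -
  have "(\<integral>\<^sup>+x. ennreal (marginal_density \<mu> x) \<partial>leb_I) = (\<integral>\<^sup>+x. ennreal (marginal_density \<mu> x) * indicator {0..1} x \<partial>leb_I)"
    by (rule nn_integral_cong) simp
  also have "\<dots> = emeasure \<mu> ({0..1} \<times> UNIV)"
    by (rule nn_integral_marginal_density) (use sets.top[of leb_I] in simp)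
  also have "\<dots> < \<infinity>" using finite_measure.emeasure_finite[OF fin] by (simp add: less_top[symmetric])
  finally show ?thesis by (intro integrableI_bounded) (auto simp: marginal_density_nonneg)
qed

lemma integral_marginal_density:
  assumes "A \<in> sets leb_I"
  shows "(\<integral>x. marginal_density \<mu> x * indicator A x \<partial>leb_I) = measure \<mu> (A \<times> UNIV)"
proof -
  have "(\<integral>\<^sup>+x. ennreal (marginal_density \<mu> x * indicator A x) \<partial>leb_I) = emeasure \<mu> (A \<times> UNIV)"
    unfolding nn_integral_marginal_density[OF assms, symmetric]
    by (rule nn_integral_cong) (simp split: split_indicator)
  then show ?thesis
    by (subst integral_eq_nn_integral)
       (use assms in \<open>auto simp: marginal_density_nonneg measure_def split: split_indicator\<close>)
qed

text \<open>Reduction to the nonnegative case by adding \<open>c'\<close>. A fibre has mass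
  \<open>marginal_density \<mu> x\<close> and not 1, so the shift costs \<open>c'\<close> times this
  density, whose integral is the total mass.\<close>

lemma integral_fibre:
  fixes h :: "real \<times> 'k \<Rightarrow> real"
  assumes h: "h \<in> borel_measurable (leb_I \<Otimes>\<^sub>M borel)" and b: "\<And>p. p \<in> Sig \<Longrightarrow> \<bar>h p\<bar> \<le> c"
  shows "integrable leb_I (\<lambda>x. \<integral>y. h (x, y) \<partial>fibre_measure \<mu> x)"
    and "(\<integral>p. h p \<partial>\<mu>) = (\<integral>x. (\<integral>y. h (x, y) \<partial>fibre_measure \<mu> x) \<partial>leb_I)"
proof -
  interpret finite_measure \<mu> by (rule fin)
  define c' where "c' = \<bar>c\<bar>"
  have b': "\<bar>h p\<bar> \<le> c'" "0 \<le> h p + c'" "h p + c' \<le> 2 * c'" if "p \<in> Sig" for p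
    using b[OF that] by (auto simp: c'_def)
  have hm: "h \<in> borel_measurable \<mu>" using h measurable_cong_sets[OF sets refl] measurable_borel_Sig by blast
  have sp: "space \<mu> = Sig" using sets_eq_imp_space_eq[OF sets] by (simp add: space_borel_Sig)
  have xS: "(x, y) \<in> Sig" if "x \<in> {0..1}" for x :: real and y :: 'k using that by (simp add: Sig_def)
  have hp: "(\<lambda>p. ennreal (h p + c')) \<in> borel_measurable (leb_I \<Otimes>\<^sub>M borel)" using h by measurable
  define I where "I x = (\<integral>\<^sup>+y. ennreal (h (x, y) + c') \<partial>fibre_measure \<mu> x)" for x
  have Im: "I \<in> borel_measurable leb_I" unfolding I_def by (rule nn_integral_fibre(2)[OF hp])
  have fib: "(\<integral>y. h (x, y) \<partial>fibre_measure \<mu> x) = enn2real (I x) - c' * marginal_density \<mu> x"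
    and Ile: "I x \<le> ennreal (2 * c' * marginal_density \<mu> x)"
    if x: "x \<in> {0..1}" for x
  proof -
    interpret f: finite_measure "fibre_measure \<mu> x" by (rule fibre_measure_finite[OF x])
    have "(\<lambda>y. h (x, y)) \<in> borel_measurable borel"
      by (rule measurable_compose[OF _ h]) (rule measurable_Pair1', use x in simp)
    then have hx: "(\<lambda>y. h (x, y)) \<in> borel_measurable (fibre_measure \<mu> x)"
      using measurable_cong_sets[OF fibre_measure_sets[OF x] refl] by blast
    have i: "integrable (fibre_measure \<mu> x) (\<lambda>y. h (x, y))"
      by (rule f.integrable_const_bound[where B=c']) (use hx b' xS[OF x] in auto)
    have "(\<integral>y. h (x, y) + c' \<partial>fibre_measure \<mu> x) = (\<integral>y. h (x, y) \<partial>fibre_measure \<mu> x) + c' * marginal_density \<mu> x"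
      using i by (simp add: fibre_measure_space[OF x] measure_fibre_measure_UNIV[OF x])
    moreover have "(\<integral>y. h (x, y) + c' \<partial>fibre_measure \<mu> x) = enn2real (I x)"
      unfolding I_def using hx b'(2) xS[OF x] by (intro integral_eq_nn_integral) auto
    ultimately show "(\<integral>y. h (x, y) \<partial>fibre_measure \<mu> x) = enn2real (I x) - c' * marginal_density \<mu> x" by simp
    have "I x \<le> (\<integral>\<^sup>+y. ennreal (2 * c') \<partial>fibre_measure \<mu> x)"
      unfolding I_def using b'(3) xS[OF x] by (intro nn_integral_mono ennreal_leI) auto
    also have "\<dots> = ennreal (2 * c' * marginal_density \<mu> x)"
      by (simp add: fibre_measure_space[OF x] emeasure_fibre_measure_UNIV[OF x] ennreal_mult'[symmetric]
          marginal_density_nonneg c'_def)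
    finally show "I x \<le> ennreal (2 * c' * marginal_density \<mu> x)" .
  qed
  have nn: "0 \<le> 2 * c' * marginal_density \<mu> x" for x by (simp add: c'_def marginal_density_nonneg)
  have i1: "integrable leb_I (\<lambda>x. enn2real (I x))"
  proof (rule Bochner_Integration.integrable_bound[where f="\<lambda>x. 2 * c' * marginal_density \<mu> x"])
    show "integrable leb_I (\<lambda>x. 2 * c' * marginal_density \<mu> x)"
      using marginal_density_integrable by simp
    show "(\<lambda>x. enn2real (I x)) \<in> borel_measurable leb_I" using Im by measurable
    show "AE x in leb_I. norm (enn2real (I x)) \<le> norm (2 * c' * marginal_density \<mu> x)"
      using Ile nn enn2real_leI by (intro AE_I2) (simp add: c'_def marginal_density_nonneg)
  qed
  have i2: "integrable leb_I (\<lambda>x. enn2real (I x) - c' * marginal_density \<mu> x)"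
    using i1 marginal_density_integrable by simp
  show "integrable leb_I (\<lambda>x. \<integral>y. h (x, y) \<partial>fibre_measure \<mu> x)"
    by (rule Bochner_Integration.integrable_cong[THEN iffD1, OF refl _ i2]) (simp add: fib)
  have "(\<integral>x. (\<integral>y. h (x, y) \<partial>fibre_measure \<mu> x) \<partial>leb_I) = (\<integral>x. enn2real (I x) - c' * marginal_density \<mu> x \<partial>leb_I)"
    by (rule Bochner_Integration.integral_cong) (simp_all add: fib)
  also have "\<dots> = (\<integral>x. enn2real (I x) \<partial>leb_I) - c' * (\<integral>x. marginal_density \<mu> x \<partial>leb_I)"
    using i1 marginal_density_integrable by simp
  also have "(\<integral>x. marginal_density \<mu> x \<partial>leb_I) = measure \<mu> Sig"
  proof -
    have "(\<integral>x. marginal_density \<mu> x \<partial>leb_I) = (\<integral>x. marginal_density \<mu> x * indicator {0..1} x \<partial>leb_I)"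
      by (rule Bochner_Integration.integral_cong) auto
    then show ?thesis using integral_marginal_density[of "{0..1}"] sets.top[of leb_I] by (simp add: Sig_def)
  qed
  also have "(\<integral>x. enn2real (I x) \<partial>leb_I) = (\<integral>p. h p + c' \<partial>\<mu>)"
  proof -
    have fI: "I x < \<infinity>" if "x \<in> {0..1}" for x using le_less_trans[OF Ile[OF that]] by simp
    have "(\<integral>x. enn2real (I x) \<partial>leb_I) = enn2real (\<integral>\<^sup>+x. ennreal (enn2real (I x)) \<partial>leb_I)"
      by (rule integral_eq_nn_integral) (use Im in measurable)
    also have "(\<integral>\<^sup>+x. ennreal (enn2real (I x)) \<partial>leb_I) = (\<integral>\<^sup>+x. I x \<partial>leb_I)"
      by (rule nn_integral_cong) (use fI in simp)
    also have "\<dots> = (\<integral>\<^sup>+p. ennreal (h p + c') \<partial>\<mu>)"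
      unfolding I_def by (rule nn_integral_fibre(1)[OF hp, symmetric])
    also have "enn2real \<dots> = (\<integral>p. h p + c' \<partial>\<mu>)"
      by (rule integral_eq_nn_integral[symmetric]) (use hm b' sp in auto)
    finally show ?thesis .
  qed
  also have "\<dots> = (\<integral>p. h p \<partial>\<mu>) + c' * measure \<mu> Sig"
  proof -
    have "integrable \<mu> h" by (rule integrable_const_bound[where B=c']) (use hm b' sp in auto)
    then show ?thesis by (simp add: sp)
  qed
  finally show "(\<integral>p. h p \<partial>\<mu>) = (\<integral>x. (\<integral>y. h (x, y) \<partial>fibre_measure \<mu> x) \<partial>leb_I)" by simp
qed

end

section \<open>Differences of finite measures with absolutely continuous marginals\<close>

lemma marginal_ac_mono:
  fixes \<mu> :: "(real \<times> 'k::polish_space) measure"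
  assumes ac: "absolutely_continuous leb_I (distr \<mu> leb_I fst)"
    and sets: "sets \<mu> = sets borel_Sig" "sets \<nu> = sets borel_Sig"
    and null: "\<And>E. E \<in> sets borel_Sig \<Longrightarrow> emeasure \<mu> E = 0 \<Longrightarrow> emeasure \<nu> E = 0"
  shows "absolutely_continuous leb_I (distr \<nu> leb_I fst)"
  unfolding absolutely_continuous_def
proof
  fix A assume A: "A \<in> null_sets leb_I"
  have f: "fst \<in> \<mu> \<rightarrow>\<^sub>M leb_I" "fst \<in> \<nu> \<rightarrow>\<^sub>M leb_I"
    unfolding measurable_cong_sets[OF sets(1) refl] measurable_cong_sets[OF sets(2) refl] measurable_borel_Sig
    by simp_all
  have sp: "space \<mu> = space \<nu>" using sets sets_eq_imp_space_eq by metis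
  have "A \<in> null_sets (distr \<mu> leb_I fst)" using ac A by (auto simp: absolutely_continuous_def)
  then have A': "A \<in> sets leb_I" "emeasure \<mu> (fst -` A \<inter> space \<mu>) = 0"
    by (auto simp: null_sets_def emeasure_distr[OF f(1)])
  have "fst -` A \<inter> space \<mu> \<in> sets borel_Sig" using measurable_sets[OF f(1) A'(1)] sets by simp
  then have "emeasure \<nu> (fst -` A \<inter> space \<nu>) = 0" using null A'(2) sp by simp
  then show "A \<in> null_sets (distr \<nu> leb_I fst)" using A'(1) by (auto simp: null_sets_def emeasure_distr[OF f(2)])
qed

context
  fixes M1 M2 :: "(real \<times> 'k::polish_space) measure" and \<eta> :: "(real \<times> 'k) set \<Rightarrow> real"
  assumes fin: "finite_measure M1" "finite_measure M2"
    and sets: "sets M1 = sets borel_Sig" "sets M2 = sets borel_Sig"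
    and ac: "absolutely_continuous leb_I (distr M1 leb_I fst)" "absolutely_continuous leb_I (distr M2 leb_I fst)"
    and \<eta>: "\<forall>A\<in>sets borel_Sig. \<eta> A = measure M1 A - measure M2 A"
begin

lemmas jordan_facts = jordan_difference[OF fin sets \<eta>]

lemma jordan_ac:
  "absolutely_continuous leb_I (distr (jordan_pos borel_Sig \<eta>) leb_I fst)"
  "absolutely_continuous leb_I (distr (jordan_neg borel_Sig \<eta>) leb_I fst)"
proof -
  have z: "emeasure P E = 0" if "measure P E \<le> measure M E" "emeasure M E = 0" "finite_measure P"
    for P M :: "(real \<times> 'k) measure" and E
  proof -
    have "measure M E = 0" using that(2) by (simp add: measure_def)
    then have "measure P E = 0" using that(1) measure_nonneg[of P E] by linarith
    then show ?thesis using finite_measure.emeasure_eq_measure[OF that(3), of E] by simp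
  qed
  show "absolutely_continuous leb_I (distr (jordan_pos borel_Sig \<eta>) leb_I fst)"
    by (rule marginal_ac_mono[OF ac(1) sets(1) jordan_facts(3)], rule z[OF jordan_facts(5) _ jordan_facts(1)])
  show "absolutely_continuous leb_I (distr (jordan_neg borel_Sig \<eta>) leb_I fst)"
    by (rule marginal_ac_mono[OF ac(2) sets(2) jordan_facts(4)], rule z[OF jordan_facts(6) _ jordan_facts(2)])
qed

text \<open>Test functions are bounded by 1, so the dual norm of a fibre is at most the sum of the
  two fibre masses, and these are integrable densities.\<close>

lemma difference_in_L1_space: "\<eta> \<in> L1_space"
proof -
  let ?P = "jordan_pos borel_Sig \<eta>" and ?N = "jordan_neg borel_Sig \<eta>"
  have AB: "\<eta> \<in> AB" unfolding AB_def
    using signed_measure_difference[OF fin sets \<eta>] jordan_ac by simp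
  note P = jordan_facts(1,3) jordan_ac(1) and N = jordan_facts(2,4) jordan_ac(2)
  have "L1_norm \<eta> \<le> (\<integral>\<^sup>+x. ennreal (marginal_density ?P x + marginal_density ?N x) \<partial>leb_I)"
    unfolding L1_norm_def
  proof (rule nn_integral_mono)
    fix x :: real assume "x \<in> space leb_I"
    then have x: "x \<in> {0..1}" by simp
    show "W_norm (fibre \<eta> x) \<le> ennreal (marginal_density ?P x + marginal_density ?N x)"
      unfolding fibre_def measure_fibre_measure_UNIV[OF P x, symmetric] measure_fibre_measure_UNIV[OF N x, symmetric]
      by (rule W_norm_difference_le fibre_measure_finite[OF P x] fibre_measure_finite[OF N x]
          fibre_measure_sets[OF P x] fibre_measure_sets[OF N x])+
  qed
  also have "\<dots> < \<infinity>"
    using marginal_density_integrable[OF P] marginal_density_integrable[OF N]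
    by (subst nn_integral_eq_integral) (auto simp: marginal_density_nonneg[OF P] marginal_density_nonneg[OF N])
  finally show ?thesis using AB by (simp add: L1_space_def)
qed

text \<open>Its integrals over base sets determine \<open>signed_density \<eta>\<close> almost
  everywhere, whatever Radon--Nikodym versions were selected; later identifications of densities
  rest on this.\<close>

lemma integral_signed_density:
  shows "integrable leb_I (signed_density \<eta>)"
    and "A \<in> sets leb_I \<Longrightarrow> (\<integral>x. signed_density \<eta> x * indicator A x \<partial>leb_I) = \<eta> (A \<times> UNIV)"
proof -
  note P = jordan_facts(1,3) jordan_ac(1) and N = jordan_facts(2,4) jordan_ac(2)
  show "integrable leb_I (signed_density \<eta>)"
    unfolding signed_density_def[abs_def]
    using marginal_density_integrable[OF P] marginal_density_integrable[OF N] by simp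
  assume A: "A \<in> sets leb_I"
  then have A': "A \<times> UNIV \<in> sets (borel_Sig :: (real \<times> 'k) measure)" by (simp add: sets_borel_Sig)
  have "(\<integral>x. signed_density \<eta> x * indicator A x \<partial>leb_I) =
    (\<integral>x. marginal_density (jordan_pos borel_Sig \<eta>) x * indicator A x - marginal_density (jordan_neg borel_Sig \<eta>) x * indicator A x \<partial>leb_I)"
    by (rule Bochner_Integration.integral_cong) (simp_all add: signed_density_def left_diff_distrib)
  also have "\<dots> = \<eta> (A \<times> UNIV)"
    by (subst Bochner_Integration.integral_diff)
       (simp_all only: integral_marginal_density[OF P A] integral_marginal_density[OF N A] jordan_facts(7)[OF A']
          integrable_real_mult_indicator[OF A marginal_density_integrable[OF P]]
          integrable_real_mult_indicator[OF A marginal_density_integrable[OF N]])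
  finally show "(\<integral>x. signed_density \<eta> x * indicator A x \<partial>leb_I) = \<eta> (A \<times> UNIV)" .
qed

text \<open>On each fibre \<open>u (x, .)\<close> is \<open>c\<close> times an admissible test
  function for \<open>W_norm\<close>, so the pairing there is at most \<open>c\<close> times the
  norm of the fibre; integration over the base gives the claim.\<close>

lemma integral_difference_le_L1_norm:
  fixes u :: "real \<times> 'k \<Rightarrow> real"
  assumes u: "u \<in> borel_measurable (leb_I \<Otimes>\<^sub>M borel)" and c: "0 \<le> c" "\<And>p. p \<in> Sig \<Longrightarrow> \<bar>u p\<bar> \<le> c"
    and lip: "\<And>x y z. x \<in> {0..1} \<Longrightarrow> \<bar>u (x, y) - u (x, z)\<bar> \<le> c * dist y z"
  shows "ennreal \<bar>(\<integral>p. u p \<partial>M1) - (\<integral>p. u p \<partial>M2)\<bar> \<le> ennreal c * L1_norm \<eta>"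
proof (cases "c = 0")
  case True
  have "(\<integral>p. u p \<partial>M) = 0" if "sets M = sets borel_Sig" for M :: "(real \<times> 'k) measure"
  proof -
    have "(\<integral>p. u p \<partial>M) = (\<integral>p. 0 \<partial>M)"
      using c(2) True sets_eq_imp_space_eq[OF that] by (intro Bochner_Integration.integral_cong) (auto simp: space_borel_Sig)
    then show ?thesis by simp
  qed
  then show ?thesis using sets by simp
next
  case False
  then have c0: "0 < c" using c(1) by simp
  let ?P = "jordan_pos borel_Sig \<eta>" and ?N = "jordan_neg borel_Sig \<eta>"
  note P = jordan_facts(1,3) jordan_ac(1) and N = jordan_facts(2,4) jordan_ac(2)
  define D where "D x = (\<integral>y. u (x, y) \<partial>fibre_measure ?P x) - (\<integral>y. u (x, y) \<partial>fibre_measure ?N x)" for x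
  have Di: "integrable leb_I D" unfolding D_def
    using integral_fibre(1)[OF P u c(2)] integral_fibre(1)[OF N u c(2)] by simp
  have "(\<integral>p. u p \<partial>M1) - (\<integral>p. u p \<partial>M2) = signed_integral borel_Sig \<eta> u"
    by (rule integral_jordan_difference[OF fin sets \<eta>, symmetric, where K=c])
       (use u c in \<open>simp_all add: measurable_borel_Sig space_borel_Sig\<close>)
  also have "\<dots> = (\<integral>x. D x \<partial>leb_I)"
    unfolding signed_integral_def D_def
    using integral_fibre[OF P u c(2)] integral_fibre[OF N u c(2)] by simp
  finally have "ennreal \<bar>(\<integral>p. u p \<partial>M1) - (\<integral>p. u p \<partial>M2)\<bar> \<le> ennreal (\<integral>x. \<bar>D x\<bar> \<partial>leb_I)"
    using integral_abs_bound[of leb_I D] by (simp add: ennreal_leI)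
  also have "\<dots> = (\<integral>\<^sup>+x. ennreal \<bar>D x\<bar> \<partial>leb_I)"
    by (rule nn_integral_eq_integral[symmetric]) (use Di in auto)
  \<comment> \<open>The factor is taken out while the integrand is still the measurable
    \<open>D\<close>; after that only monotonicity is used, since measurability of the fibre norms
    in \<open>x\<close> is not at hand.\<close>
  also have "\<dots> = (\<integral>\<^sup>+x. ennreal c * ennreal (\<bar>D x\<bar> / c) \<partial>leb_I)"
    using c0 by (simp add: ennreal_mult'[symmetric])
  also have "\<dots> = ennreal c * (\<integral>\<^sup>+x. ennreal (\<bar>D x\<bar> / c) \<partial>leb_I)"
    by (rule nn_integral_cmult) (use Di in measurable)
  also have "\<dots> \<le> ennreal c * L1_norm \<eta>"
    unfolding L1_norm_def
  proof (intro mult_left_mono nn_integral_mono)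
    fix x :: real assume "x \<in> space leb_I"
    then have x: "x \<in> {0..1}" by simp
    have "ennreal \<bar>D x\<bar> \<le> ennreal c * W_norm (fibre \<eta> x)"
      unfolding D_def fibre_def
      by (rule W_norm_difference_ge)
         (use fibre_measure_finite[OF P x] fibre_measure_finite[OF N x] fibre_measure_sets[OF P x]
           fibre_measure_sets[OF N x] c lip x in \<open>auto simp: Sig_def\<close>)
    then have "ennreal (1 / c) * ennreal \<bar>D x\<bar> \<le> ennreal (1 / c) * (ennreal c * W_norm (fibre \<eta> x))"
      by (rule mult_left_mono) simp
    also have "\<dots> = W_norm (fibre \<eta> x)"
      using c0 by (simp add: mult.assoc[symmetric] ennreal_mult'[symmetric])
    finally show "ennreal (\<bar>D x\<bar> / c) \<le> W_norm (fibre \<eta> x)"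
      using c0 by (simp add: ennreal_mult'[symmetric])
  qed simp
  finally show ?thesis .
qed

end

section \<open>Lipschitz functions\<close>

context
  assumes dist_le_1: "\<And>y z :: 'k::polish_space. dist y z \<le> 1"
begin

context
  fixes u :: "real \<times> 'k \<Rightarrow> real"
  assumes u: "u \<in> Lip_Sig"
begin

lemma lip_bound_lip_const: "lip_bound (lip_const u) u"
proof -
  obtain C where C: "lip_bound C u" using u by (auto simp: Lip_Sig_def)
  have ne: "{C. lip_bound C u} \<noteq> {}" using C by auto
  have "0 \<le> lip_const u" unfolding lip_const_def
    by (rule cInf_greatest[OF ne]) (auto simp: lip_bound_def)
  moreover have "\<bar>u p - u q\<bar> \<le> lip_const u * d_Sig p q" if "p \<in> Sig" "q \<in> Sig" for p q
  proof (cases "d_Sig p q = 0")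
    case True
    then show ?thesis using C that by (force simp: lip_bound_def)
  next
    case False
    then have d: "0 < d_Sig p q" by (simp add: d_Sig_def order_less_le)
    have "\<bar>u p - u q\<bar> / d_Sig p q \<le> lip_const u" unfolding lip_const_def
    proof (rule cInf_greatest[OF ne])
      fix c assume "c \<in> {C. lip_bound C u}"
      then show "\<bar>u p - u q\<bar> / d_Sig p q \<le> c" using that d by (simp add: lip_bound_def divide_le_eq)
    qed
    then show ?thesis using d by (simp add: divide_le_eq)
  qed
  ultimately show ?thesis by (simp add: lip_bound_def)
qed

lemma Lip_const_nonneg: "0 \<le> lip_const u"
  using lip_bound_lip_const by (simp add: lip_bound_def)

lemma Lip_Sig_le: "p \<in> Sig \<Longrightarrow> q \<in> Sig \<Longrightarrow> \<bar>u p - u q\<bar> \<le> lip_const u * d_Sig p q"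
  using lip_bound_lip_const by (simp add: lip_bound_def)

lemma Lip_Sig_borel_measurable: "u \<in> borel_measurable borel_Sig"
  unfolding borel_Sig_def
proof (rule borel_measurable_continuous_on_restrict)
  have "lipschitz_on (lip_const u * 2) Sig u"
  proof (rule lipschitz_onI)
    fix p q :: "real \<times> 'k" assume pq: "p \<in> Sig" "q \<in> Sig"
    have "d_Sig p q \<le> 2 * dist p q"
      using dist_fst_le[of p q] dist_snd_le[of p q] by (simp add: d_Sig_def)
    then have "lip_const u * d_Sig p q \<le> lip_const u * (2 * dist p q)"
      by (rule mult_left_mono) (rule Lip_const_nonneg)
    then show "dist (u p) (u q) \<le> lip_const u * 2 * dist p q"
      using Lip_Sig_le[OF pq] by (simp add: dist_real_def mult.assoc)
  qed (simp add: Lip_const_nonneg)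
  then show "continuous_on Sig u" by (rule lipschitz_on_continuous_on)
qed

lemma Lip_Sig_bdd: "bdd_above ((\<lambda>p. \<bar>u p\<bar>) ` Sig)"
proof (rule bdd_aboveI2)
  fix p :: "real \<times> 'k" assume p: "p \<in> Sig"
  let ?o = "(0, undefined) :: real \<times> 'k"
  have o: "?o \<in> Sig" by (simp add: Sig_def)
  have "d_Sig p ?o \<le> 2"
    using p dist_le_1[of "snd p" undefined] by (auto simp: d_Sig_def Sig_def dist_real_def)
  then have "lip_const u * d_Sig p ?o \<le> lip_const u * 2"
    by (rule mult_left_mono) (rule Lip_const_nonneg)
  then show "\<bar>u p\<bar> \<le> \<bar>u ?o\<bar> + lip_const u * 2"
    using Lip_Sig_le[OF p o] by linarith
qed

lemma Lip_Sig_abs_le: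
  assumes "p \<in> Sig"
  shows "\<bar>u p\<bar> \<le> lip_norm u"
  using cSUP_upper[OF assms Lip_Sig_bdd] Lip_const_nonneg by (simp add: lip_norm_def)

lemma lip_norm_nonneg: "0 \<le> lip_norm u"
  using order_trans[OF abs_ge_zero Lip_Sig_abs_le[of "(0, undefined)"]] by (simp add: Sig_def)

lemma Lip_Sig_fibre_le:
  assumes "x \<in> {0..1}"
  shows "\<bar>u (x, y) - u (x, z)\<bar> \<le> lip_norm u * dist y z"
proof -
  have "lip_const u \<le> lip_norm u"
    using order_trans[OF abs_ge_zero cSUP_upper[OF _ Lip_Sig_bdd, of "(0, undefined)"]]
    by (simp add: lip_norm_def Sig_def)
  then have "lip_const u * dist y z \<le> lip_norm u * dist y z" by (rule mult_right_mono) simp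
  then show ?thesis
    using Lip_Sig_le[of "(x, y)" "(x, z)"] assms by (simp add: Sig_def d_Sig_def)
qed

end

end

section \<open>The invariant measure and decay of correlations\<close>

text \<open>Turns the requirement \<open>measure \<mu> \<in> S1\<close> of
  \<open>invariant_S1\<close> into information about \<open>\<mu>\<close> itself. The null measure
  serves as second term of the difference and dominates the negative part.\<close>

lemma jordan_pos_measure:
  assumes "finite_measure M"
  shows "jordan_pos M (measure M) = M" and "A \<in> sets M \<Longrightarrow> measure (jordan_neg M (measure M)) A = 0"
proof -
  have z: "finite_measure (null_measure M)" by (rule finite_measureI) simp
  have s: "sets (null_measure M) = sets M" by simp
  have \<nu>: "\<forall>A\<in>sets M. measure M A = measure M A - measure (null_measure M) A" by (simp add: measure_def)
  note J = jordan_difference[OF assms z refl s \<nu>]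
  show neg: "measure (jordan_neg M (measure M)) A = 0" if "A \<in> sets M" for A
    using J(6)[OF that] measure_nonneg[of "jordan_neg M (measure M)" A] by (simp add: measure_def[of "null_measure M"])
  show "jordan_pos M (measure M) = M"
  proof (rule measure_eqI)
    fix A assume "A \<in> sets (jordan_pos M (measure M))"
    then have A: "A \<in> sets M" using J(3) by simp
    then show "emeasure (jordan_pos M (measure M)) A = emeasure M A"
      using J(7)[OF A] neg[OF A] finite_measure.emeasure_eq_measure[OF J(1), of A]
        finite_measure.emeasure_eq_measure[OF assms, of A] by simp
  qed (rule J(3))
qed

lemma jordan_pos_cong:
  assumes "sets M = sets N"
  shows "jordan_pos M \<nu> = jordan_pos N \<nu>" "jordan_neg M \<nu> = jordan_neg N \<nu>"
  unfolding jordan_neg_def jordan_pos_def using assms sets_eq_imp_space_eq[OF assms] by simp_all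

context
  fixes \<mu>0 :: "(real \<times> 'k::polish_space) measure" and F :: "real \<times> 'k \<Rightarrow> real \<times> 'k"
  assumes F: "F \<in> borel_Sig \<rightarrow>\<^sub>M borel_Sig" and inv: "invariant_S1 F \<mu>0"
begin

lemma
  shows invariant_prob: "prob_space \<mu>0" and invariant_sets: "sets \<mu>0 = sets borel_Sig"
    and invariant_space: "space \<mu>0 = Sig" and invariant_finite: "finite_measure \<mu>0"
    and invariant_distr: "distr \<mu>0 borel_Sig F = \<mu>0"
proof -
  show "prob_space \<mu>0" "sets \<mu>0 = sets borel_Sig" "distr \<mu>0 borel_Sig F = \<mu>0"
    using inv by (simp_all add: invariant_S1_def)
  then show "space \<mu>0 = Sig" "finite_measure \<mu>0"
    using sets_eq_imp_space_eq[of \<mu>0 borel_Sig] by (simp_all add: space_borel_Sig prob_space.finite_measure)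
qed

lemma invariant_jordan:
  "jordan_pos borel_Sig (measure \<mu>0) = \<mu>0"
  "A \<in> sets borel_Sig \<Longrightarrow> measure (jordan_neg borel_Sig (measure \<mu>0)) A = 0"
  using jordan_pos_measure[OF invariant_finite] jordan_pos_cong[OF invariant_sets, of "measure \<mu>0"] invariant_sets
  by simp_all

lemma invariant_ac: "absolutely_continuous leb_I (distr \<mu>0 leb_I fst)"
  using inv invariant_jordan(1) by (simp add: invariant_S1_def S1_def L1_space_def AB_def)

lemma iterate_measurable: "(F ^^ n) \<in> borel_Sig \<rightarrow>\<^sub>M borel_Sig"
proof (induction n)
  case (Suc n)
  show ?case unfolding funpow.simps by (rule measurable_comp[OF Suc F])
qed (simp add: id_def)

lemma iterate_in_Sig: "p \<in> Sig \<Longrightarrow> (F ^^ n) p \<in> Sig"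
  using measurable_space[OF iterate_measurable[of n], of p] by (simp add: space_borel_Sig)

lemma iterate_distr: "distr \<mu>0 borel_Sig (F ^^ n) = \<mu>0"
proof (induction n)
  case 0
  have "distr \<mu>0 borel_Sig (\<lambda>x. x) = \<mu>0"
    using distr_id[of \<mu>0] distr_cong[of \<mu>0 \<mu>0 borel_Sig \<mu>0 "\<lambda>x. x" "\<lambda>x. x"] invariant_sets by simp
  then show ?case by (simp add: id_def)
next
  case (Suc n)
  have m: "(F ^^ n) \<in> \<mu>0 \<rightarrow>\<^sub>M borel_Sig"
    using iterate_measurable measurable_cong_sets[OF invariant_sets refl] by blast
  have "distr \<mu>0 borel_Sig (F ^^ Suc n) = distr (distr \<mu>0 borel_Sig (F ^^ n)) borel_Sig F"
    by (simp add: distr_distr[OF F m])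
  then show ?case using Suc invariant_distr by (simp del: funpow.simps)
qed

lemma measurable_invariant: "measurable \<mu>0 N = measurable borel_Sig N"
  by (rule measurable_cong_sets[OF invariant_sets refl])

text \<open>Adding \<open>K\<close> turns \<open>u\<close> into a nonnegative density, which
  exhibits the signed measure as a difference of two measures bounded by multiples of
  \<open>\<mu>0\<close>; absolute continuity of their marginals follows from these bounds.\<close>

lemma times_measure_difference:
  fixes u :: "real \<times> 'k \<Rightarrow> real"
  assumes u: "u \<in> borel_measurable borel_Sig" and K: "\<forall>p\<in>Sig. \<bar>u p\<bar> \<le> K" "0 \<le> K"
  defines "M1 \<equiv> density \<mu>0 (\<lambda>p. ennreal (u p + K))" and "M2 \<equiv> density \<mu>0 (\<lambda>p. ennreal K)"
  shows "finite_measure M1" "finite_measure M2" "sets M1 = sets borel_Sig" "sets M2 = sets borel_Sig"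
    and "\<And>E. E \<in> sets borel_Sig \<Longrightarrow> measure M1 E \<le> 2 * K * measure \<mu>0 E"
    and "\<And>E. E \<in> sets borel_Sig \<Longrightarrow> measure M2 E = K * measure \<mu>0 E"
    and "\<forall>E\<in>sets borel_Sig. times_measure u \<mu>0 E = measure M1 E - measure M2 E"
    and "\<And>v. v \<in> borel_measurable borel_Sig \<Longrightarrow> (\<integral>p. v p \<partial>M1) = (\<integral>p. (u p + K) * v p \<partial>\<mu>0)"
proof -
  interpret prob_space \<mu>0 by (rule invariant_prob)
  have um: "u \<in> borel_measurable \<mu>0" using u by (simp add: measurable_invariant)
  have bd: "0 \<le> u p + K" "u p + K \<le> 2 * K" if "p \<in> Sig" for p using bspec[OF K(1) that] by auto
  have ui: "integrable \<mu>0 (\<lambda>p. u p + K)"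
    by (rule integrable_const_bound[where B="2*K"]) (use um bd invariant_space in auto)
  have ui': "integrable \<mu>0 u"
    by (rule integrable_const_bound[where B="K"]) (use um K invariant_space in auto)
  show s: "sets M1 = sets borel_Sig" "sets M2 = sets borel_Sig" by (simp_all add: M1_def M2_def invariant_sets)
  have e1: "emeasure M1 E = ennreal (\<integral>p. (u p + K) * indicator E p \<partial>\<mu>0)" if E: "E \<in> sets borel_Sig" for E
  proof -
    have E': "E \<in> sets \<mu>0" using E invariant_sets by simp
    have "emeasure M1 E = (\<integral>\<^sup>+p. ennreal (u p + K) * indicator E p \<partial>\<mu>0)"
      unfolding M1_def by (rule emeasure_density) (use um E' in auto)
    also have "\<dots> = (\<integral>\<^sup>+p. ennreal ((u p + K) * indicator E p) \<partial>\<mu>0)"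
      by (rule nn_integral_cong) (simp split: split_indicator)
    also have "\<dots> = ennreal (\<integral>p. (u p + K) * indicator E p \<partial>\<mu>0)"
      by (rule nn_integral_eq_integral)
         (use integrable_real_mult_indicator[OF E' ui] bd invariant_space in \<open>auto split: split_indicator\<close>)
    finally show ?thesis .
  qed
  have nn1: "0 \<le> (\<integral>p. (u p + K) * indicator E p \<partial>\<mu>0)" for E
    by (rule Bochner_Integration.integral_nonneg_AE)
       (use bd invariant_space in \<open>auto split: split_indicator\<close>)
  have m1: "measure M1 E = (\<integral>p. (u p + K) * indicator E p \<partial>\<mu>0)" if "E \<in> sets borel_Sig" for E
    using e1[OF that] nn1 by (simp add: measure_def)
  have e2: "emeasure M2 E = ennreal (K * measure \<mu>0 E)" if E: "E \<in> sets borel_Sig" for E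
    using E K(2) invariant_sets
    by (simp add: M2_def emeasure_density_const emeasure_eq_measure ennreal_mult')
  show m2: "measure M2 E = K * measure \<mu>0 E" if "E \<in> sets borel_Sig" for E
    using e2[OF that] K(2) by (simp add: measure_def)
  have top: "space M1 \<in> sets borel_Sig" "space M2 \<in> sets borel_Sig"
    using sets.top[of M1] sets.top[of M2] s by auto
  show "finite_measure M1" by (rule finite_measureI) (simp add: e1[OF top(1)])
  show "finite_measure M2" by (rule finite_measureI) (simp add: e2[OF top(2)])
  show "measure M1 E \<le> 2 * K * measure \<mu>0 E" if E: "E \<in> sets borel_Sig" for E
  proof -
    have E': "E \<in> sets \<mu>0" using E invariant_sets by simp
    have "integrable \<mu>0 (\<lambda>p. indicator E p :: real)"
      by (rule integrable_const_bound[where B=1]) (use E' in auto)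
    then have iK: "integrable \<mu>0 (\<lambda>p. 2 * K * indicator E p)" by simp
    have "measure M1 E \<le> (\<integral>p. 2 * K * indicator E p \<partial>\<mu>0)"
      unfolding m1[OF E]
      by (rule integral_mono_AE)
         (use integrable_real_mult_indicator[OF E' ui] iK bd invariant_space in \<open>auto split: split_indicator\<close>)
    then show ?thesis using E' by simp
  qed
  show "\<forall>E\<in>sets borel_Sig. times_measure u \<mu>0 E = measure M1 E - measure M2 E"
  proof
    fix E :: "(real \<times> 'k) set" assume E: "E \<in> sets borel_Sig"
    then have E': "E \<in> sets \<mu>0" using invariant_sets by simp
    have "(\<integral>p. (u p + K) * indicator E p \<partial>\<mu>0) = (\<integral>p. u p * indicator E p + K * indicator E p \<partial>\<mu>0)"
      by (simp add: distrib_right)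
    also have "\<dots> = (\<integral>p. u p * indicator E p \<partial>\<mu>0) + (\<integral>p. K * indicator E p \<partial>\<mu>0)"
    proof (rule Bochner_Integration.integral_add[OF integrable_real_mult_indicator[OF E' ui']])
      have "integrable \<mu>0 (\<lambda>p. indicator E p :: real)"
        by (rule integrable_const_bound[where B=1]) (use E' in auto)
      then show "integrable \<mu>0 (\<lambda>p. K * indicator E p)" by simp
    qed
    also have "(\<integral>p. K * indicator E p \<partial>\<mu>0) = K * measure \<mu>0 E" using E' by simp
    finally show "times_measure u \<mu>0 E = measure M1 E - measure M2 E"
      using m1[OF E] m2[OF E] by (simp add: times_measure_def set_lebesgue_integral_def mult.commute)
  qed
  show "(\<integral>p. v p \<partial>M1) = (\<integral>p. (u p + K) * v p \<partial>\<mu>0)" if "v \<in> borel_measurable borel_Sig" for v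
    unfolding M1_def
    by (subst integral_density) (use that um bd invariant_space in \<open>auto simp: measurable_invariant\<close>)
qed

lemma density_ac:
  assumes "sets M = sets borel_Sig" "finite_measure M" "\<And>E. E \<in> sets borel_Sig \<Longrightarrow> measure M E \<le> K * measure \<mu>0 E"
  shows "absolutely_continuous leb_I (distr M leb_I fst)"
proof (rule marginal_ac_mono[OF invariant_ac invariant_sets assms(1)])
  fix E :: "(real \<times> 'k) set" assume "E \<in> sets borel_Sig" "emeasure \<mu>0 E = 0"
  then have "measure M E \<le> 0" using assms(3)[of E] by (simp add: measure_def[of \<mu>0])
  then have "measure M E = 0" using measure_nonneg[of M E] by linarith
  then show "emeasure M E = 0" using finite_measure.emeasure_eq_measure[OF assms(2)] by simp
qed

text \<open>One application of \<open>N_op\<close> makes the total mass 0, so all later applications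
  are plain push-forwards, and \<open>\<mu>0\<close> is invariant. Hence a single correction term,
  which is absent for exponent 0; this explains \<open>Suc n\<close>.\<close>

lemma N_op_iterate:
  assumes "E \<in> sets borel_Sig"
  shows "(N_op F \<mu>0 ^^ Suc n) \<nu> E = \<nu> ((F ^^ Suc n) -` E \<inter> Sig) - \<nu> Sig * measure \<mu>0 E"
  using assms
proof (induction n arbitrary: E)
  case 0
  then show ?case by (simp add: N_op_def push_def)
next
  case (Suc n)
  have pull: "F -` A \<inter> Sig \<in> sets borel_Sig" if "A \<in> sets borel_Sig" for A
    using measurable_sets[OF F that] by (simp add: space_borel_Sig)
  have top: "Sig \<in> sets (borel_Sig :: (real \<times> 'k) measure)"
    using sets.top[of "borel_Sig :: (real \<times> 'k) measure"] by (simp add: space_borel_Sig)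
  have "(F ^^ Suc n) -` (Sig :: (real \<times> 'k) set) \<inter> Sig = Sig" using iterate_in_Sig[of _ "Suc n"] by auto
  then have 0: "(N_op F \<mu>0 ^^ Suc n) \<nu> Sig = 0"
    using Suc.IH[OF top] prob_space.prob_space[OF invariant_prob] invariant_space by (simp del: funpow.simps)
  have "measure \<mu>0 (F -` E \<inter> Sig) = measure (distr \<mu>0 borel_Sig F) E"
    by (subst measure_distr) (use F Suc.prems invariant_space in \<open>auto simp: measurable_invariant\<close>)
  then have inv: "measure \<mu>0 (F -` E \<inter> Sig) = measure \<mu>0 E" using invariant_distr by simp
  have set: "(F ^^ Suc n) -` (F -` E \<inter> Sig) \<inter> Sig = (F ^^ Suc (Suc n)) -` E \<inter> Sig"
    using iterate_in_Sig[of _ "Suc n"] by auto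
  have "(N_op F \<mu>0 ^^ Suc (Suc n)) \<nu> E = (N_op F \<mu>0 ^^ Suc n) \<nu> (F -` E \<inter> Sig)
      - (N_op F \<mu>0 ^^ Suc n) \<nu> Sig * measure \<mu>0 E"
    by (simp add: N_op_def push_def)
  also have "\<dots> = \<nu> ((F ^^ Suc n) -` (F -` E \<inter> Sig) \<inter> Sig) - \<nu> Sig * measure \<mu>0 E"
    unfolding 0 Suc.IH[OF pull[OF Suc.prems]] inv by simp
  finally show ?case unfolding set .
qed

lemma decay_of_correlations:
  assumes dist_le_1: "\<And>y z :: 'k. dist y z \<le> 1"
    and gap: "spectral_gap F \<mu>0 l0 U" and u1: "u1 \<in> Lip_Sig" and u2: "u2 \<in> Lip_Sig"
    and S1: "times_measure u2 \<mu>0 \<in> S1" and n: "1 \<le> n"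
  shows "ennreal \<bar>(\<integral>p. u1 ((F ^^ n) p) * u2 p \<partial>\<mu>0) - (\<integral>p. u1 p \<partial>\<mu>0) * (\<integral>p. u2 p \<partial>\<mu>0)\<bar>
    \<le> S1_norm (times_measure u2 \<mu>0) * ennreal (U * lip_norm u1 * l0 ^ n)"
proof -
  interpret prob_space \<mu>0 by (rule invariant_prob)
  define K where "K = lip_norm u2"
  note m1 = Lip_Sig_borel_measurable[OF dist_le_1 u1] and m2 = Lip_Sig_borel_measurable[OF dist_le_1 u2]
  have K: "\<forall>p\<in>Sig. \<bar>u2 p\<bar> \<le> K" "0 \<le> K"
    using Lip_Sig_abs_le[OF dist_le_1 u2] lip_norm_nonneg[OF dist_le_1 u2] by (simp_all add: K_def)
  define M1 M2 where "M1 = density \<mu>0 (\<lambda>p. ennreal (u2 p + K))" and "M2 = density \<mu>0 (\<lambda>p. ennreal K)"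
  note D = times_measure_difference[OF m2 K, folded M1_def M2_def]
  note b1 = Lip_Sig_abs_le[OF dist_le_1 u1]
  define \<nu> where "\<nu> = times_measure u2 \<mu>0"
  define m where "m = measure M1 Sig"
  have Fn: "(F ^^ n) \<in> M1 \<rightarrow>\<^sub>M borel_Sig" using iterate_measurable measurable_cong_sets[OF D(3) refl] by blast
  have spM1: "space M1 = Sig" using sets_eq_imp_space_eq[OF D(3)] by (simp add: space_borel_Sig)
  have top: "Sig \<in> sets (borel_Sig :: (real \<times> 'k) measure)"
    using sets.top[of "borel_Sig :: (real \<times> 'k) measure"] by (simp add: space_borel_Sig)
  \<comment> \<open>Here \<open>\<nu>\<close> is \<open>M1\<close> minus \<open>K\<close> times
    \<open>\<mu>0\<close> and has mass \<open>m - K\<close>. By invariance the two multiples of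
    \<open>\<mu>0\<close> by \<open>K\<close> cancel in the iterate of \<open>N_op\<close>, which
    leaves the difference of \<open>A1\<close> and \<open>A2\<close>.\<close>
  define A1 A2 where "A1 = distr M1 borel_Sig (F ^^ n)" and "A2 = density \<mu>0 (\<lambda>_. ennreal m)"
  have m0: "0 \<le> m" by (simp add: m_def)
  have A1: "measure A1 E = measure M1 ((F ^^ n) -` E \<inter> Sig)" if "E \<in> sets borel_Sig" for E
    unfolding A1_def by (subst measure_distr[OF Fn that]) (simp add: spM1)
  have A2: "measure A2 E = m * measure \<mu>0 E" "emeasure A2 E = ennreal (m * measure \<mu>0 E)" if "E \<in> sets borel_Sig" for E
    using that m0 invariant_sets
    by (simp_all add: A2_def emeasure_density_const emeasure_eq_measure ennreal_mult'[symmetric] measure_def[of "density \<mu>0 (\<lambda>_. ennreal m)"])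
  have pull: "(F ^^ n) -` E \<inter> Sig \<in> sets borel_Sig" if "E \<in> sets borel_Sig" for E
    using measurable_sets[OF iterate_measurable that] by (simp add: space_borel_Sig)
  have inv_n: "measure \<mu>0 ((F ^^ n) -` E \<inter> Sig) = measure \<mu>0 E" if "E \<in> sets borel_Sig" for E
  proof -
    have "measure (distr \<mu>0 borel_Sig (F ^^ n)) E = measure \<mu>0 ((F ^^ n) -` E \<inter> Sig)"
      by (subst measure_distr) (use iterate_measurable that invariant_space in \<open>auto simp: measurable_invariant\<close>)
    then show ?thesis using iterate_distr by simp
  qed
  have fin: "finite_measure A1" "finite_measure A2"
  proof -
    show "finite_measure A1" unfolding A1_def by (rule finite_measure.finite_measure_distr[OF D(1) Fn])
    have "space A2 \<in> sets borel_Sig" using top invariant_space by (simp add: A2_def)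
    then show "finite_measure A2" by (intro finite_measureI) (simp add: A2)
  qed
  have sets: "sets A1 = sets borel_Sig" "sets A2 = sets borel_Sig" by (simp_all add: A1_def A2_def invariant_sets)
  have ac: "absolutely_continuous leb_I (distr A1 leb_I fst)" "absolutely_continuous leb_I (distr A2 leb_I fst)"
  proof -
    show "absolutely_continuous leb_I (distr A1 leb_I fst)"
    proof (rule density_ac[OF sets(1) fin(1), where K="2 * K"])
      show "measure A1 E \<le> 2 * K * measure \<mu>0 E" if "E \<in> sets borel_Sig" for E
        using D(5)[OF pull[OF that]] A1[OF that] inv_n[OF that] by simp
    qed
    show "absolutely_continuous leb_I (distr A2 leb_I fst)"
      by (rule density_ac[OF sets(2) fin(2), where K=m]) (simp add: A2)
  qed
  obtain k where k: "n = Suc k" using n by (cases n) auto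
  have \<nu>Sig: "\<nu> Sig = m - K"
    using bspec[OF D(7) top] D(6)[OF top] prob_space invariant_space by (simp add: \<nu>_def m_def)
  have \<eta>: "\<forall>E\<in>sets borel_Sig. (N_op F \<mu>0 ^^ n) \<nu> E = measure A1 E - measure A2 E"
  proof
    fix E :: "(real \<times> 'k) set" assume E: "E \<in> sets borel_Sig"
    have "(N_op F \<mu>0 ^^ n) \<nu> E = \<nu> ((F ^^ n) -` E \<inter> Sig) - \<nu> Sig * measure \<mu>0 E"
      unfolding k by (rule N_op_iterate[OF E])
    also have "\<nu> ((F ^^ n) -` E \<inter> Sig) = measure A1 E - K * measure \<mu>0 E"
      using bspec[OF D(7) pull[OF E]] D(6)[OF pull[OF E]] A1[OF E] inv_n[OF E] by (simp add: \<nu>_def)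
    finally show "(N_op F \<mu>0 ^^ n) \<nu> E = measure A1 E - measure A2 E"
      unfolding A2(1)[OF E] \<nu>Sig by (simp add: algebra_simps)
  qed
  have i1: "(\<integral>p. u1 p \<partial>A1) = (\<integral>p. u1 ((F ^^ n) p) * u2 p \<partial>\<mu>0) + K * (\<integral>p. u1 p \<partial>\<mu>0)"
  proof -
    have c: "(\<lambda>p. u1 ((F ^^ n) p)) \<in> borel_measurable borel_Sig"
      by (rule measurable_compose[OF iterate_measurable m1])
    have "(\<integral>p. u1 p \<partial>A1) = (\<integral>p. u1 ((F ^^ n) p) \<partial>M1)"
      unfolding A1_def by (rule integral_distr[OF Fn m1])
    also have "\<dots> = (\<integral>p. (u2 p + K) * u1 ((F ^^ n) p) \<partial>\<mu>0)" by (rule D(8)[OF c])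
    also have "\<dots> = (\<integral>p. u1 ((F ^^ n) p) * u2 p + K * u1 ((F ^^ n) p) \<partial>\<mu>0)"
      by (simp add: algebra_simps)
    also have "\<dots> = (\<integral>p. u1 ((F ^^ n) p) * u2 p \<partial>\<mu>0) + (\<integral>p. K * u1 ((F ^^ n) p) \<partial>\<mu>0)"
    proof (rule Bochner_Integration.integral_add)
      have "\<bar>u1 ((F ^^ n) p) * u2 p\<bar> \<le> lip_norm u1 * K" if "p \<in> Sig" for p
        unfolding abs_mult
        by (rule mult_mono[OF b1[OF iterate_in_Sig[OF that]] bspec[OF K(1) that]])
           (simp_all add: lip_norm_nonneg[OF dist_le_1 u1])
      then show "integrable \<mu>0 (\<lambda>p. u1 ((F ^^ n) p) * u2 p)"
        by (intro integrable_const_bound[where B="lip_norm u1 * K"])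
           (use c m2 invariant_space in \<open>auto simp: measurable_invariant\<close>)
      have "\<bar>u1 ((F ^^ n) p)\<bar> \<le> lip_norm u1" if "p \<in> Sig" for p using b1[OF iterate_in_Sig[OF that]] .
      then have "integrable \<mu>0 (\<lambda>p. u1 ((F ^^ n) p))"
        by (intro integrable_const_bound[where B="lip_norm u1"])
           (use c invariant_space in \<open>auto simp: measurable_invariant\<close>)
      then show "integrable \<mu>0 (\<lambda>p. K * u1 ((F ^^ n) p))" by simp
    qed
    also have "(\<integral>p. K * u1 ((F ^^ n) p) \<partial>\<mu>0) = K * (\<integral>p. u1 p \<partial>distr \<mu>0 borel_Sig (F ^^ n))"
      by (subst integral_distr) (use iterate_measurable m1 in \<open>auto simp: measurable_invariant\<close>)
    finally show ?thesis unfolding iterate_distr .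
  qed
  have i2: "(\<integral>p. u1 p \<partial>A2) = m * (\<integral>p. u1 p \<partial>\<mu>0)"
    unfolding A2_def by (subst integral_density) (use m0 m1 in \<open>auto simp: measurable_invariant\<close>)
  have mK: "m = (\<integral>p. u2 p \<partial>\<mu>0) + K"
  proof -
    have "\<nu> Sig = (\<integral>p. u2 p \<partial>\<mu>0)"
      unfolding \<nu>_def times_measure_def set_lebesgue_integral_def
      by (rule Bochner_Integration.integral_cong) (simp_all add: invariant_space)
    then show ?thesis using \<nu>Sig by simp
  qed
  have "(\<integral>p. u1 ((F ^^ n) p) * u2 p \<partial>\<mu>0) - (\<integral>p. u1 p \<partial>\<mu>0) * (\<integral>p. u2 p \<partial>\<mu>0) = (\<integral>p. u1 p \<partial>A1) - (\<integral>p. u1 p \<partial>A2)"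
    unfolding i1 i2 mK by (simp add: algebra_simps)
  then have "ennreal \<bar>(\<integral>p. u1 ((F ^^ n) p) * u2 p \<partial>\<mu>0) - (\<integral>p. u1 p \<partial>\<mu>0) * (\<integral>p. u2 p \<partial>\<mu>0)\<bar>
      = ennreal \<bar>(\<integral>p. u1 p \<partial>A1) - (\<integral>p. u1 p \<partial>A2)\<bar>" by simp
  also have "\<dots> \<le> ennreal (lip_norm u1) * L1_norm ((N_op F \<mu>0 ^^ n) \<nu>)"
    by (rule integral_difference_le_L1_norm[OF fin sets ac \<eta>])
       (use m1 b1 Lip_Sig_fibre_le[OF dist_le_1 u1] lip_norm_nonneg[OF dist_le_1 u1] in \<open>simp_all add: measurable_borel_Sig\<close>)
  also have "\<dots> \<le> ennreal (lip_norm u1) * S1_norm ((N_op F \<mu>0 ^^ n) \<nu>)"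
    by (rule mult_left_mono) (simp_all add: S1_norm_def)
  also have "\<dots> \<le> ennreal (lip_norm u1) * (ennreal (U * l0 ^ n) * S1_norm \<nu>)"
    using gap S1 n unfolding spectral_gap_def \<nu>_def by (intro mult_left_mono) auto
  also have "\<dots> = S1_norm \<nu> * ennreal (U * lip_norm u1 * l0 ^ n)"
    using lip_norm_nonneg[OF dist_le_1 u1]
    by (simp add: mult.assoc[symmetric] ennreal_mult'[symmetric]) (simp add: ac_simps)
  finally show ?thesis by (simp add: \<nu>_def)
qed

end

section \<open>Branch systems and a Lasota--Yorke inequality\<close>

text \<open>Unordered families replace ordered partitions, because pulling intervals back along all
  inverse branches gives a family indexed by pairs, with no useful enumeration.\<close>

definition nonoverlapping :: "'i set \<Rightarrow> ('i \<Rightarrow> real) \<Rightarrow> ('i \<Rightarrow> real) \<Rightarrow> bool" where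
  "nonoverlapping A p q \<longleftrightarrow> finite A \<and> (\<forall>i\<in>A. p i < q i) \<and>
     (\<forall>i\<in>A. \<forall>j\<in>A. i \<noteq> j \<longrightarrow> q i \<le> p j \<or> q j \<le> p i)"

lemma nonoverlapping_subset:
  "nonoverlapping A p q \<Longrightarrow> B \<subseteq> A \<Longrightarrow> nonoverlapping B p q"
  unfolding nonoverlapping_def by (meson finite_subset subsetD)

text \<open>Induction by removing an interval with the largest right endpoint: the others end before
  its left endpoint, where the value of \<open>P\<close> becomes their new bound \<open>hi\<close>.
  The set \<open>X\<close> is there for functions monotone only on part of the line, such as the
  weights.\<close>

lemma nonoverlapping_sum_increments_le:
  fixes P :: "real \<Rightarrow> real"
  assumes "nonoverlapping A p q" "lo \<le> hi"
    and "\<And>i. i \<in> A \<Longrightarrow> p i \<in> X \<and> q i \<in> X" "mono_on X P"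
    and "\<And>i. i \<in> A \<Longrightarrow> lo \<le> P (p i) \<and> P (q i) \<le> hi"
  shows "(\<Sum>i\<in>A. P (q i) - P (p i)) \<le> hi - lo"
  using assms
proof (induction "card A" arbitrary: A hi)
  case 0
  then show ?case by (auto simp: nonoverlapping_def)
next
  case (Suc n)
  have fin: "finite A" using Suc.prems(1) by (simp add: nonoverlapping_def)
  have ne: "A \<noteq> {}" using Suc.hyps by auto
  obtain i where i: "i \<in> A" "\<And>j. j \<in> A \<Longrightarrow> q j \<le> q i"
  proof -
    have "Max (q ` A) \<in> q ` A" using fin ne by simp
    then obtain i where "i \<in> A" "q i = Max (q ` A)" by auto
    then show ?thesis using that[of i] fin by simp
  qed
  have le: "q j \<le> p i" if "j \<in> A - {i}" for j
  proof -
    have "q i \<le> p j \<or> q j \<le> p i" "p j < q j" "q j \<le> q i"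
      using Suc.prems(1) i that unfolding nonoverlapping_def by auto
    then show ?thesis by linarith
  qed
  have "(\<Sum>j\<in>A - {i}. P (q j) - P (p j)) \<le> P (p i) - lo"
  proof (rule Suc.hyps(1))
    show "n = card (A - {i})" using Suc.hyps(2) i(1) fin by simp
    show "nonoverlapping (A - {i}) p q"
      using Suc.prems(1) by (rule nonoverlapping_subset) auto
    show "lo \<le> P (p i)" using Suc.prems(5) i by blast
    show "p j \<in> X \<and> q j \<in> X" if "j \<in> A - {i}" for j using Suc.prems(3) that by blast
    show "lo \<le> P (p j) \<and> P (q j) \<le> P (p i)" if "j \<in> A - {i}" for j
      using Suc.prems(3)[of j] Suc.prems(3)[of i] Suc.prems(5)[of j] that le[OF that] i
        mono_onD[OF Suc.prems(4), of "q j" "p i"] by auto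
  qed (fact Suc.prems)
  moreover have "(\<Sum>j\<in>A. P (q j) - P (p j)) = P (q i) - P (p i) + (\<Sum>j\<in>A - {i}. P (q j) - P (p j))"
    using fin i by (simp add: sum.remove)
  ultimately show ?case using Suc.prems(5)[OF i(1)] by linarith
qed

text \<open>
  Some of the sets \<open>J n\<close> may be empty. By \<open>T_full\<close> the image of a nonempty \<open>J n\<close> is an interval
  with left endpoint \<open>0\<close>; the inverse branch \<open>s n\<close> is \<open>0\<close> and the weight \<open>w n\<close> vanishes off that image.
\<close>

locale branch_system =
  fixes T T' :: "real \<Rightarrow> real" and J :: "nat \<Rightarrow> real set" and C :: "nat \<Rightarrow> real"
  assumes J_open: "open (J n)"
    and J_interval: "is_interval (J n)"
    and J_sub: "J n \<subseteq> {0<..<1}"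
    and J_disj: "disjoint_family J"
    and J_cover: "AE x in leb_I. x \<in> (\<Union>n. J n)"
    and C_summable: "summable C"
    and T_der: "x \<in> J n \<Longrightarrow> (T has_real_derivative T' x) (at x)"
    and T'_mono: "x \<in> J n \<Longrightarrow> y \<in> J n \<Longrightarrow> x \<le> y \<Longrightarrow> T' x \<le> T' y"
    and T'_pos: "x \<in> J n \<Longrightarrow> 0 < T' x"
    and T'_bound: "x \<in> J n \<Longrightarrow> 1 / T' x \<le> C n"
    and C_nonneg: "0 \<le> C n"
    and T_less: "x \<in> J n \<Longrightarrow> y \<in> J n \<Longrightarrow> x < y \<Longrightarrow> T x < T y"
    and T_image: "x \<in> J n \<Longrightarrow> T x \<in> {0<..<1}"
    and T_full: "x \<in> J n \<Longrightarrow> 0 < y \<Longrightarrow> y \<le> T x \<Longrightarrow> y \<in> T ` J n"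
begin

definition s :: "nat \<Rightarrow> real \<Rightarrow> real" where
  "s n y = (if y \<in> T ` J n then the_inv_into (J n) T y else 0)"

definition w :: "nat \<Rightarrow> real \<Rightarrow> real" where
  "w n y = (if y \<in> T ` J n then 1 / T' (s n y) else 0)"

lemma T_inj: "inj_on T (J n)"
  by (rule linorder_inj_onI') (use T_less in fastforce)

lemma s_in: "y \<in> T ` J n \<Longrightarrow> s n y \<in> J n"
  unfolding s_def using the_inv_into_into[OF T_inj, of y n "J n"] by auto

lemma T_s: "y \<in> T ` J n \<Longrightarrow> T (s n y) = y"
  unfolding s_def using f_the_inv_into_f[OF T_inj, of y n] by auto

lemma s_T: "x \<in> J n \<Longrightarrow> s n (T x) = x"
  unfolding s_def using the_inv_into_f_f[OF T_inj, of x n] by auto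

lemma s_less:
  assumes "x \<in> T ` J n" "y \<in> T ` J n" "x < y"
  shows "s n x < s n y"
proof (rule ccontr)
  assume "\<not> s n x < s n y"
  then consider "s n y < s n x" | "s n y = s n x" by linarith
  then show False
    using T_less[OF s_in[OF assms(2)] s_in[OF assms(1)]] T_s[OF assms(1)] T_s[OF assms(2)] assms(3)
    by cases auto
qed

lemma image_down: "y \<in> T ` J n \<Longrightarrow> 0 < x \<Longrightarrow> x \<le> y \<Longrightarrow> x \<in> T ` J n"
  using T_full by blast

lemma w_nonneg: "0 \<le> w n y"
  unfolding w_def using T'_pos[OF s_in] by (auto intro: less_imp_le)

lemma w_le: "w n y \<le> C n"
  unfolding w_def using T'_bound[OF s_in] C_nonneg by auto

text \<open>Convexity makes \<open>T'\<close> increase along a branch, so \<open>w n\<close>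
  decreases on its image. The image reaches down to 0, so the only other change on the positive
  half-line is the drop to 0 at its right end, again a decrease.\<close>

lemma w_antimono:
  assumes "0 < x" "x \<le> y"
  shows "w n y \<le> w n x"
proof (cases "y \<in> T ` J n")
  case True
  then have x: "x \<in> T ` J n" using image_down assms by blast
  have "s n x \<le> s n y" using s_less[OF x True] assms by (cases "x = y") auto
  then have "T' (s n x) \<le> T' (s n y)" using T'_mono s_in x True by blast
  then show ?thesis unfolding w_def using x True T'_pos[OF s_in[OF x]]
    by (simp add: frac_le)
next
  case False
  then show ?thesis using w_nonneg[of n x] by (simp add: w_def)
qed

lemma w_le_suminf: "w n y \<le> suminf C"
proof -
  have "sum C {n} \<le> suminf C"
    by (rule sum_le_suminf) (use C_summable C_nonneg in auto)
  then show ?thesis using w_le[of n y] by simp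
qed

lemma suminf_C_nonneg: "0 \<le> suminf C"
  using suminf_nonneg[OF C_summable] C_nonneg by blast

lemma w_mult_summable:
  assumes "\<And>n. \<bar>v n\<bar> \<le> B"
  shows "summable (\<lambda>n. w n y * v n)" "\<bar>\<Sum>n. w n y * v n\<bar> \<le> suminf C * B"
proof -
  have le: "norm (w n y * v n) \<le> C n * B" for n
    using mult_mono[OF w_le assms C_nonneg] w_nonneg by (simp add: abs_mult)
  have sm: "summable (\<lambda>n. C n * B)" using C_summable by (rule summable_mult2)
  show "summable (\<lambda>n. w n y * v n)" by (rule summable_comparison_test'[OF sm]) (rule le)
  have sn: "summable (\<lambda>n. norm (w n y * v n))"
    by (rule summable_comparison_test'[OF sm]) (use le in auto)
  have "\<bar>\<Sum>n. w n y * v n\<bar> \<le> (\<Sum>n. norm (w n y * v n))"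
    using summable_norm[OF sn] by simp
  also have "\<dots> \<le> (\<Sum>n. C n * B)" by (rule suminf_le[OF le sn sm])
  also have "\<dots> = suminf C * B" using suminf_mult2[OF C_summable, of B] by simp
  finally show "\<bar>\<Sum>n. w n y * v n\<bar> \<le> suminf C * B" .
qed

end

text \<open>
  \<open>D\<close> is a set of full measure on which all the almost sure properties hold pointwise. It is mapped
  into itself by the inverse branches, so that they can be iterated.
\<close>

locale skew_system = branch_system T T' J C
  for T T' :: "real \<Rightarrow> real" and J :: "nat \<Rightarrow> real set" and C :: "nat \<Rightarrow> real" +
  fixes g :: "real \<Rightarrow> 'k::metric_space \<Rightarrow> 'k" and y0 :: 'k
    and \<phi> P :: "real \<Rightarrow> real" and D :: "real set" and M VP ak \<theta> Lc :: real
  assumes D_sub: "D \<subseteq> {0<..<1}"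
    and D_back: "y \<in> D \<Longrightarrow> y \<in> T ` J n \<Longrightarrow> s n y \<in> D"
    and phi_nonneg: "0 \<le> \<phi> x" and phi_le: "\<phi> x \<le> M"
    and phi_fix: "y \<in> D \<Longrightarrow> (\<lambda>n. w n y * \<phi> (s n y)) sums \<phi> y"
    and P_mono: "mono P" and P_range: "0 \<le> P x" "P x \<le> VP"
    and phi_P: "x \<in> D \<Longrightarrow> y \<in> D \<Longrightarrow> x \<le> y \<Longrightarrow> \<bar>\<phi> y - \<phi> x\<bar> \<le> P y - P x"
    and g_fibre: "x \<in> D \<Longrightarrow> dist (g x z1) (g x z2) \<le> ak * dist z1 z2"
    and ak_range: "0 \<le> ak" "ak < 1"
    and theta: "x \<in> D \<Longrightarrow> x \<in> J n \<Longrightarrow> ak / T' x \<le> \<theta>" "0 \<le> \<theta>" "\<theta> < 1"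
    and g_base: "x \<in> J n \<Longrightarrow> x' \<in> J n \<Longrightarrow> dist (g x z) (g x' z) \<le> Lc * \<bar>x - x'\<bar>"
    and Lc_nonneg: "0 \<le> Lc"
    and dist_le_1: "dist (z1 :: 'k) z2 \<le> 1"
begin

text \<open>
  \<open>\<Lambda> m x\<close> is integration against the fibre at \<open>x\<close> of the \<open>m\<close>-th push-forward of \<open>\<phi> m \<times> \<delta>\<^sub>y\<close>,
  where \<open>y = y0\<close>.
\<close>

fun \<Lambda> :: "nat \<Rightarrow> real \<Rightarrow> ('k \<Rightarrow> real) \<Rightarrow> real" where
  "\<Lambda> 0 x h = \<phi> x * h y0"
| "\<Lambda> (Suc m) x h = (\<Sum>n. w n x * \<Lambda> m (s n x) (\<lambda>z. h (g (s n x) z)))"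

lemma M_nonneg: "0 \<le> M"
  using phi_nonneg phi_le order_trans by blast

text \<open>Valid at every \<open>x\<close>, where the fixed point equation for
  \<open>\<phi>\<close> may fail, at the price of dependence on \<open>m\<close>. It secures
  convergence and boundedness; on \<open>D\<close> the bound \<open>\<Lambda>_le_phi\<close> is
  uniform in \<open>m\<close>.\<close>

lemma \<Lambda>_bound:
  assumes "\<And>z. \<bar>h z\<bar> \<le> B"
  shows "\<bar>\<Lambda> m x h\<bar> \<le> suminf C ^ m * (M * B)"
  using assms
proof (induction m arbitrary: x h)
  case 0
  show ?case using mult_mono[OF phi_le 0[of y0] M_nonneg, of x] phi_nonneg
    by (simp add: abs_mult)
next
  case (Suc m)
  have "\<bar>\<Lambda> m (s n x) (\<lambda>z. h (g (s n x) z))\<bar> \<le> suminf C ^ m * (M * B)" for n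
    using Suc by simp
  from w_mult_summable(2)[OF this] show ?case by (simp add: algebra_simps)
qed

lemma \<Lambda>_summable:
  assumes "\<And>z. \<bar>h z\<bar> \<le> B"
  shows "summable (\<lambda>n. w n x * \<Lambda> m (s n x) (\<lambda>z. h (g (s n x) z)))"
  by (rule w_mult_summable[where B = "suminf C ^ m * (M * B)"]) (use assms \<Lambda>_bound in auto)

lemma \<Lambda>_linear:
  assumes "\<And>z. \<bar>h1 z\<bar> \<le> B1" "\<And>z. \<bar>h2 z\<bar> \<le> B2"
  shows "\<Lambda> m x (\<lambda>z. c1 * h1 z + c2 * h2 z) = c1 * \<Lambda> m x h1 + c2 * \<Lambda> m x h2"
  using assms
proof (induction m arbitrary: x h1 h2)
  case 0
  show ?case by (simp add: algebra_simps)
next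
  case (Suc m)
  note S1 = \<Lambda>_summable[where h=h1, OF Suc.prems(1)]
  note S2 = \<Lambda>_summable[where h=h2, OF Suc.prems(2)]
  have "\<Lambda> (Suc m) x (\<lambda>z. c1 * h1 z + c2 * h2 z) =
    (\<Sum>n. c1 * (w n x * \<Lambda> m (s n x) (\<lambda>z. h1 (g (s n x) z))) +
          c2 * (w n x * \<Lambda> m (s n x) (\<lambda>z. h2 (g (s n x) z))))"
    using Suc.IH[of "\<lambda>z. h1 (g _ z)" "\<lambda>z. h2 (g _ z)"] Suc.prems by (simp add: algebra_simps)
  also have "\<dots> = c1 * \<Lambda> (Suc m) x h1 + c2 * \<Lambda> (Suc m) x h2"
    by (simp add: S1 S2 suminf_add[symmetric] suminf_mult[symmetric] summable_mult)
  finally show ?case .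
qed

text \<open>\<open>\<phi>\<close> is a fixed point of the weighted sum over branches, so an estimate
  relative to \<open>\<phi>\<close> reproduces itself without loss, however often it is
  iterated.\<close>

lemma w_phi_le:
  assumes "y \<in> D" "\<And>n. y \<in> T ` J n \<Longrightarrow> \<bar>v n\<bar> \<le> \<phi> (s n y) * B"
  shows "\<bar>\<Sum>n. w n y * v n\<bar> \<le> \<phi> y * B"
proof -
  have le: "norm (w n y * v n) \<le> w n y * \<phi> (s n y) * B" for n
  proof (cases "y \<in> T ` J n")
    case True
    then show ?thesis
      using mult_left_mono[OF assms(2)[OF True] w_nonneg[of n y]] w_nonneg[of n y]
      by (simp add: abs_mult mult.assoc)
  qed (simp add: w_def)
  have sm: "(\<lambda>n. w n y * \<phi> (s n y) * B) sums (\<phi> y * B)"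
    using phi_fix[OF assms(1)] by (rule sums_mult2)
  have sn: "summable (\<lambda>n. norm (w n y * v n))"
    by (rule summable_comparison_test'[OF sums_summable[OF sm]]) (use le in auto)
  have "\<bar>\<Sum>n. w n y * v n\<bar> \<le> (\<Sum>n. norm (w n y * v n))"
    using summable_norm[OF sn] by simp
  also have "\<dots> \<le> (\<Sum>n. w n y * \<phi> (s n y) * B)"
    by (rule suminf_le[OF le sn sums_summable[OF sm]])
  also have "\<dots> = \<phi> y * B" using sm sums_unique by metis
  finally show ?thesis .
qed

lemma \<Lambda>_le_phi:
  assumes "x \<in> D" "\<And>z. \<bar>h z\<bar> \<le> B"
  shows "\<bar>\<Lambda> m x h\<bar> \<le> \<phi> x * B"
  using assms
proof (induction m arbitrary: x h)
  case 0
  show ?case using 0(2)[of y0] phi_nonneg[of x] by (simp add: abs_mult mult_left_mono)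
next
  case (Suc m)
  show ?case unfolding \<Lambda>.simps
  proof (rule w_phi_le[OF Suc.prems(1)], rule Suc.IH)
    show "s n x \<in> D" if "x \<in> T ` J n" for n using D_back[OF Suc.prems(1) that] .
  qed (rule Suc.prems(2))
qed

lemma \<Lambda>_const:
  assumes "x \<in> D"
  shows "\<Lambda> m x (\<lambda>_. c) = c * \<phi> x"
  using assms
proof (induction m arbitrary: x)
  case (Suc m)
  have "w n x * \<Lambda> m (s n x) (\<lambda>z. c) = c * (w n x * \<phi> (s n x))" for n
    using Suc.IH[OF D_back[OF Suc.prems, of n]] by (simp add: w_def)
  have "\<Lambda> (Suc m) x (\<lambda>_. c) = (\<Sum>n. c * (w n x * \<phi> (s n x)))"
    unfolding \<Lambda>.simps by (rule arg_cong[where f=suminf], rule ext) fact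
  then show ?case
    using sums_unique[OF sums_mult[OF phi_fix[OF Suc.prems], of c]] by (simp del: \<Lambda>.simps)
qed simp

lemma \<Lambda>_add_const:
  assumes "x \<in> D" "\<And>z. \<bar>h z\<bar> \<le> B"
  shows "\<Lambda> m x (\<lambda>z. c + d * h z) = c * \<phi> x + d * \<Lambda> m x h"
  using \<Lambda>_linear[where m=m and x=x and ?h1.0="\<lambda>_. 1" and ?B1.0=1 and ?h2.0=h and ?B2.0=B
      and ?c1.0=c and ?c2.0=d] \<Lambda>_const[OF assms(1), of m 1] assms(2) by simp

lemma \<Lambda>_diff:
  assumes "\<And>z. \<bar>h1 z\<bar> \<le> B1" "\<And>z. \<bar>h2 z\<bar> \<le> B2"
  shows "\<Lambda> m x h1 - \<Lambda> m x h2 = \<Lambda> m x (\<lambda>z. h1 z - h2 z)"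
  using \<Lambda>_linear[where m=m and x=x and ?c1.0=1 and ?c2.0="-1", OF assms] by simp

text \<open>Each step composes the test function with a fibre map and multiplies its Lipschitz
  constant by \<open>ak\<close>. What remains at the end is one comparison of \<open>y0\<close> with
  its image, at distance at most 1.\<close>

lemma \<Lambda>_Cauchy:
  assumes "x \<in> D" "0 \<le> l" "\<And>z z'. \<bar>h z - h z'\<bar> \<le> l * dist z z'"
  shows "\<bar>\<Lambda> (Suc m) x h - \<Lambda> m x h\<bar> \<le> \<phi> x * (l * ak ^ m)"
  using assms
proof (induction m arbitrary: x h l)
  have hb: "\<bar>h z\<bar> \<le> \<bar>h y0\<bar> + l"
    if "0 \<le> l" "\<And>z z'. \<bar>h z - h z'\<bar> \<le> l * dist z z'" for h :: "'k \<Rightarrow> real" and l z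
    using that(2)[of z y0] mult_left_mono[OF dist_le_1[of z y0] that(1)] by linarith
  {
    case 0
    have le: "\<bar>h (g (s n x) y0) - h y0\<bar> \<le> l" for n
      using 0(3)[of "g (s n x) y0" y0] mult_left_mono[OF dist_le_1[of "g (s n x) y0" y0] 0(2)] by linarith
    have b: "\<bar>\<phi> (s n x) * h (g (s n x) y0)\<bar> \<le> M * (\<bar>h y0\<bar> + l)" for n
      using mult_mono[OF phi_le hb[OF 0(2,3)] M_nonneg] phi_nonneg by (simp add: abs_mult)
    have "\<Lambda> (Suc 0) x h - \<Lambda> 0 x h =
       (\<Sum>n. w n x * (\<phi> (s n x) * h (g (s n x) y0))) - (\<Sum>n. w n x * \<phi> (s n x) * h y0)"
      using sums_mult2[OF phi_fix[OF 0(1)], of "h y0"] by (simp add: sums_iff)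
    also have "\<dots> = (\<Sum>n. w n x * (\<phi> (s n x) * (h (g (s n x) y0) - h y0)))"
      by (subst suminf_diff[OF w_mult_summable(1)[OF b] sums_summable[OF sums_mult2[OF phi_fix[OF 0(1)]]]])
         (simp add: algebra_simps)
    also have "\<bar>\<dots>\<bar> \<le> \<phi> x * l"
      by (rule w_phi_le[OF 0(1)]) (use le phi_nonneg in \<open>auto simp: abs_mult mult_left_mono\<close>)
    finally show ?case by simp
  next
    case (Suc m)
    note b = hb[OF Suc.prems(2,3)]
    have lip: "\<bar>h (g y z) - h (g y z')\<bar> \<le> (l * ak) * dist z z'" if "y \<in> D" for y z z'
      using Suc.prems(3)[of "g y z" "g y z'"] mult_left_mono[OF g_fibre[OF that, of z z'] Suc.prems(2)]
      by (simp add: mult.assoc)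
    have "\<Lambda> (Suc (Suc m)) x h - \<Lambda> (Suc m) x h =
      (\<Sum>n. w n x * (\<Lambda> (Suc m) (s n x) (\<lambda>z. h (g (s n x) z)) - \<Lambda> m (s n x) (\<lambda>z. h (g (s n x) z))))"
      by (subst \<Lambda>.simps, subst (2) \<Lambda>.simps, subst suminf_diff[OF \<Lambda>_summable[OF b] \<Lambda>_summable[OF b]])
         (simp only: right_diff_distrib)
    also have "\<bar>\<dots>\<bar> \<le> \<phi> x * (l * ak * ak ^ m)"
    proof (rule w_phi_le[OF Suc.prems(1)], rule Suc.IH)
      fix n assume "x \<in> T ` J n"
      then show sx: "s n x \<in> D" using D_back Suc.prems(1) by blast
      show "0 \<le> l * ak" using Suc.prems(2) ak_range by simp
      show "\<bar>h (g (s n x) z) - h (g (s n x) z')\<bar> \<le> l * ak * dist z z'" for z z'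
        by (rule lip) (rule sx)
    qed
    finally show ?case by (simp add: mult.assoc)
  }
qed

text \<open>
  A \<open>1\<close>-Lipschitz function composed with a fibre map is a constant plus \<open>ak\<close> times an element of
  \<open>H0\<close>, and the constant only meets the variation of \<open>\<phi>\<close>; hence the factor \<open>ak\<close> in the
  Lasota--Yorke inequality. A different test function is allowed on each interval.
\<close>

definition H0 :: "('k \<Rightarrow> real) set" where
  "H0 = {h. h y0 = 0 \<and> (\<forall>z z'. \<bar>h z - h z'\<bar> \<le> dist z z')}"

lemma H0_bound: "h \<in> H0 \<Longrightarrow> \<bar>h z\<bar> \<le> 1"
proof -
  assume "h \<in> H0"
  then have "h y0 = 0" "\<bar>h z - h y0\<bar> \<le> dist z y0" unfolding H0_def by blast+
  then show ?thesis using dist_le_1[of z y0] by simp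
qed

text \<open>As each interval may choose its own \<open>h i\<close>, this bounds the variation of the
  path in the norm dual to \<open>H0\<close>. A definition cannot quantify over types, so indices
  are natural numbers; \<open>var_boundD\<close> frees them.\<close>

definition var_bound :: "real \<Rightarrow> (real \<Rightarrow> ('k \<Rightarrow> real) \<Rightarrow> real) \<Rightarrow> bool" where
  "var_bound V F \<longleftrightarrow> (\<forall>(A :: nat set) p q h. nonoverlapping A p q \<longrightarrow>
     (\<forall>i\<in>A. p i \<in> D \<and> q i \<in> D \<and> h i \<in> H0) \<longrightarrow>
     (\<Sum>i\<in>A. \<bar>F (q i) (h i) - F (p i) (h i)\<bar>) \<le> V)"

lemma var_boundD:
  fixes A :: "'i set"
  assumes "var_bound V F" "nonoverlapping A p q"
    and "\<And>i. i \<in> A \<Longrightarrow> p i \<in> D \<and> q i \<in> D \<and> h i \<in> H0"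
  shows "(\<Sum>i\<in>A. \<bar>F (q i) (h i) - F (p i) (h i)\<bar>) \<le> V"
proof -
  have "finite A" using assms(2) by (simp add: nonoverlapping_def)
  from ex_bij_betw_nat_finite[OF this] obtain b where b: "bij_betw b {0..<card A} A" by blast
  have inj: "b i = b j \<longleftrightarrow> i = j" if "i < card A" "j < card A" for i j
    using bij_betw_imp_inj_on[OF b] that by (auto simp: inj_on_def)
  have mem: "b i \<in> A" if "i < card A" for i using bij_betwE[OF b] that by auto
  have "nonoverlapping {0..<card A} (p \<circ> b) (q \<circ> b)"
    using assms(2) mem inj unfolding nonoverlapping_def by auto
  then have "(\<Sum>i\<in>{0..<card A}. \<bar>F ((q \<circ> b) i) ((h \<circ> b) i) - F ((p \<circ> b) i) ((h \<circ> b) i)\<bar>) \<le> V"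
    using assms(1)[unfolded var_bound_def, THEN spec, THEN spec, THEN spec, THEN spec, of "{0..<card A}" "p \<circ> b" "q \<circ> b" "h \<circ> b"]
      assms(3)[OF mem] by simp
  then show ?thesis using sum.reindex_bij_betw[OF b, of "\<lambda>i. \<bar>F (q i) (h i) - F (p i) (h i)\<bar>"] by simp
qed

text \<open>The terms come from the decrease of the weights, at most \<open>C n\<close> on branch
  \<open>n\<close>; from the variation of \<open>\<phi>\<close> paired with constants; and from the
  dependence of the fibre maps on the base, over intervals of total length at most 1.\<close>

definition K_LY :: real where
  "K_LY = suminf C * M + suminf C * VP + suminf C * M * Lc"

lemma K_LY_nonneg: "0 \<le> K_LY"
  unfolding K_LY_def using suminf_C_nonneg M_nonneg Lc_nonneg order_trans[OF P_range] by simp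

text \<open>Subtracting the value at \<open>y0\<close> restores the normalisation, dividing by
  \<open>ak\<close> the Lipschitz constant. For \<open>ak = 0\<close> the composition is constant,
  and division by 0 gives the zero function, so both claims survive.\<close>

lemma fibre_scaled_in_H0:
  assumes "h \<in> H0" "x \<in> D"
  defines "c \<equiv> h (g x y0)"
  shows "(\<lambda>z. (h (g x z) - c) / ak) \<in> H0" "h (g x z) = c + ak * ((h (g x z) - c) / ak)"
proof -
  have lip: "\<bar>h (g x z) - h (g x z')\<bar> \<le> ak * dist z z'" for z z'
    using assms(1) g_fibre[OF assms(2), of z z'] unfolding H0_def by (auto intro: order_trans)
  show "(\<lambda>z. (h (g x z) - c) / ak) \<in> H0"
  proof (cases "ak = 0")
    case False
    then have "0 < ak" using ak_range by simp
    moreover have "\<bar>(h (g x z) - c) / ak - (h (g x z') - c) / ak\<bar> = \<bar>h (g x z) - h (g x z')\<bar> / ak" for z z'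
      using calculation by (simp add: diff_divide_distrib[symmetric])
    ultimately show ?thesis using lip unfolding H0_def c_def
      by (auto simp: divide_le_eq mult.commute)
  qed (simp add: H0_def)
  show "h (g x z) = c + ak * ((h (g x z) - c) / ak)"
    using lip[of z y0] by (cases "ak = 0") (auto simp: c_def)
qed

text \<open>Three successive changes: of the weight, of the base point of \<open>\<Lambda>\<close>
  and of the fibre map. In the second, the test function pulled back by the fibre map over
  \<open>s n q\<close> is split into a constant, which meets only \<open>\<phi>\<close>, and
  \<open>ak\<close> times \<open>h'\<close>; the weight at \<open>p\<close> is \<open>1 / T'\<close>
  at a point of \<open>D\<close>, so its product with \<open>ak\<close> is at most \<theta>.\<close>

lemma branch_increment_le:
  fixes m :: nat
  assumes "h \<in> H0" "p \<in> D" "q \<in> D" "p < q" "q \<in> T ` J n"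
  defines "t \<equiv> \<lambda>x. w n x * \<Lambda> m (s n x) (\<lambda>z. h (g (s n x) z))"
  obtains h' where "h' \<in> H0"
    "\<bar>t q - t p\<bar> \<le> (w n p - w n q) * M + suminf C * (P (s n q) - P (s n p))
       + \<theta> * \<bar>\<Lambda> m (s n q) h' - \<Lambda> m (s n p) h'\<bar> + suminf C * M * Lc * (s n q - s n p)"
proof -
  have p: "p \<in> T ` J n" using image_down[OF assms(5), of p] assms(2,4) D_sub by auto
  define x y where "x = s n p" and "y = s n q"
  have xy: "x \<in> J n" "y \<in> J n" "x \<in> D" "y \<in> D" "x < y"
    using s_in[OF p] s_in[OF assms(5)] D_back[OF assms(2) p] D_back[OF assms(3,5)]
      s_less[OF p assms(5,4)] by (simp_all add: x_def y_def)
  define c where "c = h (g y y0)"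
  define h' where "h' = (\<lambda>z. (h (g y z) - c) / ak)"
  note H' = fibre_scaled_in_H0[OF assms(1) xy(4), folded c_def, folded h'_def]
  have h': "h' \<in> H0" and hh: "\<And>z. h (g y z) = c + ak * h' z"
    using H'(1) fibre_scaled_in_H0(2)[OF assms(1) xy(4), folded c_def] by (auto simp: h'_def)
  have b: "\<And>z. \<bar>h z\<bar> \<le> 1" "\<And>z. \<bar>h' z\<bar> \<le> 1" using assms(1) h' H0_bound by auto
  have wp: "0 \<le> w n p" "w n p \<le> suminf C" "w n p * ak \<le> \<theta>"
    using w_nonneg[of n p] w_le_suminf[of n p] theta(1)[OF xy(3,1)] p by (simp_all add: w_def x_def)
  have wd: "0 \<le> w n p - w n q" using w_antimono[of p q n] assms(2,4) D_sub by auto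
  have t1: "\<bar>(w n q - w n p) * \<Lambda> m y (\<lambda>z. h (g y z))\<bar> \<le> (w n p - w n q) * M"
  proof -
    have "\<bar>\<Lambda> m y (\<lambda>z. h (g y z))\<bar> \<le> \<phi> y * 1" by (rule \<Lambda>_le_phi) (use xy b in auto)
    also have "\<dots> \<le> M" using phi_le by simp
    finally show ?thesis using mult_left_mono[OF _ wd] wd by (simp add: abs_mult abs_minus_commute)
  qed
  have e2: "\<Lambda> m y (\<lambda>z. h (g y z)) - \<Lambda> m x (\<lambda>z. h (g y z)) = c * (\<phi> y - \<phi> x) + ak * (\<Lambda> m y h' - \<Lambda> m x h')"
    unfolding hh using \<Lambda>_add_const[OF xy(4) b(2), of m c ak] \<Lambda>_add_const[OF xy(3) b(2), of m c ak]
    by (simp add: algebra_simps)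
  have t2: "\<bar>w n p * (\<Lambda> m y (\<lambda>z. h (g y z)) - \<Lambda> m x (\<lambda>z. h (g y z)))\<bar>
     \<le> suminf C * (P y - P x) + \<theta> * \<bar>\<Lambda> m y h' - \<Lambda> m x h'\<bar>"
  proof -
    have c1: "\<bar>c\<bar> \<le> 1" using b by (simp add: c_def)
    have "\<bar>c * (\<phi> y - \<phi> x)\<bar> \<le> 1 * (P y - P x)"
      unfolding abs_mult by (rule mult_mono[OF c1]) (use phi_P[OF xy(3,4)] xy in auto)
    then have 1: "w n p * \<bar>c * (\<phi> y - \<phi> x)\<bar> \<le> suminf C * (P y - P x)"
      using mult_mono[OF wp(2) _ suminf_C_nonneg, of "\<bar>c * (\<phi> y - \<phi> x)\<bar>" "P y - P x"] by simp
    have 2: "w n p * (ak * \<bar>\<Lambda> m y h' - \<Lambda> m x h'\<bar>) \<le> \<theta> * \<bar>\<Lambda> m y h' - \<Lambda> m x h'\<bar>"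
      using mult_right_mono[OF wp(3), of "\<bar>\<Lambda> m y h' - \<Lambda> m x h'\<bar>"] by (simp add: mult.assoc)
    have "\<bar>w n p * (c * (\<phi> y - \<phi> x) + ak * (\<Lambda> m y h' - \<Lambda> m x h'))\<bar>
       \<le> w n p * (\<bar>c * (\<phi> y - \<phi> x)\<bar> + ak * \<bar>\<Lambda> m y h' - \<Lambda> m x h'\<bar>)"
      using wp(1) ak_range abs_triangle_ineq[of "c * (\<phi> y - \<phi> x)" "ak * (\<Lambda> m y h' - \<Lambda> m x h')"]
      by (simp add: abs_mult[of "w n p"] abs_mult[of ak] mult_left_mono)
    then show ?thesis unfolding e2 using 1 2 by (simp add: distrib_left)
  qed
  have t3: "\<bar>w n p * (\<Lambda> m x (\<lambda>z. h (g y z)) - \<Lambda> m x (\<lambda>z. h (g x z)))\<bar> \<le> suminf C * M * Lc * (y - x)"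
  proof -
    have l: "\<bar>h (g y z) - h (g x z)\<bar> \<le> Lc * (y - x)" for z
      using assms(1) g_base[OF xy(2,1), of z] xy(5) unfolding H0_def by (auto intro: order_trans)
    have "\<bar>\<Lambda> m x (\<lambda>z. h (g y z)) - \<Lambda> m x (\<lambda>z. h (g x z))\<bar> \<le> \<phi> x * (Lc * (y - x))"
      by (subst \<Lambda>_diff[where ?B1.0=1 and ?B2.0=1]) (use b l xy in \<open>auto intro!: \<Lambda>_le_phi\<close>)
    also have "\<dots> \<le> M * (Lc * (y - x))"
      using phi_le[of x] Lc_nonneg xy by (intro mult_right_mono) auto
    finally have "w n p * \<bar>\<Lambda> m x (\<lambda>z. h (g y z)) - \<Lambda> m x (\<lambda>z. h (g x z))\<bar> \<le> suminf C * (M * (Lc * (y - x)))"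
      by (intro mult_mono[OF wp(2)] suminf_C_nonneg) auto
    then show ?thesis using wp(1) by (simp add: abs_mult mult.assoc)
  qed
  have "t q - t p = (w n q - w n p) * \<Lambda> m y (\<lambda>z. h (g y z))
     + w n p * (\<Lambda> m y (\<lambda>z. h (g y z)) - \<Lambda> m x (\<lambda>z. h (g y z)))
     + w n p * (\<Lambda> m x (\<lambda>z. h (g y z)) - \<Lambda> m x (\<lambda>z. h (g x z)))"
    by (simp add: t_def x_def y_def algebra_simps)
  then have "\<bar>t q - t p\<bar> \<le> (w n p - w n q) * M + suminf C * (P y - P x)
       + \<theta> * \<bar>\<Lambda> m y h' - \<Lambda> m x h'\<bar> + suminf C * M * Lc * (y - x)"
    using t1 t2 t3 by linarith
  then show ?thesis using that[OF h'] by (simp add: x_def y_def)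
qed

text \<open>Intervals inside an image are pulled back; over all branches together they form one
  nonoverlapping family in \<open>D\<close>, so \<open>V\<close> is spent only once. Intervals that
  leave an image are absorbed by the decrease of its weight.\<close>

lemma Lasota_Yorke:
  assumes V: "var_bound V (\<Lambda> m)"
  shows "var_bound (\<theta> * V + K_LY) (\<Lambda> (Suc m))"
  unfolding var_bound_def
proof (intro allI impI)
  fix A :: "nat set" and p q h
  assume no: "nonoverlapping A p q" and D: "\<forall>i\<in>A. p i \<in> D \<and> q i \<in> D \<and> h i \<in> H0"
  have fin: "finite A" using no by (simp add: nonoverlapping_def)
  define t where "t i n x = w n x * \<Lambda> m (s n x) (\<lambda>z. h i (g (s n x) z))" for i n x
  define A' where "A' n = {i\<in>A. q i \<in> T ` J n}" for n
  have ex: "\<exists>h'. h' \<in> H0 \<and> \<bar>t i n (q i) - t i n (p i)\<bar> \<le> (w n (p i) - w n (q i)) * M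
       + suminf C * (P (s n (q i)) - P (s n (p i)))
       + \<theta> * \<bar>\<Lambda> m (s n (q i)) h' - \<Lambda> m (s n (p i)) h'\<bar> + suminf C * M * Lc * (s n (q i) - s n (p i))"
    if "i \<in> A' n" for i n
    using branch_increment_le[of "h i" "p i" "q i" n m] D no that
    unfolding t_def A'_def nonoverlapping_def by (metis (mono_tags, lifting) mem_Collect_eq)
  define h' where "h' = (\<lambda>(n, i). SOME h'. h' \<in> H0 \<and> \<bar>t i n (q i) - t i n (p i)\<bar> \<le> (w n (p i) - w n (q i)) * M
       + suminf C * (P (s n (q i)) - P (s n (p i)))
       + \<theta> * \<bar>\<Lambda> m (s n (q i)) h' - \<Lambda> m (s n (p i)) h'\<bar> + suminf C * M * Lc * (s n (q i) - s n (p i)))"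
  define R where "R = (\<lambda>(n, i). suminf C * (P (s n (q i)) - P (s n (p i)))
       + \<theta> * \<bar>\<Lambda> m (s n (q i)) (h' (n, i)) - \<Lambda> m (s n (p i)) (h' (n, i))\<bar>
       + suminf C * M * Lc * (s n (q i) - s n (p i)))"
  have h': "h' (n, i) \<in> H0 \<and> \<bar>t i n (q i) - t i n (p i)\<bar> \<le> (w n (p i) - w n (q i)) * M + R (n, i)"
    if "i \<in> A' n" for i n
    using someI_ex[OF ex[OF that]] unfolding h'_def R_def prod.case by (simp add: add.assoc)
  have pq: "0 < p i" "p i < q i" "p i \<in> D" "q i \<in> D" if "i \<in> A" for i
    using that D D_sub no by (force simp: nonoverlapping_def)+
  have pT: "p i \<in> T ` J n" if "i \<in> A' n" for i n
    using image_down[of "q i" n "p i"] that pq[of i] by (simp add: A'_def)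
  \<comment> \<open>A bound for all finite sets of branches by the final constant also gives the
    summability needed to exchange the sums over branches and intervals.\<close>
  have partial: "(\<Sum>n<N. \<Sum>i\<in>A. \<bar>t i n (q i) - t i n (p i)\<bar>) \<le> \<theta> * V + K_LY" for N
  proof -
    define I where "I = (SIGMA n:{..<N}. A' n)"
    have finA': "finite (A' n)" for n using fin by (simp add: A'_def)
    have one: "(\<Sum>i\<in>A. \<bar>t i n (q i) - t i n (p i)\<bar>) \<le> C n * M + (\<Sum>i\<in>A' n. R (n, i))" for n
    proof -
      have "(\<Sum>i\<in>A. \<bar>t i n (q i) - t i n (p i)\<bar>)
         \<le> (\<Sum>i\<in>A. (w n (p i) - w n (q i)) * M + (if i \<in> A' n then R (n, i) else 0))"
      proof (rule sum_mono)
        fix i assume i: "i \<in> A"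
        show "\<bar>t i n (q i) - t i n (p i)\<bar> \<le> (w n (p i) - w n (q i)) * M + (if i \<in> A' n then R (n, i) else 0)"
        proof (cases "i \<in> A' n")
          \<comment> \<open>The right endpoint lies beyond the image, so the term there is 0, and
            the term at the left endpoint is at most \<open>M\<close> times the drop of
            \<open>w n\<close> across the interval. No remainder \<open>R\<close> arises.\<close>
          case False
          then have q0: "w n (q i) = 0" using i by (auto simp: A'_def w_def)
          have "\<bar>t i n (p i)\<bar> \<le> w n (p i) * M"
          proof (cases "p i \<in> T ` J n")
            case True
            have "\<bar>\<Lambda> m (s n (p i)) (\<lambda>z. h i (g (s n (p i)) z))\<bar> \<le> \<phi> (s n (p i)) * 1"
              by (rule \<Lambda>_le_phi) (use D i H0_bound D_back True pq in auto)
            also have "\<dots> \<le> M" using phi_le by simp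
            finally show ?thesis unfolding t_def using w_nonneg by (simp add: abs_mult mult_left_mono)
          qed (simp add: t_def w_def)
          then show ?thesis using False q0 by (simp add: t_def)
        qed (use h' in auto)
      qed
      also have "\<dots> = (\<Sum>i\<in>A. (- w n (q i)) - (- w n (p i))) * M + (\<Sum>i\<in>A' n. R (n, i))"
        using fin by (simp add: sum.distrib sum_distrib_right sum.inter_filter[symmetric] A'_def)
      \<comment> \<open>Monotonicity is available on the positive half-line only: at 0 and below the
        weight is 0 by default.\<close>
      also have "(\<Sum>i\<in>A. (- w n (q i)) - (- w n (p i))) \<le> 0 - (- C n)"
      proof (rule nonoverlapping_sum_increments_le[OF no, where X="{0<..}" and P="\<lambda>x. - w n x"])
        show "mono_on {0<..} (\<lambda>x. - w n x)" using w_antimono by (auto simp: mono_on_def)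
      qed (use w_nonneg w_le C_nonneg pq less_trans[OF pq(1,2)] in auto)
      finally show ?thesis using M_nonneg by (simp add: mult_right_mono)
    qed
    \<comment> \<open>Within a branch the increasing \<open>s n\<close> keeps the order of the
      intervals; for different branches the intervals lie in disjoint intervals \<open>J n\<close>
      and \<open>J n'\<close>.\<close>
    have no': "nonoverlapping I (\<lambda>(n, i). s n (p i)) (\<lambda>(n, i). s n (q i))"
      unfolding nonoverlapping_def
    proof (intro conjI ballI impI)
      show "finite I" using finA' by (simp add: I_def)
      show "(case a of (n, i) \<Rightarrow> s n (p i)) < (case a of (n, i) \<Rightarrow> s n (q i))" if "a \<in> I" for a
      proof -
        obtain n i where a: "a = (n, i)" by fastforce
        then have i: "i \<in> A' n" using that by (simp add: I_def)
        then have "i \<in> A" "q i \<in> T ` J n" by (simp_all add: A'_def)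
        then show ?thesis using s_less[OF pT[OF i]] pq(2)[of i] a by simp
      qed
      fix a b assume ab: "a \<in> I" "b \<in> I" "a \<noteq> b"
      obtain n i n' i' where eq: "a = (n, i)" "b = (n', i')" by fastforce
      have i: "i \<in> A' n" "i' \<in> A' n'" using ab eq by (auto simp: I_def)
      then have qT: "q i \<in> T ` J n" "q i' \<in> T ` J n'" "i \<in> A" "i' \<in> A" by (auto simp: A'_def)
      have mem: "s n (p i) \<in> J n" "s n (q i) \<in> J n" "s n' (p i') \<in> J n'" "s n' (q i') \<in> J n'"
        using s_in[OF pT[OF i(1)]] s_in[OF qT(1)] s_in[OF pT[OF i(2)]] s_in[OF qT(2)] by simp_all
      have lt: "s n (p i) < s n (q i)" "s n' (p i') < s n' (q i')"
        using s_less[OF pT[OF i(1)] qT(1) pq(2)] s_less[OF pT[OF i(2)] qT(2) pq(2)] qT(3,4) by simp_all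
      show "(case a of (n, i) \<Rightarrow> s n (q i)) \<le> (case b of (n, i) \<Rightarrow> s n (p i)) \<or>
            (case b of (n, i) \<Rightarrow> s n (q i)) \<le> (case a of (n, i) \<Rightarrow> s n (p i))"
      proof (cases "n = n'")
        case True
        then have "q i \<le> p i' \<or> q i' \<le> p i"
          using ab eq no qT unfolding nonoverlapping_def by blast
        moreover have "s n x \<le> s n y" if "x \<le> y" "x \<in> T ` J n" "y \<in> T ` J n" for x y
          using s_less[of x n y] that by (cases "x = y") auto
        ultimately have "s n (q i) \<le> s n (p i') \<or> s n (q i') \<le> s n (p i)"
          using pT[OF i(1)] pT[OF i(2)] qT True by metis
        then show ?thesis using True eq by simp
      next
        case False
        have disj: "J n \<inter> J n' = {}" using J_disj False by (auto simp: disjoint_family_on_def)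
        have ii: "\<And>n x y z. x \<in> J n \<Longrightarrow> y \<in> J n \<Longrightarrow> x \<le> z \<Longrightarrow> z \<le> y \<Longrightarrow> z \<in> J n"
          using J_interval mem_is_interval_1_I by blast
        show ?thesis
        proof (rule ccontr)
          assume "\<not> ?thesis"
          then have "s n' (p i') < s n (q i)" "s n (p i) < s n' (q i')" using eq by auto
          then have "s n' (p i') \<in> J n \<or> s n (p i) \<in> J n'"
            using ii[OF mem(1,2), of "s n' (p i')"] ii[OF mem(3,4), of "s n (p i)"] by fastforce
          then show False using disj mem by auto
        qed
      qed
    qed
    have inD: "s n (p i) \<in> D \<and> s n (q i) \<in> D" if "(n, i) \<in> I" for n i
    proof -
      from that have i: "i \<in> A' n" by (simp add: I_def)
      then have "i \<in> A" "q i \<in> T ` J n" by (simp_all add: A'_def)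
      then show ?thesis using D_back[OF pq(3) pT[OF i]] D_back[OF pq(4)] by blast
    qed
    have R1: "(\<Sum>(n, i)\<in>I. P (s n (q i)) - P (s n (p i))) \<le> VP"
    proof -
      have "(\<Sum>a\<in>I. P ((\<lambda>(n, i). s n (q i)) a) - P ((\<lambda>(n, i). s n (p i)) a)) \<le> VP - 0"
      proof (rule nonoverlapping_sum_increments_le[OF no', where X=UNIV])
        show "0 \<le> VP" using order_trans[OF P_range] .
        show "mono_on UNIV P" using P_mono .
      qed (use P_range in simp_all)
      then show ?thesis by (simp add: case_prod_unfold)
    qed
    have R2: "(\<Sum>(n, i)\<in>I. s n (q i) - s n (p i)) \<le> 1"
    proof -
      have "(\<Sum>a\<in>I. (\<lambda>x. x) ((\<lambda>(n, i). s n (q i)) a) - (\<lambda>x. x) ((\<lambda>(n, i). s n (p i)) a)) \<le> 1 - 0"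
      proof (rule nonoverlapping_sum_increments_le[OF no', where X=UNIV])
        show "0 \<le> (case a of (n, i) \<Rightarrow> s n (p i)) \<and> (case a of (n, i) \<Rightarrow> s n (q i)) \<le> 1" if "a \<in> I" for a
        proof -
          obtain n i where "a = (n, i)" by fastforce
          then have "s n (p i) \<in> {0<..<1} \<and> s n (q i) \<in> {0<..<1}" using inD[of n i] that D_sub by blast
          then show ?thesis using \<open>a = (n, i)\<close> by simp
        qed
      qed (auto simp: mono_on_def)
      then show ?thesis by (simp add: case_prod_unfold)
    qed
    have R3: "(\<Sum>(n, i)\<in>I. \<bar>\<Lambda> m (s n (q i)) (h' (n, i)) - \<Lambda> m (s n (p i)) (h' (n, i))\<bar>) \<le> V"
    proof -
      have "(\<Sum>a\<in>I. \<bar>\<Lambda> m ((\<lambda>(n, i). s n (q i)) a) (h' a) - \<Lambda> m ((\<lambda>(n, i). s n (p i)) a) (h' a)\<bar>) \<le> V"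
        by (rule var_boundD[OF V no']) (use inD h' in \<open>auto simp: I_def\<close>)
      then show ?thesis by (simp add: case_prod_unfold)
    qed
    have "(\<Sum>n<N. \<Sum>i\<in>A. \<bar>t i n (q i) - t i n (p i)\<bar>) \<le> (\<Sum>n<N. C n * M + (\<Sum>i\<in>A' n. R (n, i)))"
      by (rule sum_mono) (rule one)
    also have "\<dots> = (\<Sum>n<N. C n) * M + (\<Sum>a\<in>I. R a)"
      using finA' by (simp add: sum.distrib sum_distrib_right I_def sum.Sigma)
    also have "(\<Sum>a\<in>I. R a) = suminf C * (\<Sum>(n, i)\<in>I. P (s n (q i)) - P (s n (p i)))
       + \<theta> * (\<Sum>(n, i)\<in>I. \<bar>\<Lambda> m (s n (q i)) (h' (n, i)) - \<Lambda> m (s n (p i)) (h' (n, i))\<bar>)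
       + suminf C * M * Lc * (\<Sum>(n, i)\<in>I. s n (q i) - s n (p i))"
      by (simp add: R_def sum.distrib sum_distrib_left case_prod_unfold)
    also have "(\<Sum>n<N. C n) * M \<le> suminf C * M"
      by (intro mult_right_mono sum_le_suminf) (use C_summable C_nonneg M_nonneg in auto)
    also have "suminf C * (\<Sum>(n, i)\<in>I. P (s n (q i)) - P (s n (p i))) \<le> suminf C * VP"
      using R1 suminf_C_nonneg by (rule mult_left_mono)
    also have "\<theta> * (\<Sum>(n, i)\<in>I. \<bar>\<Lambda> m (s n (q i)) (h' (n, i)) - \<Lambda> m (s n (p i)) (h' (n, i))\<bar>) \<le> \<theta> * V"
      using R3 theta(2) by (rule mult_left_mono)
    also have "suminf C * M * Lc * (\<Sum>(n, i)\<in>I. s n (q i) - s n (p i)) \<le> suminf C * M * Lc * 1"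
      using R2 by (rule mult_left_mono) (use suminf_C_nonneg M_nonneg Lc_nonneg in auto)
    finally show ?thesis by (simp add: K_LY_def)
  qed
  have sm: "summable (\<lambda>n. t i n x)" if "i \<in> A" for i x
    unfolding t_def by (rule \<Lambda>_summable[where B=1]) (use D H0_bound that in auto)
  have nn: "0 \<le> (\<Sum>i\<in>A. \<bar>t i n (q i) - t i n (p i)\<bar>)" for n by (rule sum_nonneg) auto
  have smA: "summable (\<lambda>n. \<Sum>i\<in>A. \<bar>t i n (q i) - t i n (p i)\<bar>)"
    by (rule summableI_nonneg_bounded[OF nn partial])
  have sma: "summable (\<lambda>n. \<bar>t i n (q i) - t i n (p i)\<bar>)" if "i \<in> A" for i
    by (rule summable_comparison_test'[OF smA])
       (use that fin in \<open>simp add: member_le_sum[of i A "\<lambda>i. \<bar>t i _ (q i) - t i _ (p i)\<bar>"]\<close>)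
  have "(\<Sum>i\<in>A. \<bar>\<Lambda> (Suc m) (q i) (h i) - \<Lambda> (Suc m) (p i) (h i)\<bar>)
     \<le> (\<Sum>i\<in>A. \<Sum>n. \<bar>t i n (q i) - t i n (p i)\<bar>)"
  proof (rule sum_mono)
    fix i assume i: "i \<in> A"
    have "\<Lambda> (Suc m) (q i) (h i) - \<Lambda> (Suc m) (p i) (h i) = (\<Sum>n. t i n (q i) - t i n (p i))"
      using suminf_diff[OF sm[OF i] sm[OF i], of "q i" "p i"] by (simp add: t_def)
    also have "\<bar>\<dots>\<bar> \<le> (\<Sum>n. \<bar>t i n (q i) - t i n (p i)\<bar>)"
      by (rule summable_rabs[OF sma[OF i]])
    finally show "\<bar>\<Lambda> (Suc m) (q i) (h i) - \<Lambda> (Suc m) (p i) (h i)\<bar> \<le> \<dots>" .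
  qed
  also have "\<dots> = (\<Sum>n. \<Sum>i\<in>A. \<bar>t i n (q i) - t i n (p i)\<bar>)"
    by (rule suminf_sum[symmetric]) (rule sma)
  also have "\<dots> \<le> \<theta> * V + K_LY" by (rule suminf_le_const[OF smA partial])
  finally show "(\<Sum>i\<in>A. \<bar>\<Lambda> (Suc m) (q i) (h i) - \<Lambda> (Suc m) (p i) (h i)\<bar>) \<le> \<theta> * V + K_LY" .
qed

text \<open>The constant is the fixed point of \<open>V\<close> going to
  \<open>\<theta> * V + K_LY\<close>. The induction can start because functions in \<open>H0\<close>
  vanish at \<open>y0\<close>, so \<open>\<Lambda> 0\<close> is zero on them.\<close>

lemma var_bound_\<Lambda>: "var_bound (K_LY / (1 - \<theta>)) (\<Lambda> m)"
proof (induction m)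
  case 0
  have "0 \<le> K_LY / (1 - \<theta>)" using K_LY_nonneg theta by simp
  then show ?case unfolding var_bound_def H0_def by simp
next
  case (Suc m)
  have "\<theta> * (K_LY / (1 - \<theta>)) + K_LY = K_LY / (1 - \<theta>)" using theta by (simp add: field_simps)
  then show ?case using Lasota_Yorke[OF Suc] by (simp del: \<Lambda>.simps)
qed

end

section \<open>Branches of the iterates of a piecewise convex map\<close>

text \<open>Exceptional sets are handled as \<open>negligible\<close> sets, since images of Borel
  null sets under the branches are null without being visibly Borel.\<close>

lemma AE_leb_I_negligible:
  assumes "negligible N"
  shows "AE x in leb_I. x \<notin> N"
proof -
  have "AE x in lebesgue. x \<notin> N"
    using assms by (simp add: negligible_iff_null_sets AE_not_in)
  then have "AE x in lborel. x \<notin> N" by (simp add: AE_completion_iff)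
  then show ?thesis unfolding leb_I_def by (subst AE_restrict_space_iff) auto
qed

lemma negligible_of_AE_leb_I:
  assumes "AE x in leb_I. P x"
  shows "negligible {x\<in>{0..1}. \<not> P x}"
proof -
  have "AE x in lborel. x \<in> {0..1} \<longrightarrow> P x"
    using assms unfolding leb_I_def by (subst (asm) AE_restrict_space_iff) auto
  then obtain N where N: "\<And>x. x \<in> space lborel - N \<Longrightarrow> x \<in> {0..1} \<longrightarrow> P x" "N \<in> null_sets lborel"
    by (rule AE_E3) (rule that)
  have "negligible N" using N(2) by (simp add: negligible_iff_null_sets null_sets_completionI)
  moreover have "{x\<in>{0..1}. \<not> P x} \<subseteq> N" using N(1) by auto
  ultimately show ?thesis by (rule negligible_subset)
qed

context branch_system
begin

lemma T_increment_ge: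
  assumes "x \<in> J n" "y \<in> J n" "x < y"
  shows "y - x \<le> C n * (T y - T x)"
proof -
  have mem: "z \<in> J n" if "x \<le> z" "z \<le> y" for z
    using J_interval assms that mem_is_interval_1_I by blast
  obtain z where z: "x < z" "z < y" "T y - T x = (y - x) * T' z"
    using MVT2[OF assms(3), of T T'] T_der mem by blast
  have zn: "z \<in> J n" using mem z by simp
  have "1 \<le> C n * T' z" using T'_bound[OF zn] T'_pos[OF zn] by (simp add: divide_le_eq)
  then have "(y - x) * 1 \<le> (y - x) * (C n * T' z)" using assms(3) by (intro mult_left_mono) auto
  then show ?thesis using z(3) by (simp add: mult.left_commute mult.commute)
qed

lemma s_Lipschitz:
  assumes "x \<in> T ` J n" "y \<in> T ` J n"
  shows "\<bar>s n x - s n y\<bar> \<le> C n * \<bar>x - y\<bar>"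
proof -
  have *: "\<bar>s n x - s n y\<bar> \<le> C n * \<bar>x - y\<bar>" if "x \<in> T ` J n" "y \<in> T ` J n" "x < y" for x y
    using T_increment_ge[OF s_in[OF that(1)] s_in[OF that(2)] s_less[OF that]] T_s that s_less[OF that]
    by simp
  consider "x < y" | "x = y" | "y < x" by linarith
  then show ?thesis
    using *[OF assms] *[OF assms(2,1)] by cases (auto simp: abs_minus_commute)
qed

text \<open>The inverse branch is Lipschitz with constant \<open>C n\<close>, and Lipschitz images
  of null sets are null.\<close>

lemma negligible_preimage:
  assumes "negligible N"
  shows "negligible {x \<in> J n. T x \<in> N}"
proof -
  have "negligible (s n ` (N \<inter> T ` J n))"
  proof (rule negligible_locally_Lipschitz_image)
    show "negligible (N \<inter> T ` J n)" using assms by (rule negligible_subset) auto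
    fix x assume x: "x \<in> N \<inter> T ` J n"
    show "\<exists>U B. open U \<and> x \<in> U \<and> (\<forall>y \<in> N \<inter> T ` J n \<inter> U. norm (s n y - s n x) \<le> B * norm (y - x))"
      using x s_Lipschitz by (intro exI[of _ UNIV] exI[of _ "C n"]) auto
  qed simp
  moreover have "{x \<in> J n. T x \<in> N} \<subseteq> s n ` (N \<inter> T ` J n)"
    using s_T by force
  ultimately show ?thesis by (rule negligible_subset)
qed

lemma negligible_image:
  assumes "negligible N"
  shows "negligible (T ` (N \<inter> J n))"
proof (rule negligible_differentiable_image_negligible)
  show "negligible (N \<inter> J n)" using assms by (rule negligible_subset) auto
  show "T differentiable_on N \<inter> J n"
    unfolding differentiable_on_def
    using T_der by (meson IntD2 differentiable_def has_field_derivative_at_within has_field_derivative_def)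
qed simp

lemma J_mem_unique: "x \<in> J m \<Longrightarrow> x \<in> J n \<Longrightarrow> m = n"
  using J_disj by (auto simp: disjoint_family_on_def)

end

lemma summable_prod_decode:
  fixes A B :: "nat \<Rightarrow> real"
  assumes A: "summable A" "\<And>n. 0 \<le> A n" and B: "summable B" "\<And>n. 0 \<le> B n"
  shows "summable (\<lambda>n. A (fst (prod_decode n)) * B (snd (prod_decode n)))"
proof (rule summableI_nonneg_bounded)
  show "0 \<le> A (fst (prod_decode n)) * B (snd (prod_decode n))" for n using A B by simp
  fix N
  define S where "S = prod_decode ` {..<N}"
  have fS: "finite S" by (simp add: S_def)
  have inj: "inj_on prod_decode {..<N}" by (rule inj_prod_decode)
  have "(\<Sum>n<N. A (fst (prod_decode n)) * B (snd (prod_decode n))) = (\<Sum>p\<in>S. A (fst p) * B (snd p))"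
    unfolding S_def by (subst sum.reindex[OF inj]) simp
  also have "\<dots> \<le> (\<Sum>p\<in>fst ` S \<times> snd ` S. A (fst p) * B (snd p))"
    by (rule sum_mono2) (use fS A B in \<open>auto simp: image_iff, force+\<close>)
  also have "\<dots> = (\<Sum>i\<in>fst ` S. A i) * (\<Sum>j\<in>snd ` S. B j)"
    by (simp add: sum_product sum.cartesian_product case_prod_unfold)
  also have "\<dots> \<le> suminf A * suminf B"
    by (intro mult_mono sum_le_suminf sum_nonneg suminf_nonneg) (use A B fS in auto)
  finally show "(\<Sum>n<N. A (fst (prod_decode n)) * B (snd (prod_decode n))) \<le> suminf A * suminf B" .
qed

text \<open>Branches of the composition are indexed by pairs, some of them empty because an image
  under \<open>f\<close> may miss \<open>J2\<close>. Weights multiply, so products of their bounds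
  are summable. \<open>T_full\<close> persists: a point \<open>z\<close> of \<open>J2\<close> below
  \<open>f x\<close> is reached by the same branch of \<open>f\<close>, whose image extends down to
  0.\<close>

lemma branch_system_compose:
  assumes 1: "branch_system f f' J1 C1" and 2: "branch_system T T' J2 C2"
  shows "branch_system (\<lambda>x. T (f x)) (\<lambda>x. T' (f x) * f' x)
    (\<lambda>n. {x \<in> J1 (fst (prod_decode n)). f x \<in> J2 (snd (prod_decode n))})
    (\<lambda>n. C1 (fst (prod_decode n)) * C2 (snd (prod_decode n)))"
proof -
  interpret A: branch_system f f' J1 C1 by (rule 1)
  interpret B: branch_system T T' J2 C2 by (rule 2)
  have le: "f x \<le> f y" if "x \<in> J1 i" "y \<in> J1 i" "x \<le> y" for x y i
    using A.T_less[OF that(1,2)] that(3) by (cases "x = y") auto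
  show ?thesis
  proof
    fix n
    let ?i = "fst (prod_decode n)" and ?m = "snd (prod_decode n)"
    have "continuous_on (J1 ?i) f"
      using A.T_der by (intro continuous_at_imp_continuous_on ballI DERIV_isCont) blast
    then have "open (J1 ?i \<inter> f -` J2 ?m)"
      by (rule continuous_open_preimage[OF _ A.J_open B.J_open])
    moreover have "J1 ?i \<inter> f -` J2 ?m = {x \<in> J1 ?i. f x \<in> J2 ?m}" by auto
    ultimately show "open {x \<in> J1 ?i. f x \<in> J2 ?m}" by simp
    show "is_interval {x \<in> J1 ?i. f x \<in> J2 ?m}"
      unfolding is_interval_1
    proof (intro ballI allI impI)
      fix x y z assume h: "x \<in> {x \<in> J1 ?i. f x \<in> J2 ?m}" "y \<in> {x \<in> J1 ?i. f x \<in> J2 ?m}" "x \<le> z \<and> z \<le> y"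
      then have z: "z \<in> J1 ?i" using mem_is_interval_1_I[OF A.J_interval[of ?i], of x y z] by simp
      then have "f x \<le> f z" "f z \<le> f y" using le h by auto
      then show "z \<in> {x \<in> J1 ?i. f x \<in> J2 ?m}"
        using z h mem_is_interval_1_I[OF B.J_interval[of ?m], of "f x" "f y" "f z"] by simp
    qed
    show "{x \<in> J1 ?i. f x \<in> J2 ?m} \<subseteq> {0<..<1}" using A.J_sub by blast
    show "0 \<le> C1 ?i * C2 ?m" using A.C_nonneg B.C_nonneg by simp
    fix x assume "x \<in> {x \<in> J1 ?i. f x \<in> J2 ?m}"
    then have x: "x \<in> J1 ?i" "f x \<in> J2 ?m" by auto
    show "((\<lambda>x. T (f x)) has_real_derivative T' (f x) * f' x) (at x)"
      using DERIV_chain2[OF B.T_der[OF x(2)] A.T_der[OF x(1)]] .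
    show "0 < T' (f x) * f' x" using A.T'_pos[OF x(1)] B.T'_pos[OF x(2)] by simp
    have "1 / (T' (f x) * f' x) = (1 / f' x) * (1 / T' (f x))" by simp
    also have "\<dots> \<le> C1 ?i * C2 ?m"
      by (rule mult_mono[OF A.T'_bound[OF x(1)] B.T'_bound[OF x(2)] A.C_nonneg])
         (use B.T'_pos[OF x(2)] in simp)
    finally show "1 / (T' (f x) * f' x) \<le> C1 ?i * C2 ?m" .
    show "T (f x) \<in> {0<..<1}" by (rule B.T_image[OF x(2)])
    fix y
    show "y \<in> (\<lambda>x. T (f x)) ` {x \<in> J1 ?i. f x \<in> J2 ?m}" if y: "0 < y" "y \<le> T (f x)"
    proof -
      obtain z where z: "z \<in> J2 ?m" "T z = y" using B.T_full[OF x(2) y] by auto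
      have "z \<le> f x" using B.T_less[OF x(2) z(1)] z(2) y(2) by fastforce
      then obtain x' where "x' \<in> J1 ?i" "f x' = z" using A.T_full[OF x(1), of z] B.J_sub z(1) by force
      then show ?thesis using z by auto
    qed
    assume "y \<in> {x \<in> J1 ?i. f x \<in> J2 ?m}"
    then have y: "y \<in> J1 ?i" "f y \<in> J2 ?m" by auto
    show "T' (f x) * f' x \<le> T' (f y) * f' y" if "x \<le> y"
      by (rule mult_mono[OF B.T'_mono[OF x(2) y(2) le[OF x(1) y(1) that]] A.T'_mono[OF x(1) y(1) that]])
         (use A.T'_pos[OF x(1)] B.T'_pos[OF y(2)] in auto)
    show "T (f x) < T (f y)" if "x < y"
      by (rule B.T_less[OF x(2) y(2) A.T_less[OF x(1) y(1) that]])
  next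
    show "disjoint_family (\<lambda>n. {x \<in> J1 (fst (prod_decode n)). f x \<in> J2 (snd (prod_decode n))})"
      unfolding disjoint_family_on_def
    proof (intro ballI impI)
      fix m n :: nat assume "m \<noteq> n"
      then have "prod_decode m \<noteq> prod_decode n" using inj_prod_decode by (metis injD)
      then show "{x \<in> J1 (fst (prod_decode m)). f x \<in> J2 (snd (prod_decode m))} \<inter>
        {x \<in> J1 (fst (prod_decode n)). f x \<in> J2 (snd (prod_decode n))} = {}"
        using A.J_mem_unique B.J_mem_unique by (auto simp: prod_eq_iff)
    qed
    show "summable (\<lambda>n. C1 (fst (prod_decode n)) * C2 (snd (prod_decode n)))"
      by (rule summable_prod_decode[OF A.C_summable A.C_nonneg B.C_summable B.C_nonneg])
    define N where "N = {x\<in>{0..1}. \<not> x \<in> (\<Union>n. J2 n)}"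
    have N: "negligible N" unfolding N_def by (rule negligible_of_AE_leb_I[OF B.J_cover])
    have "negligible (\<Union>n. {x \<in> J1 n. f x \<in> N})"
      using A.negligible_preimage[OF N] by (intro negligible_countable_Union) auto
    from AE_leb_I_negligible[OF this] A.J_cover
    show "AE x in leb_I. x \<in> (\<Union>n. {x \<in> J1 (fst (prod_decode n)). f x \<in> J2 (snd (prod_decode n))})"
    proof eventually_elim
      case (elim x)
      then obtain i where i: "x \<in> J1 i" "f x \<notin> N" by auto
      then obtain m where "f x \<in> J2 m" using A.T_image[OF i(1)] by (auto simp: N_def)
      then have "x \<in> {x \<in> J1 (fst (prod_decode (prod_encode (i, m)))). f x \<in> J2 (snd (prod_decode (prod_encode (i, m))))}"
        using i by simp
      then show ?case by blast
    qed
  qed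
qed

context
  fixes a b :: "nat \<Rightarrow> real" and f :: "real \<Rightarrow> real"
  assumes T: "class_T a b f"
begin

lemma
  shows ab: "0 \<le> a i" "a i < b i" "b i \<le> 1"
    and f_range: "x \<in> {a i<..<b i} \<Longrightarrow> f x \<in> {0..1}"
    and f_less: "x \<in> {a i<..<b i} \<Longrightarrow> y \<in> {a i<..<b i} \<Longrightarrow> x < y \<Longrightarrow> f x < f y"
    and f_convex: "convex_on {a i<..<b i} f"
    and f_deriv: "x \<in> {a i<..<b i} \<Longrightarrow> (f has_real_derivative deriv f x) (at x)"
    and f_lim: "(f \<longlongrightarrow> 0) (at_right (a i))"
    and slope_pos: "0 < slope0 a f i" and slope_summable: "summable (\<lambda>i. 1 / slope0 a f i)"
    and intervals_disjoint: "disjoint_family (\<lambda>i. {a i<..<b i})"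
    and intervals_cover: "emeasure lborel ({0..1} - (\<Union>i. {a i<..<b i})) = 0"
proof -
  note T' = T[unfolded class_T_def]
  show "0 \<le> a i" "a i < b i" "b i \<le> 1" using T' by auto
  show "x \<in> {a i<..<b i} \<Longrightarrow> f x \<in> {0..1}" using T' by blast
  have "strict_mono_on {a i<..<b i} f" using T' by blast
  then show "x \<in> {a i<..<b i} \<Longrightarrow> y \<in> {a i<..<b i} \<Longrightarrow> x < y \<Longrightarrow> f x < f y" by (rule strict_mono_onD)
  show "convex_on {a i<..<b i} f" using T' by blast
  show "(f has_real_derivative deriv f x) (at x)" if "x \<in> {a i<..<b i}"
  proof -
    have "f differentiable (at x)" using T' that by blast
    then show ?thesis by (simp add: DERIV_deriv_iff_real_differentiable)
  qed
  show "(f \<longlongrightarrow> 0) (at_right (a i))" "0 < slope0 a f i" using T' by blast+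
  show "summable (\<lambda>i. 1 / slope0 a f i)" "disjoint_family (\<lambda>i. {a i<..<b i})"
    "emeasure lborel ({0..1} - (\<Union>i. {a i<..<b i})) = 0" using T' by blast+
qed

text \<open>The sum of the tangent inequalities at the two points.\<close>

lemma deriv_mono:
  assumes "x \<in> {a i<..<b i}" "y \<in> {a i<..<b i}" "x \<le> y"
  shows "deriv f x \<le> deriv f y"
proof (cases "x = y")
  case False
  have tangent: "f v \<ge> f u + deriv f u * (v - u)" if "u \<in> {a i<..<b i}" "v \<in> {a i<..<b i}" for u v
  proof -
    have "f v - f u \<ge> deriv f u * (v - u)"
      by (rule convex_on_imp_above_tangent[OF f_convex[of i]])
         (use that f_deriv in \<open>auto intro: has_field_derivative_at_within\<close>)
    then show ?thesis by simp
  qed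
  have "(deriv f y - deriv f x) * (y - x) \<ge> 0"
    using tangent[OF assms(1,2)] tangent[OF assms(2,1)] by (simp add: algebra_simps)
  then show ?thesis using False assms(3) by (simp add: zero_le_mult_iff)
qed simp

lemma deriv_nonneg: "x \<in> {a i<..<b i} \<Longrightarrow> 0 \<le> deriv f x"
  by (rule mono_on_imp_deriv_nonneg[where A="{a i<..<b i}" and f=f])
     (use f_less f_deriv in \<open>auto simp: mono_on_def le_less interior_open\<close>)

text \<open>\<open>Lim\<close> is informative only if the limit exists. Here the derivative is
  nondecreasing and bounded below by 0, so at the left end it tends to its infimum over the
  branch.\<close>

lemma slope0_le_deriv:
  assumes "x \<in> {a i<..<b i}"
  shows "slope0 a f i \<le> deriv f x"
proof -
  define L where "L = Inf (deriv f ` {a i<..<b i})"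
  have bdd: "bdd_below (deriv f ` {a i<..<b i})" using deriv_nonneg by (intro bdd_belowI2[where m=0]) auto
  have "(deriv f \<longlongrightarrow> L) (at_right (a i))"
  proof (rule decreasing_tendsto)
    show "eventually (\<lambda>x. L \<le> deriv f x) (at_right (a i))"
      unfolding eventually_at_right_field
      using ab(2)[of i] cINF_lower[OF bdd] by (intro exI[of _ "b i"]) (auto simp: L_def)
    fix c assume "L < c"
    then obtain z where z: "z \<in> {a i<..<b i}" "deriv f z < c"
      unfolding L_def using cInf_lessD[of "deriv f ` {a i<..<b i}" c] assms by auto
    have "deriv f y < c" if "a i < y" "y < z" for y
      using deriv_mono[of y i z] z that by auto
    then show "eventually (\<lambda>x. deriv f x < c) (at_right (a i))"
      unfolding eventually_at_right_field using z by (intro exI[of _ z]) auto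
  qed
  then have "slope0 a f i = L" unfolding slope0_def by (rule tendsto_Lim[rotated]) simp
  then show ?thesis using cINF_lower[OF bdd assms] by (simp add: L_def)
qed

text \<open>The limit 0 at the left end and the intermediate value theorem give
  \<open>T_full\<close>. Values lie strictly between 0 and 1 because every point of a branch has
  neighbours on both sides with values in the closed interval.\<close>

lemma class_T_branch_system:
  "branch_system f (deriv f) (\<lambda>i. {a i<..<b i}) (\<lambda>i. 1 / slope0 a f i)"
proof
  fix n
  show "open {a n<..<b n}" "is_interval {a n<..<b n}" by (simp_all add: is_interval_oo)
  show "{a n<..<b n} \<subseteq> {0<..<1}" using ab[of n] by auto
  show "0 \<le> 1 / slope0 a f n" using slope_pos[of n] by simp
  fix x assume x: "x \<in> {a n<..<b n}"
  show "(f has_real_derivative deriv f x) (at x)" by (rule f_deriv[OF x])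
  show pos: "0 < deriv f x" using slope0_le_deriv[OF x] slope_pos[of n] by linarith
  show "1 / deriv f x \<le> 1 / slope0 a f n"
    using slope0_le_deriv[OF x] slope_pos[of n] by (intro divide_left_mono) auto
  show "f x \<in> {0<..<1}"
  proof -
    obtain l r where "a n < l" "l < x" "x < r" "r < b n" using x dense by (metis greaterThanLessThan_iff)
    then show ?thesis using f_less[of l n x] f_less[of x n r] f_range[of l n] f_range[of r n] x by auto
  qed
  fix y
  show "y \<in> f ` {a n<..<b n}" if y: "0 < y" "y \<le> f x"
  proof -
    have "eventually (\<lambda>z. f z < y) (at_right (a n))" using f_lim[of n] y(1) by (rule order_tendstoD)
    then obtain c where c: "a n < c" "\<And>z. a n < z \<Longrightarrow> z < c \<Longrightarrow> f z < y"
      unfolding eventually_at_right_field by auto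
    obtain z where z: "a n < z" "z < min c x" using dense[of "a n" "min c x"] c(1) x by auto
    have "\<exists>t\<ge>z. t \<le> x \<and> f t = y"
    proof (rule IVT')
      show "f z \<le> y" "y \<le> f x" "z \<le> x" using c(2)[of z] z y by auto
      show "continuous_on {z..x} f"
        using f_deriv z x by (intro continuous_at_imp_continuous_on ballI DERIV_isCont[OF f_deriv[of _ n]]) auto
    qed
    then show ?thesis using z x by force
  qed
  assume y: "y \<in> {a n<..<b n}"
  show "x \<le> y \<Longrightarrow> deriv f x \<le> deriv f y" by (rule deriv_mono[OF x y])
  show "x < y \<Longrightarrow> f x < f y" by (rule f_less[OF x y])
next
  show "disjoint_family (\<lambda>i. {a i<..<b i})" by (rule intervals_disjoint)
  show "summable (\<lambda>i. 1 / slope0 a f i)" by (rule slope_summable)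
  have "{0..1} - (\<Union>i. {a i<..<b i}) \<in> null_sets lborel" using intervals_cover by auto
  then have "AE x in lborel. x \<notin> {0..1} - (\<Union>i. {a i<..<b i})" by (rule AE_not_in)
  then show "AE x in leb_I. x \<in> (\<Union>i. {a i<..<b i})"
    unfolding leb_I_def by (subst AE_restrict_space_iff) auto
qed

text \<open>Composing with a further \<open>f\<close> on the inside prefixes an index to the
  itinerary. Membership of the branches in \<open>branch_partition\<close> gives access to the base
  Lipschitz bound of \<open>H3\<close>; empty branches arise from composition and are no elements of
  the partition.\<close>

lemma iterate_branch_system:
  "\<exists>T' J C. branch_system (f ^^ Suc k) T' J C \<and> (\<forall>n. J n \<noteq> {} \<longrightarrow> J n \<in> branch_partition a b f (Suc k))"
proof (induction k)
  case 0
  have "{a n<..<b n} \<in> branch_partition a b f (Suc 0)" for n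
    unfolding branch_partition_def using ab[of n]
    by (auto intro!: exI[of _ "\<lambda>_. n"])
  then show ?case using class_T_branch_system by fastforce
next
  case (Suc k)
  then obtain T' J C where B: "branch_system (f ^^ Suc k) T' J C"
    and J: "\<And>n. J n \<noteq> {} \<Longrightarrow> J n \<in> branch_partition a b f (Suc k)" by blast
  let ?J = "\<lambda>n. {x \<in> {a (fst (prod_decode n))<..<b (fst (prod_decode n))}. f x \<in> J (snd (prod_decode n))}"
  have eq: "(\<lambda>x. (f ^^ Suc k) (f x)) = f ^^ Suc (Suc k)" by (simp add: funpow_Suc_right o_def del: funpow.simps)
  note S = branch_system_compose[OF class_T_branch_system B, unfolded eq]
  have "?J n \<in> branch_partition a b f (Suc (Suc k))" if ne: "?J n \<noteq> {}" for n
  proof -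
    let ?i = "fst (prod_decode n)" and ?m = "snd (prod_decode n)"
    have "J ?m \<noteq> {}" using ne by auto
    from J[OF this] obtain \<iota> :: "nat \<Rightarrow> nat" where
      \<iota>: "J ?m = {x\<in>{0..1}. \<forall>j<Suc k. (f ^^ j) x \<in> {a (\<iota> j)<..<b (\<iota> j)}}"
      unfolding branch_partition_def by blast
    define \<iota>' where "\<iota>' j = (case j of 0 \<Rightarrow> ?i | Suc j \<Rightarrow> \<iota> j)" for j
    have "x \<in> ?J n \<longleftrightarrow> x \<in> {0..1} \<and> (\<forall>j<Suc (Suc k). (f ^^ j) x \<in> {a (\<iota>' j)<..<b (\<iota>' j)})" for x
    proof -
      have "(\<forall>j<Suc (Suc k). (f ^^ j) x \<in> {a (\<iota>' j)<..<b (\<iota>' j)}) \<longleftrightarrow>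
        x \<in> {a ?i<..<b ?i} \<and> (\<forall>j<Suc k. (f ^^ j) (f x) \<in> {a (\<iota> j)<..<b (\<iota> j)})"
        by (subst All_less_Suc2) (simp add: \<iota>'_def funpow_Suc_right del: funpow.simps(2))
      moreover have "x \<in> {0..1}" "f x \<in> {0..1}" if "x \<in> {a ?i<..<b ?i}"
        using that ab[of ?i] f_range[OF that] by auto
      ultimately show ?thesis unfolding \<iota> by blast
    qed
    then have "?J n = {x\<in>{0..1}. \<forall>j<Suc (Suc k). (f ^^ j) x \<in> {a (\<iota>' j)<..<b (\<iota>' j)}}" by blast
    then show ?thesis unfolding branch_partition_def using ne by blast
  qed
  then show ?case using S by blast
qed

end

section \<open>The transfer operator of a branch system\<close>

context branch_system
begin

lemma image_J_subset: "T ` J n \<subseteq> {0<..<1}"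
  using T_image by blast

lemma w_borel [measurable]: "w n \<in> borel_measurable borel"
proof -
  have "mono_on {0<..} (\<lambda>x. - w n x)" using w_antimono by (auto simp: mono_on_def)
  then have "(\<lambda>x. - w n x) \<in> borel_measurable (restrict_space borel {0<..})"
    by (rule borel_measurable_mono_on_fnc)
  then have "(\<lambda>x. indicator {0<..} x *\<^sub>R (- w n x)) \<in> borel_measurable borel"
    by (subst (asm) borel_measurable_restrict_space_iff) auto
  moreover have "(\<lambda>x. indicator {0<..} x *\<^sub>R (- w n x)) = (\<lambda>x. - w n x)"
    using image_J_subset[of n] by (auto simp: w_def fun_eq_iff split: split_indicator)
  ultimately have "(\<lambda>x. - w n x) \<in> borel_measurable borel" by (simp only:)
  then show ?thesis by simp
qed

lemma image_J_iff: "y \<in> T ` J n \<longleftrightarrow> 0 < w n y"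
proof (cases "y \<in> T ` J n")
  case True
  have "0 < w n y" using T'_pos[OF s_in[OF True]] True by (simp add: w_def)
  then show ?thesis using True by blast
qed (simp add: w_def)

lemma image_J_borel [measurable]: "T ` J n \<in> sets borel"
proof -
  have "T ` J n = {y\<in>space borel. 0 < w n y}" using image_J_iff by auto
  also have "\<dots> \<in> sets borel" by measurable
  finally show ?thesis .
qed

lemma s_borel [measurable]: "s n \<in> borel_measurable borel"
proof -
  have "mono_on (T ` J n) (s n)"
  proof (rule mono_onI)
    fix x y assume h: "x \<in> T ` J n" "y \<in> T ` J n" "x \<le> y"
    then show "s n x \<le> s n y" using s_less[OF h(1,2)] by (cases "x = y") auto
  qed
  then have "s n \<in> borel_measurable (restrict_space borel (T ` J n))"
    by (rule borel_measurable_mono_on_fnc)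
  then have "(\<lambda>x. indicator (T ` J n) x *\<^sub>R s n x) \<in> borel_measurable borel"
    by (subst (asm) borel_measurable_restrict_space_iff) auto
  moreover have "(\<lambda>x. indicator (T ` J n) x *\<^sub>R s n x) = s n"
    by (simp add: s_def indicator_def fun_eq_iff)
  ultimately show ?thesis by (simp only:)
qed

lemma s_range: "s n y \<in> {0..1}"
proof (cases "y \<in> T ` J n")
  case True
  then show ?thesis using s_in[OF True] J_sub[of n] by force
qed (simp add: s_def)

lemma s_leb_I [measurable]: "s n \<in> leb_I \<rightarrow>\<^sub>M leb_I"
  by (rule measurable_into_leb_I) (use s_range borel_measurable_leb_I[OF s_borel] in auto)

text \<open>Change of variables on a single branch, the weight being the derivative of the inverse
  branch \<open>s n\<close>. Extension of \<open>u\<close> by 0 to \<open>v\<close> moves the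
  computation from \<open>leb_I\<close> to the whole line.\<close>

lemma branch_integral:
  fixes u :: "real \<Rightarrow> real"
  assumes u: "u \<in> borel_measurable leb_I" and b: "\<forall>x\<in>{0..1}. \<bar>u x\<bar> \<le> B"
  shows "(\<integral>y. w n y * u (s n y) \<partial>leb_I) = (\<integral>x. indicator (J n) x * u x \<partial>leb_I)"
proof -
  define v where "v x = indicator {0..1} x * u x" for x
  have v [measurable]: "v \<in> borel_measurable borel"
    using u unfolding v_def measurable_cong_sets[OF sets_leb_I refl]
    by (subst (asm) borel_measurable_restrict_space_iff) auto
  have vb: "\<bar>v x\<bar> \<le> \<bar>B\<bar>" for x using b by (force simp: v_def split: split_indicator)
  have Jb [measurable]: "J n \<in> sets borel" using J_open by auto
  have set_int: "set_integrable lborel S h"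
    if "S \<in> sets borel" "S \<subseteq> {0..1}" "h \<in> borel_measurable borel" "\<And>x. \<bar>h x\<bar> \<le> c"
    for S and h :: "real \<Rightarrow> real" and c
  proof -
    have "integrable lborel (\<lambda>x. indicator S x *\<^sub>R h x)"
    proof (rule Bochner_Integration.integrable_bound[where f="\<lambda>x. indicator {0..1} x *\<^sub>R c"])
      show "integrable lborel (\<lambda>x::real. indicator {0..1} x *\<^sub>R c)" by simp
      show "AE x in lborel. norm (indicator S x *\<^sub>R h x) \<le> norm (indicator {0..1} x *\<^sub>R c)"
        using that(2,4) order_trans[OF that(4) abs_ge_self] by (intro AE_I2) (auto split: split_indicator)
    qed (use that in simp)
    then show ?thesis by (simp add: set_integrable_def)
  qed
  define h where "h y = w n y * v (s n y)" for y
  have h [measurable]: "h \<in> borel_measurable borel" unfolding h_def by measurable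
  have hb: "\<bar>h y\<bar> \<le> C n * \<bar>B\<bar>" for y
    unfolding h_def abs_mult using w_nonneg w_le[of n y] vb C_nonneg by (intro mult_mono) auto
  have I1: "set_integrable lborel (J n) v"
    by (rule set_int[OF Jb _ v vb]) (use J_sub[of n] in force)
  have I2: "set_integrable lborel (T ` J n) h"
    by (rule set_int[OF image_J_borel _ h hb]) (use image_J_subset[of n] in force)
  have cg: "\<bar>T' x\<bar> * h (T x) = v x" if "x \<in> J n" for x
    using T'_pos[OF that] that s_T[OF that] by (simp add: h_def w_def)
  have J_leb: "J n \<in> sets lebesgue" using Jb by (rule sets_completionI_sets[of _ lborel, simplified])
  \<comment> \<open>The value in the change of variables theorem is chosen to be the integral over
    \<open>J n\<close> itself, so that only integrability remains to be checked on this
    side.\<close>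
  have "(\<lambda>x. \<bar>T' x\<bar> * h (T x)) absolutely_integrable_on J n \<and>
      integral (J n) (\<lambda>x. \<bar>T' x\<bar> * h (T x)) = integral (J n) (\<lambda>x. \<bar>T' x\<bar> * h (T x)) \<longleftrightarrow>
    h absolutely_integrable_on T ` J n \<and> integral (T ` J n) h = integral (J n) (\<lambda>x. \<bar>T' x\<bar> * h (T x))"
    by (rule has_absolute_integral_change_of_variables_1'[OF J_leb _ T_inj])
       (use T_der in \<open>auto intro: has_field_derivative_at_within\<close>)
  moreover have "(\<lambda>x. \<bar>T' x\<bar> * h (T x)) absolutely_integrable_on J n"
  proof -
    have "v absolutely_integrable_on J n"
      using I1 unfolding set_integrable_def by (subst integrable_completion) auto
    then show ?thesis
      by (subst set_integrable_cong[OF refl refl, of _ _ v]) (use cg in auto)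
  qed
  ultimately have "integral (T ` J n) h = integral (J n) (\<lambda>x. \<bar>T' x\<bar> * h (T x))" by blast
  also have "\<dots> = integral (J n) v" by (rule Henstock_Kurzweil_Integration.integral_cong) (rule cg)
  finally have eq: "(LINT y:T ` J n|lborel. h y) = (LINT x:J n|lborel. v x)"
    using set_borel_integral_eq_integral(2)[OF I1] set_borel_integral_eq_integral(2)[OF I2] by simp
  have "(\<integral>y. w n y * u (s n y) \<partial>leb_I) = (\<integral>y. indicator {0..1} y *\<^sub>R (w n y * u (s n y)) \<partial>lborel)"
    unfolding leb_I_def by (rule integral_restrict_space) simp
  also have "\<dots> = (LINT y:T ` J n|lborel. h y)"
    unfolding set_lebesgue_integral_def
  proof (rule Bochner_Integration.integral_cong[OF refl])
    fix y
    show "indicator {0..1} y *\<^sub>R (w n y * u (s n y)) = indicator (T ` J n) y *\<^sub>R h y"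
    proof (cases "y \<in> T ` J n")
      case True
      then have "y \<in> {0..1}" using image_J_subset[of n] by force
      then show ?thesis using True s_range[of n y] by (simp add: h_def v_def)
    qed (simp add: w_def)
  qed
  also have "\<dots> = (\<integral>x. indicator {0..1} x *\<^sub>R (indicator (J n) x * u x) \<partial>lborel)"
    unfolding eq
    unfolding set_lebesgue_integral_def
    by (rule Bochner_Integration.integral_cong[OF refl]) (simp add: v_def split: split_indicator)
  also have "\<dots> = (\<integral>x. indicator (J n) x * u x \<partial>leb_I)"
    unfolding leb_I_def by (rule integral_restrict_space[symmetric]) simp
  finally show ?thesis .
qed

lemma finite_leb_I: "finite_measure leb_I"
  by (rule finite_measureI) (simp add: leb_I_def space_restrict_space emeasure_restrict_space)

lemma transfer_measurable:
  fixes u :: "real \<Rightarrow> real"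
  assumes u [measurable]: "u \<in> borel_measurable leb_I"
  shows "(\<lambda>y. \<Sum>n. w n y * u (s n y)) \<in> borel_measurable leb_I"
proof -
  have [measurable]: "w n \<in> borel_measurable leb_I" for n by (rule borel_measurable_leb_I[OF w_borel])
  show ?thesis by measurable
qed

text \<open>Branch \<open>n\<close> contributes the integral of \<open>u\<close> over
  \<open>J n\<close>, and these sets fill the interval up to a null set. The summable bounds
  \<open>C n * B\<close> justify integrating term by term.\<close>

lemma transfer_integral:
  fixes u :: "real \<Rightarrow> real"
  assumes u [measurable]: "u \<in> borel_measurable leb_I" and b: "\<forall>x\<in>{0..1}. \<bar>u x\<bar> \<le> B"
  shows "(\<integral>y. (\<Sum>n. w n y * u (s n y)) \<partial>leb_I) = (\<integral>x. u x \<partial>leb_I)"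
proof -
  interpret finite_measure leb_I by (rule finite_leb_I)
  have wm [measurable]: "w n \<in> borel_measurable leb_I" for n by (rule borel_measurable_leb_I[OF w_borel])
  have vb: "\<bar>u (s n y)\<bar> \<le> B" for n y using b s_range[of n y] by blast
  then have B0: "0 \<le> B" using order_trans[OF abs_ge_zero] by blast
  have le: "norm (w n y * u (s n y)) \<le> C n * B" for n y
    using mult_mono[OF w_le vb C_nonneg] w_nonneg by (simp add: abs_mult)
  have sm: "summable (\<lambda>n. C n * B)" using C_summable by (rule summable_mult2)
  have int: "integrable leb_I (\<lambda>y. w n y * u (s n y))" for n
    by (rule integrable_const_bound[where B="C n * B"]) (use le in auto)
  have "(\<integral>y. (\<Sum>n. w n y * u (s n y)) \<partial>leb_I) = (\<Sum>n. \<integral>y. w n y * u (s n y) \<partial>leb_I)"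
  proof (rule integral_suminf[OF int])
    show "AE y in leb_I. summable (\<lambda>n. norm (w n y * u (s n y)))"
      by (intro AE_I2 summable_comparison_test'[OF sm]) (use le in auto)
    show "summable (\<lambda>n. \<integral>y. norm (w n y * u (s n y)) \<partial>leb_I)"
    proof (rule summable_comparison_test'[where g="\<lambda>n. C n * B * measure leb_I (space leb_I)"])
      show "summable (\<lambda>n. C n * B * measure leb_I (space leb_I))" using sm by (rule summable_mult2)
      fix n
      have "(\<integral>y. norm (w n y * u (s n y)) \<partial>leb_I) \<le> (\<integral>y. C n * B \<partial>leb_I)"
        by (rule integral_mono) (use int le in auto)
      then show "norm (\<integral>y. norm (w n y * u (s n y)) \<partial>leb_I) \<le> C n * B * measure leb_I (space leb_I)"
        by (simp add: ac_simps)
    qed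
  qed
  also have "\<dots> = (\<Sum>n. (LINT x:J n|leb_I. u x))"
    by (simp add: branch_integral[OF u b] set_lebesgue_integral_def)
  also have "\<dots> = (LINT x:(\<Union>n. J n)|leb_I. u x)"
  proof (rule lebesgue_integral_countable_add[symmetric])
    have J: "J n \<in> sets leb_I" for n
    proof -
      have "J n = J n \<inter> {0..1}" using J_sub[of n] by force
      moreover have "J n \<in> sets borel" using J_open by auto
      ultimately show ?thesis unfolding sets_leb_I sets_restrict_space by (metis image_eqI inf_commute)
    qed
    then show "J n \<in> sets leb_I" for n .
    show "m \<noteq> n \<Longrightarrow> J m \<inter> J n = {}" for m n using J_mem_unique by auto
    have "integrable leb_I (\<lambda>x. indicator (\<Union>n. J n) x *\<^sub>R u x)"
      by (rule integrable_const_bound[where B=B]) (use b B0 J in \<open>auto split: split_indicator\<close>)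
    then show "set_integrable leb_I (\<Union>n. J n) u" by (simp add: set_integrable_def)
  qed
  also have "\<dots> = (\<integral>x. u x \<partial>leb_I)"
  proof -
    have J: "(\<Union>n. J n) \<in> sets borel" using J_open by auto
    have "(\<Union>n. J n) \<subseteq> {0..1}" using J_sub by force
    then have "(\<Union>n. J n) \<in> sets leb_I"
      unfolding sets_leb_I sets_restrict_space using J by (metis Int_absorb1 image_eqI inf_commute)
    then show ?thesis unfolding set_lebesgue_integral_def
    proof (intro integral_cong_AE)
      show "AE x in leb_I. indicator (\<Union>n. J n) x *\<^sub>R u x = u x"
        using J_cover by (rule eventually_mono) (simp add: indicator_def)
    qed simp_all
  qed
  finally show ?thesis .
qed

end

section \<open>Extending functions of bounded variation\<close>

lemma total_variation_le_of_control:
  assumes "\<And>x y. x \<in> {0..1} \<Longrightarrow> y \<in> {0..1} \<Longrightarrow> x \<le> y \<Longrightarrow> \<bar>g y - g x\<bar> \<le> P y - P x"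
    and "\<And>x. x \<in> {0..1} \<Longrightarrow> 0 \<le> P x \<and> P x \<le> W"
  shows "total_variation g \<le> ennreal W"
  unfolding total_variation_def
proof (rule SUP_least)
  fix xs :: "real list" assume "xs \<in> {xs. sorted xs \<and> set xs \<subseteq> {0..1}}"
  then have xs: "sorted xs" "set xs \<subseteq> {0..1}" by auto
  have mem: "i < length xs \<Longrightarrow> xs ! i \<in> {0..1}" for i using xs(2) nth_mem by blast
  have "(\<Sum>i<length xs - 1. \<bar>g (xs ! Suc i) - g (xs ! i)\<bar>) \<le> (\<Sum>i<length xs - 1. P (xs ! Suc i) - P (xs ! i))"
    by (rule sum_mono) (use assms(1) mem sorted_nth_mono[OF xs(1)] in auto)
  also have "\<dots> = P (xs ! (length xs - 1)) - P (xs ! 0)" by (rule sum_lessThan_telescope)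
  also have "\<dots> \<le> W"
  proof (cases "xs = []")
    case True
    then show ?thesis using order_trans[of 0 "P 0" W] assms(2)[of 0] by simp
  next
    case False
    then show ?thesis using assms(2)[OF mem[of "length xs - 1"]] assms(2)[OF mem[of 0]] by simp
  qed
  finally show "(\<Sum>i<length xs - 1. ennreal \<bar>g (xs ! Suc i) - g (xs ! i)\<bar>) \<le> ennreal W"
    by (simp add: sum_ennreal ennreal_leI)
qed

text \<open>
  The extension is McShane's, with respect to the pseudometric \<open>|P x - P y|\<close> given by the variation
  \<open>P\<close> of \<open>\<psi>\<close> along \<open>D\<close>.
\<close>

lemma bounded_variation_extension:
  fixes \<psi> :: "real \<Rightarrow> real"
  assumes D: "D \<noteq> {}" "D \<subseteq> {0..1}"
    and W: "\<forall>(A :: nat set) p q. nonoverlapping A p q \<longrightarrow> (\<forall>i\<in>A. p i \<in> D \<and> q i \<in> D) \<longrightarrow>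
      (\<Sum>i\<in>A. \<bar>\<psi> (q i) - \<psi> (p i)\<bar>) \<le> W"
  obtains g where "\<And>x. x \<in> D \<Longrightarrow> g x = \<psi> x" "total_variation g \<le> ennreal W"
proof -
  define S where "S x = {v. \<exists>(A :: nat set) p q. nonoverlapping A p q \<and>
    (\<forall>i\<in>A. p i \<in> D \<and> q i \<in> D \<and> q i \<le> x) \<and> v = (\<Sum>i\<in>A. \<bar>\<psi> (q i) - \<psi> (p i)\<bar>)}" for x
  define P where "P x = Sup (S x)" for x
  have z: "0 \<in> S x" for x
    unfolding S_def by (intro CollectI exI[of _ "{}"]) (auto simp: nonoverlapping_def)
  have ub: "v \<le> W" if "v \<in> S x" for v x using that W unfolding S_def by blast
  then have bdd: "bdd_above (S x)" for x by (rule bdd_aboveI)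
  have P0: "0 \<le> P x" for x unfolding P_def by (rule cSup_upper[OF z bdd])
  have PW: "P x \<le> W" for x unfolding P_def by (rule cSup_least) (use z ub in auto)
  have Pmono: "P x \<le> P y" if "x \<le> y" for x y
    unfolding P_def
  proof (rule cSup_subset_mono)
    show "S x \<subseteq> S y" unfolding S_def using that order_trans by blast
  qed (use z bdd in auto)
  \<comment> \<open>A family that ends before \<open>x\<close> can be enlarged, under a fresh index,
    by the interval from \<open>x\<close> to \<open>y\<close>.\<close>
  have inc: "\<bar>\<psi> y - \<psi> x\<bar> \<le> P y - P x" if "x \<in> D" "y \<in> D" "x < y" for x y
  proof -
    have "P x \<le> P y - \<bar>\<psi> y - \<psi> x\<bar>"
      unfolding P_def[of x]
    proof (rule cSup_least)
      fix v assume "v \<in> S x"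
      then obtain A :: "nat set" and p q where A: "nonoverlapping A p q"
        "\<forall>i\<in>A. p i \<in> D \<and> q i \<in> D \<and> q i \<le> x" and v: "v = (\<Sum>i\<in>A. \<bar>\<psi> (q i) - \<psi> (p i)\<bar>)"
        unfolding S_def by blast
      have fin: "finite A" using A(1) by (simp add: nonoverlapping_def)
      obtain k where k: "k \<notin> A" using ex_new_if_finite[OF infinite_UNIV_nat fin] by blast
      define p' q' where "p' = p(k := x)" and "q' = q(k := y)"
      have same: "i \<in> A \<Longrightarrow> p' i = p i \<and> q' i = q i" for i using k by (auto simp: p'_def q'_def)
      have k': "p' k = x" "q' k = y" by (simp_all add: p'_def q'_def)
      have no: "nonoverlapping (insert k A) p' q'"
        unfolding nonoverlapping_def
      proof (intro conjI ballI impI)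
        show "finite (insert k A)" using fin by simp
        show "p' i < q' i" if "i \<in> insert k A" for i
          using that same k' \<open>x < y\<close> A(1) by (auto simp: nonoverlapping_def)
        fix i j assume ij: "i \<in> insert k A" "j \<in> insert k A" "i \<noteq> j"
        show "q' i \<le> p' j \<or> q' j \<le> p' i"
          using ij same k' A unfolding nonoverlapping_def by (metis insert_iff)
      qed
      have "(\<Sum>i\<in>insert k A. \<bar>\<psi> (q' i) - \<psi> (p' i)\<bar>) \<in> S y"
        unfolding S_def using no same k' that A(2)
        by (intro CollectI exI[of _ "insert k A"] exI[of _ p'] exI[of _ q']) (auto intro: order_trans)
      moreover have "(\<Sum>i\<in>insert k A. \<bar>\<psi> (q' i) - \<psi> (p' i)\<bar>) = \<bar>\<psi> y - \<psi> x\<bar> + v"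
        using fin k k' same by (simp add: v)
      ultimately have "\<bar>\<psi> y - \<psi> x\<bar> + v \<le> P y" unfolding P_def by (metis cSup_upper bdd)
      then show "v \<le> P y - \<bar>\<psi> y - \<psi> x\<bar>" by simp
    qed (use z in blast)
    then show ?thesis by simp
  qed
  have Lip: "\<psi> x \<le> \<psi> t + \<bar>P x - P t\<bar>" if "x \<in> D" "t \<in> D" for x t
  proof -
    consider "x < t" | "x = t" | "t < x" by linarith
    then show ?thesis using inc[of x t] inc[of t x] that by cases auto
  qed
  define g where "g x = (INF t\<in>D. \<psi> t + \<bar>P x - P t\<bar>)" for x
  obtain d where d: "d \<in> D" using D by blast
  have bb: "bdd_below ((\<lambda>t. \<psi> t + \<bar>P x - P t\<bar>) ` D)" for x
  proof (rule bdd_belowI2[where m="\<psi> d - W"])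
    fix t assume "t \<in> D"
    then have "\<psi> d \<le> \<psi> t + \<bar>P d - P t\<bar>" using Lip d by blast
    moreover have "\<bar>P d - P t\<bar> \<le> W" using P0[of d] P0[of t] PW[of d] PW[of t] by linarith
    ultimately show "\<psi> d - W \<le> \<psi> t + \<bar>P x - P t\<bar>" using abs_ge_zero[of "P x - P t"] by linarith
  qed
  have gle: "g x \<le> g y + \<bar>P x - P y\<bar>" for x y
  proof -
    have "g x - \<bar>P x - P y\<bar> \<le> g y" unfolding g_def[of y]
    proof (rule cINF_greatest[OF D(1)])
      fix t assume "t \<in> D"
      then have "g x \<le> \<psi> t + \<bar>P x - P t\<bar>" unfolding g_def by (rule cINF_lower[OF bb])
      then show "g x - \<bar>P x - P y\<bar> \<le> \<psi> t + \<bar>P y - P t\<bar>" by linarith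
    qed
    then show ?thesis by simp
  qed
  show thesis
  proof (rule that)
    fix x assume x: "x \<in> D"
    show "g x = \<psi> x"
    proof (rule antisym)
      show "g x \<le> \<psi> x" using cINF_lower[OF bb x, of x] by (simp add: g_def)
      show "\<psi> x \<le> g x" unfolding g_def by (rule cINF_greatest[OF D(1)]) (rule Lip[OF x])
    qed
  next
    show "total_variation g \<le> ennreal W"
    proof (rule total_variation_le_of_control[where P=P])
      fix x y :: real assume "x \<le> y"
      then show "\<bar>g y - g x\<bar> \<le> P y - P x" using gle[of x y] gle[of y x] Pmono[of x y] by linarith
    qed (use P0 PW in auto)
  qed
qed

text \<open>\<open>P x\<close> is the variation of \<open>g\<close> over partition points up to
  \<open>x\<close>. It is defined for every real \<open>x\<close>, so that it is monotone and
  bounded on the whole line.\<close>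

lemma total_variation_control:
  assumes "total_variation g < \<infinity>"
  obtains P V where "mono P" "\<And>x. 0 \<le> P x" "\<And>x. P x \<le> V"
    "\<And>x y. 0 \<le> x \<Longrightarrow> x \<le> y \<Longrightarrow> y \<le> 1 \<Longrightarrow> \<bar>g y - g x\<bar> \<le> P y - (P x :: real)"
proof -
  define S where "S xs = (\<Sum>i<length xs - 1. ennreal \<bar>g (xs ! Suc i) - g (xs ! i)\<bar>)" for xs
  define X where "X x = {xs. sorted xs \<and> set xs \<subseteq> {0..1} \<and> (\<forall>t\<in>set xs. t \<le> x)}" for x :: real
  define Q where "Q x = (SUP xs\<in>X x. S xs)" for x
  have ne: "[] \<in> X x" for x by (simp add: X_def)
  have Qmono: "Q x \<le> Q y" if "x \<le> y" for x y
    unfolding Q_def by (rule SUP_subset_mono) (use that in \<open>auto simp: X_def\<close>)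
  have Qle: "Q x \<le> total_variation g" for x
    unfolding Q_def total_variation_def S_def by (rule SUP_subset_mono) (auto simp: X_def)
  have Qfin: "Q x < \<infinity>" for x using le_less_trans[OF Qle assms] .
  have inc: "Q x + ennreal \<bar>g y - g x\<bar> \<le> Q y" if "0 \<le> x" "x \<le> y" "y \<le> 1" for x y
  proof -
    have "Q x + ennreal \<bar>g y - g x\<bar> = (SUP xs\<in>X x. S xs + ennreal \<bar>g y - g x\<bar>)"
      unfolding Q_def by (rule ennreal_SUP_add_left[symmetric]) (use ne in auto)
    also have "\<dots> \<le> Q y"
    proof (rule SUP_least)
      fix xs assume xs: "xs \<in> X x"
      \<comment> \<open>Both points are appended because \<open>xs\<close> need not end at
        \<open>x\<close>; the extra step from its last point to \<open>x\<close> only increases the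
        sum.\<close>
      let ?ys = "xs @ [x, y]"
      have ys: "?ys \<in> X y" using xs that by (auto simp: X_def sorted_append)
      have "S xs \<le> (\<Sum>i<length xs. ennreal \<bar>g (?ys ! Suc i) - g (?ys ! i)\<bar>)"
        unfolding S_def
      proof (rule order_trans[OF _ sum_mono2])
        show "(\<Sum>i<length xs - 1. ennreal \<bar>g (xs ! Suc i) - g (xs ! i)\<bar>)
          \<le> (\<Sum>i<length xs - 1. ennreal \<bar>g (?ys ! Suc i) - g (?ys ! i)\<bar>)"
          by (rule eq_refl, rule sum.cong) (auto simp: nth_append)
      qed auto
      moreover have "S ?ys = (\<Sum>i<length xs. ennreal \<bar>g (?ys ! Suc i) - g (?ys ! i)\<bar>) + ennreal \<bar>g y - g x\<bar>"
        by (simp add: S_def nth_append)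
      ultimately have "S xs + ennreal \<bar>g y - g x\<bar> \<le> S ?ys" by (simp add: add_right_mono)
      also have "\<dots> \<le> Q y" unfolding Q_def by (rule SUP_upper[OF ys])
      finally show "S xs + ennreal \<bar>g y - g x\<bar> \<le> Q y" .
    qed
    finally show ?thesis .
  qed
  define P where "P x = enn2real (Q x)" for x
  have eP: "ennreal (P x) = Q x" for x using Qfin[of x] by (simp add: P_def)
  show thesis
  proof (rule that[of P "enn2real (total_variation g)"])
    show "mono P" unfolding P_def by (intro monoI enn2real_mono Qmono) (use Qfin in auto)
    show "0 \<le> P x" for x by (simp add: P_def)
    show "P x \<le> enn2real (total_variation g)" for x
      unfolding P_def by (intro enn2real_mono Qle) (use assms in auto)
    fix x y :: real assume h: "0 \<le> x" "x \<le> y" "y \<le> 1"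
    have "ennreal (P x + \<bar>g y - g x\<bar>) \<le> ennreal (P y)"
      using inc[OF h] by (subst ennreal_plus) (simp_all add: eP, simp add: P_def)
    moreover have "0 \<le> P y" by (simp add: P_def)
    ultimately have "P x + \<bar>g y - g x\<bar> \<le> P y" by (subst (asm) ennreal_le_iff)
    then show "\<bar>g y - g x\<bar> \<le> P y - P x" by simp
  qed
qed

section \<open>Fibrewise regularity of the invariant measure\<close>

text \<open>Now the test function depends on the base point. Replacing \<open>u (q i)\<close> by
  \<open>u (p i)\<close> costs \<open>l\<close> times the length of the interval;
  \<open>u (p i)\<close> is then a constant, paired with \<open>\<phi>\<close>, plus
  \<open>l\<close> times an element of \<open>H0\<close>. These are the three terms of the
  bound.\<close>

lemma (in skew_system) var_bound_Lipschitz: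
  fixes A :: "nat set" and u :: "real \<Rightarrow> 'k \<Rightarrow> real"
  assumes no: "nonoverlapping A p q" and D: "\<And>i. i \<in> A \<Longrightarrow> p i \<in> D \<and> q i \<in> D"
    and B: "\<And>x z. x \<in> D \<Longrightarrow> \<bar>u x z\<bar> \<le> B" and l: "0 \<le> l"
    and lz: "\<And>x z z'. x \<in> D \<Longrightarrow> \<bar>u x z - u x z'\<bar> \<le> l * dist z z'"
    and lx: "\<And>x x' z. x \<in> D \<Longrightarrow> x' \<in> D \<Longrightarrow> \<bar>u x z - u x' z\<bar> \<le> l * \<bar>x - x'\<bar>"
  shows "(\<Sum>i\<in>A. \<bar>\<Lambda> m (q i) (u (q i)) - \<Lambda> m (p i) (u (p i))\<bar>)
    \<le> M * l + \<bar>B\<bar> * VP + l * (K_LY / (1 - \<theta>))"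
proof -
  define h where "h i z = (u (p i) z - u (p i) y0) / l" for i z
  have h: "h i \<in> H0" and hu: "u (p i) z = u (p i) y0 + l * h i z" if "i \<in> A" for i z
  proof -
    have pD: "p i \<in> D" using D that by blast
    have "\<bar>h i z - h i z'\<bar> \<le> dist z z'" for z z'
      using lz[OF pD, of z z'] l
      by (cases "l = 0") (simp_all add: h_def diff_divide_distrib[symmetric] divide_le_eq mult.commute)
    then show "h i \<in> H0" by (simp add: H0_def h_def)
    show "u (p i) z = u (p i) y0 + l * h i z"
      using lz[OF pD, of z y0] by (cases "l = 0") (simp_all add: h_def)
  qed
  have le: "\<bar>\<Lambda> m (q i) (u (q i)) - \<Lambda> m (p i) (u (p i))\<bar>
    \<le> M * l * (q i - p i) + \<bar>B\<bar> * (P (q i) - P (p i)) + l * \<bar>\<Lambda> m (q i) (h i) - \<Lambda> m (p i) (h i)\<bar>"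
    if i: "i \<in> A" for i
  proof -
    have pq: "p i \<in> D" "q i \<in> D" "p i < q i" using D i no by (auto simp: nonoverlapping_def)
    define c where "c = u (p i) y0"
    have ue: "u (p i) = (\<lambda>z. c + l * h i z)" unfolding c_def by (rule ext) (rule hu[OF i])
    have t1: "\<bar>\<Lambda> m (q i) (u (q i)) - \<Lambda> m (q i) (u (p i))\<bar> \<le> M * l * (q i - p i)"
    proof -
      have "\<bar>\<Lambda> m (q i) (\<lambda>z. u (q i) z - u (p i) z)\<bar> \<le> \<phi> (q i) * (l * (q i - p i))"
        by (rule \<Lambda>_le_phi[OF pq(2)]) (use lx[OF pq(2,1)] pq(3) in simp)
      also have "\<dots> \<le> M * (l * (q i - p i))" using phi_le l pq(3) by (intro mult_right_mono) auto
      finally show ?thesis using \<Lambda>_diff[OF B[OF pq(2)] B[OF pq(1)], of m "q i"] by (simp add: mult.assoc)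
    qed
    have hb: "\<And>z. \<bar>h i z\<bar> \<le> 1" using H0_bound[OF h[OF i]] .
    have "\<Lambda> m (q i) (u (p i)) - \<Lambda> m (p i) (u (p i)) = c * (\<phi> (q i) - \<phi> (p i)) + l * (\<Lambda> m (q i) (h i) - \<Lambda> m (p i) (h i))"
      unfolding ue \<Lambda>_add_const[OF pq(1) hb] \<Lambda>_add_const[OF pq(2) hb] by (simp add: algebra_simps)
    moreover have "\<bar>c * (\<phi> (q i) - \<phi> (p i))\<bar> \<le> \<bar>B\<bar> * (P (q i) - P (p i))"
      unfolding abs_mult using B[OF pq(1), of y0] phi_P[OF pq(1,2)] pq(3)
      by (intro mult_mono) (auto simp: c_def)
    moreover have "\<bar>l * (\<Lambda> m (q i) (h i) - \<Lambda> m (p i) (h i))\<bar> = l * \<bar>\<Lambda> m (q i) (h i) - \<Lambda> m (p i) (h i)\<bar>"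
      using l by (simp add: abs_mult)
    ultimately show ?thesis using t1 by linarith
  qed
  have R1: "(\<Sum>i\<in>A. P (q i) - P (p i)) \<le> VP"
  proof -
    have "(\<Sum>i\<in>A. P (q i) - P (p i)) \<le> VP - 0"
    proof (rule nonoverlapping_sum_increments_le[OF no, where X=UNIV])
      show "0 \<le> VP" using order_trans[OF P_range] .
      show "mono_on UNIV P" using P_mono .
    qed (use P_range in simp_all)
    then show ?thesis by simp
  qed
  have R2: "(\<Sum>i\<in>A. q i - p i) \<le> 1"
  proof -
    have "(\<Sum>i\<in>A. (\<lambda>x. x) (q i) - (\<lambda>x. x) (p i)) \<le> 1 - 0"
    proof (rule nonoverlapping_sum_increments_le[OF no, where X=UNIV])
      show "0 \<le> p i \<and> q i \<le> 1" if "i \<in> A" for i using D[OF that] D_sub by force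
    qed (auto simp: mono_on_def)
    then show ?thesis by simp
  qed
  have R3: "(\<Sum>i\<in>A. \<bar>\<Lambda> m (q i) (h i) - \<Lambda> m (p i) (h i)\<bar>) \<le> K_LY / (1 - \<theta>)"
    by (rule var_boundD[OF var_bound_\<Lambda> no]) (use D h in blast)
  have "(\<Sum>i\<in>A. \<bar>\<Lambda> m (q i) (u (q i)) - \<Lambda> m (p i) (u (p i))\<bar>)
    \<le> (\<Sum>i\<in>A. M * l * (q i - p i) + \<bar>B\<bar> * (P (q i) - P (p i)) + l * \<bar>\<Lambda> m (q i) (h i) - \<Lambda> m (p i) (h i)\<bar>)"
    by (rule sum_mono) (rule le)
  also have "\<dots> = M * l * (\<Sum>i\<in>A. q i - p i) + \<bar>B\<bar> * (\<Sum>i\<in>A. P (q i) - P (p i))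
      + l * (\<Sum>i\<in>A. \<bar>\<Lambda> m (q i) (h i) - \<Lambda> m (p i) (h i)\<bar>)"
    by (simp only: sum.distrib sum_distrib_left)
  also have "\<dots> \<le> M * l * 1 + \<bar>B\<bar> * VP + l * (K_LY / (1 - \<theta>))"
    by (intro add_mono mult_left_mono R1 R2 R3) (use l M_nonneg in auto)
  finally show ?thesis by simp
qed

text \<open>It is applied with \<open>F\<close> the \<open>k\<close>-th iterate of the given skew
  product, for which a single step already has the factor \<open>\<theta> < 1\<close>.
  \<open>\<phi>\<close> is a version of the marginal density with good pointwise properties.\<close>

locale skew_measure_system =
  skew_system T T' J C g y0 \<phi> P D M VP ak \<theta> Lc
  for T T' :: "real \<Rightarrow> real" and J :: "nat \<Rightarrow> real set" and C :: "nat \<Rightarrow> real"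
    and g :: "real \<Rightarrow> 'k::polish_space \<Rightarrow> 'k" and y0 :: 'k
    and \<phi> P :: "real \<Rightarrow> real" and D :: "real set" and M VP ak \<theta> Lc :: real +
  fixes F :: "real \<times> 'k \<Rightarrow> real \<times> 'k" and \<mu> :: "(real \<times> 'k) measure"
  assumes F_eq: "F (x, y) = (T x, g x y)"
    and F_measurable: "F \<in> borel_Sig \<rightarrow>\<^sub>M borel_Sig"
    and mu_prob: "prob_space \<mu>" and mu_sets: "sets \<mu> = sets borel_Sig"
    and mu_ac: "absolutely_continuous leb_I (distr \<mu> leb_I fst)"
    and mu_inv: "distr \<mu> borel_Sig F = \<mu>"
    and phi_measurable: "\<phi> \<in> borel_measurable leb_I"
    and phi_marginal: "AE x in leb_I. \<phi> x = marginal_density \<mu> x"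
    and D_full: "AE x in leb_I. x \<in> D"
begin

lemma mu_finite: "finite_measure \<mu>"
  using mu_prob by (rule prob_space.finite_measure)

lemma mu_space: "space \<mu> = Sig"
  using sets_eq_imp_space_eq[OF mu_sets] by (simp add: space_borel_Sig)

lemma measurable_mu: "measurable \<mu> N = measurable (leb_I \<Otimes>\<^sub>M borel) N"
  using measurable_cong_sets[OF mu_sets refl] measurable_borel_Sig by blast

lemma F_pair_measurable: "F \<in> leb_I \<Otimes>\<^sub>M borel \<rightarrow>\<^sub>M leb_I \<Otimes>\<^sub>M borel"
  using F_measurable by (simp add: measurable_borel_Sig measurable_to_borel_Sig)

lemma F_mu_measurable: "F \<in> \<mu> \<rightarrow>\<^sub>M borel_Sig"
  using F_measurable measurable_cong_sets[OF mu_sets refl] by blast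

lemma F_in_Sig: "p \<in> Sig \<Longrightarrow> F p \<in> Sig"
  using measurable_space[OF F_measurable, of p] by (simp add: space_borel_Sig)

lemma Fn_in_Sig: "p \<in> Sig \<Longrightarrow> (F ^^ n) p \<in> Sig"
  by (induction n) (auto intro: F_in_Sig)

lemma Fn_measurable: "(F ^^ n) \<in> leb_I \<Otimes>\<^sub>M borel \<rightarrow>\<^sub>M leb_I \<Otimes>\<^sub>M borel"
proof (induction n)
  case (Suc n)
  show ?case unfolding funpow.simps by (rule measurable_comp[OF Suc F_pair_measurable])
qed (simp add: id_def)

lemma fst_Fn: "fst ((F ^^ n) (x, y)) = fst ((F ^^ n) (x, z))"
proof (induction n)
  case (Suc n)
  have "fst (F p) = T (fst p)" for p using F_eq[of "fst p" "snd p"] by simp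
  then show ?case using Suc by simp
qed simp

text \<open>Duality between the transfer operator and composition with \<open>F\<close>.
  Measurability is proved in the same induction because \<open>transfer_integral\<close> requires it
  at each step.\<close>

lemma \<Lambda>_integral:
  fixes u :: "real \<times> 'k \<Rightarrow> real"
  assumes "u \<in> borel_measurable (leb_I \<Otimes>\<^sub>M borel)" "\<forall>p\<in>Sig. \<bar>u p\<bar> \<le> B"
  shows "(\<lambda>x. \<Lambda> m x (\<lambda>z. u (x, z))) \<in> borel_measurable leb_I \<and>
    (\<integral>x. \<Lambda> m x (\<lambda>z. u (x, z)) \<partial>leb_I) = (\<integral>x. \<phi> x * u ((F ^^ m) (x, y0)) \<partial>leb_I)"
  using assms
proof (induction m arbitrary: u)
  case 0
  have "(\<lambda>x. u (x, y0)) \<in> borel_measurable leb_I"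
    by (rule measurable_compose[OF measurable_Pair2' 0(1)]) simp
  then show ?case using phi_measurable by simp
next
  case (Suc m)
  define v where "v p = u (F p)" for p
  have v: "v \<in> borel_measurable (leb_I \<Otimes>\<^sub>M borel)"
    unfolding v_def by (rule measurable_compose[OF F_pair_measurable Suc.prems(1)])
  have vb: "\<forall>p\<in>Sig. \<bar>v p\<bar> \<le> B" using Suc.prems(2) F_in_Sig by (simp add: v_def)
  define \<Psi> where "\<Psi> x = \<Lambda> m x (\<lambda>z. v (x, z))" for x
  note IH = Suc.IH[OF v vb]
  have \<Psi>m: "\<Psi> \<in> borel_measurable leb_I" using IH unfolding \<Psi>_def[abs_def] by blast
  have \<Psi>b: "\<forall>x\<in>{0..1}. \<bar>\<Psi> x\<bar> \<le> suminf C ^ m * (M * B)"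
    unfolding \<Psi>_def by (intro ballI \<Lambda>_bound) (use vb in \<open>auto simp: Sig_def\<close>)
  have eq: "\<Lambda> (Suc m) x (\<lambda>z. u (x, z)) = (\<Sum>n. w n x * \<Psi> (s n x))" for x
  proof -
    have "w n x * \<Lambda> m (s n x) (\<lambda>z. u (x, g (s n x) z)) = w n x * \<Psi> (s n x)" for n
    proof (cases "x \<in> T ` J n")
      case True
      then show ?thesis using T_s[OF True] by (simp add: \<Psi>_def v_def F_eq)
    qed (simp add: w_def)
    then show ?thesis unfolding \<Lambda>.simps by (simp only:)
  qed
  have "(\<integral>x. \<Lambda> (Suc m) x (\<lambda>z. u (x, z)) \<partial>leb_I) = (\<integral>x. \<Psi> x \<partial>leb_I)"
    unfolding eq by (rule transfer_integral[OF \<Psi>m \<Psi>b])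
  also have "\<dots> = (\<integral>x. \<phi> x * u ((F ^^ Suc m) (x, y0)) \<partial>leb_I)"
    using IH by (simp add: \<Psi>_def v_def)
  finally show ?case unfolding eq using transfer_measurable[OF \<Psi>m] by blast
qed

text \<open>Points of one fibre share their base orbit. By invariance of \<open>\<mu>\<close> this
  orbit stays in \<open>D\<close> almost surely, so every step contracts by \<open>ak\<close>, from
  an initial distance of at most 1.\<close>

lemma contraction_along_orbit:
  "AE p in \<mu>. dist (snd ((F ^^ n) (fst p, y0))) (snd ((F ^^ n) p)) \<le> ak ^ n"
proof (induction n)
  case 0
  show ?case using dist_le_1 by simp
next
  case (Suc n)
  have "AE p in \<mu>. fst p \<in> D"
  proof -
    have "AE x in distr \<mu> leb_I fst. x \<in> D"
      by (rule absolutely_continuous_AE[OF _ mu_ac D_full]) simp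
    then show ?thesis by (rule AE_distrD[rotated]) (simp add: measurable_mu)
  qed
  then have Dn: "AE p in \<mu>. fst ((F ^^ k) p) \<in> D" for k
  proof (induction k)
    case (Suc k)
    have "AE p in distr \<mu> borel_Sig F. fst ((F ^^ k) p) \<in> D" unfolding mu_inv using Suc by simp
    then have "AE p in \<mu>. fst ((F ^^ k) (F p)) \<in> D" by (rule AE_distrD[OF F_mu_measurable])
    then show ?case by (simp add: funpow_swap1)
  qed simp
  show ?case using Suc Dn[of n]
  proof eventually_elim
    case (elim p)
    let ?x = "fst ((F ^^ n) p)"
    have fx: "fst ((F ^^ n) (fst p, y0)) = ?x" using fst_Fn[of n "fst p" y0 "snd p"] by simp
    have snd: "snd (F q) = g (fst q) (snd q)" for q using F_eq[of "fst q" "snd q"] by simp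
    have "dist (snd ((F ^^ Suc n) (fst p, y0))) (snd ((F ^^ Suc n) p))
       = dist (g ?x (snd ((F ^^ n) (fst p, y0)))) (g ?x (snd ((F ^^ n) p)))"
      by (simp add: snd fx)
    also have "\<dots> \<le> ak * dist (snd ((F ^^ n) (fst p, y0))) (snd ((F ^^ n) p))"
      by (rule g_fibre) (rule elim(2))
    also have "\<dots> \<le> ak * ak ^ n" by (rule mult_left_mono[OF elim(1) ak_range(1)])
    finally show ?case by simp
  qed
qed

lemma Fn_distr: "distr \<mu> borel_Sig (F ^^ n) = \<mu>"
proof (induction n)
  case 0
  have "distr \<mu> borel_Sig (\<lambda>x. x) = \<mu>"
    using distr_id[of \<mu>] distr_cong[of \<mu> \<mu> borel_Sig \<mu> "\<lambda>x. x" "\<lambda>x. x"] mu_sets by simp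
  then show ?case by (simp add: id_def)
next
  case (Suc n)
  have m: "(F ^^ n) \<in> \<mu> \<rightarrow>\<^sub>M borel_Sig"
    unfolding measurable_mu measurable_to_borel_Sig by (rule Fn_measurable)
  have "distr \<mu> borel_Sig (F ^^ Suc n) = distr (distr \<mu> borel_Sig (F ^^ n)) borel_Sig F"
    by (simp add: distr_distr[OF F_measurable m])
  then show ?case using Suc mu_inv by (simp del: funpow.simps)
qed

lemma integral_marginal:
  fixes h :: "real \<Rightarrow> real"
  assumes h: "h \<in> borel_measurable leb_I" and b: "\<And>x. x \<in> {0..1} \<Longrightarrow> \<bar>h x\<bar> \<le> B"
  shows "(\<integral>p. h (fst p) \<partial>\<mu>) = (\<integral>x. \<phi> x * h x \<partial>leb_I)"
proof -
  have hm: "(\<lambda>p. h (fst p)) \<in> borel_measurable (leb_I \<Otimes>\<^sub>M (borel :: 'k measure))"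
    by (rule measurable_compose[OF measurable_fst h])
  have "(\<integral>p. h (fst p) \<partial>\<mu>) = (\<integral>x. (\<integral>y. h (fst (x, y)) \<partial>fibre_measure \<mu> x) \<partial>leb_I)"
    by (rule integral_fibre(2)[OF mu_finite mu_sets mu_ac hm, of B]) (use b in \<open>auto simp: Sig_def\<close>)
  also have "\<dots> = (\<integral>x. marginal_density \<mu> x * h x \<partial>leb_I)"
    by (rule Bochner_Integration.integral_cong)
       (simp_all add: fibre_measure_space[OF mu_finite mu_sets mu_ac] measure_fibre_measure_UNIV[OF mu_finite mu_sets mu_ac])
  also have "\<dots> = (\<integral>x. \<phi> x * h x \<partial>leb_I)"
  proof (rule integral_cong_AE)
    show "AE x in leb_I. marginal_density \<mu> x * h x = \<phi> x * h x"
      using phi_marginal by (rule eventually_mono) simp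
  qed (use h phi_measurable marginal_density_measurable[OF mu_finite mu_sets mu_ac] in auto)
  finally show ?thesis .
qed

text \<open>Invariance replaces the integrand by its composition with the \<open>m\<close>-th
  iterate, after which the orbits of \<open>(x, y0)\<close> and \<open>(x, y)\<close> are compared.
  The indicator of \<open>A\<close> sees only the common base orbit and does not disturb the
  comparison.\<close>

lemma \<Lambda>_set_integral:
  fixes u :: "real \<times> 'k \<Rightarrow> real"
  assumes u: "u \<in> borel_measurable (leb_I \<Otimes>\<^sub>M borel)" and b: "\<forall>p\<in>Sig. \<bar>u p\<bar> \<le> B"
    and l: "0 \<le> l" "\<And>x z z'. x \<in> {0..1} \<Longrightarrow> \<bar>u (x, z) - u (x, z')\<bar> \<le> l * dist z z'"
    and A: "A \<in> sets leb_I"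
  shows "\<bar>(\<integral>x. indicator A x * \<Lambda> m x (\<lambda>z. u (x, z)) \<partial>leb_I) - (\<integral>p. indicator A (fst p) * u p \<partial>\<mu>)\<bar> \<le> l * ak ^ m"
proof -
  interpret prob_space \<mu> by (rule mu_prob)
  define v :: "real \<times> 'k \<Rightarrow> real" where "v p = indicator A (fst p) * u p" for p
  have v: "v \<in> borel_measurable (leb_I \<Otimes>\<^sub>M borel)" unfolding v_def using u A by measurable
  have vb: "\<forall>p\<in>Sig. \<bar>v p\<bar> \<le> B" using b order_trans[OF abs_ge_zero bspec[OF b]]
    by (auto simp: v_def split: split_indicator)
  have zero: "\<Lambda> m x (\<lambda>z. 0) = 0" for x using \<Lambda>_bound[of "\<lambda>z. 0" 0 m x] by simp
  have "(\<integral>x. indicator A x * \<Lambda> m x (\<lambda>z. u (x, z)) \<partial>leb_I) = (\<integral>x. \<Lambda> m x (\<lambda>z. v (x, z)) \<partial>leb_I)"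
    by (rule Bochner_Integration.integral_cong) (simp_all add: v_def zero split: split_indicator)
  also have "\<dots> = (\<integral>x. \<phi> x * v ((F ^^ m) (x, y0)) \<partial>leb_I)" using \<Lambda>_integral[OF v vb] by blast
  also have "\<dots> = (\<integral>p. v ((F ^^ m) (fst p, y0)) \<partial>\<mu>)"
  proof (rule integral_marginal[symmetric])
    show "(\<lambda>x. v ((F ^^ m) (x, y0))) \<in> borel_measurable leb_I"
      by (rule measurable_compose[OF measurable_Pair2' measurable_compose[OF Fn_measurable v]]) simp
    show "\<bar>v ((F ^^ m) (x, y0))\<bar> \<le> B" if "x \<in> {0..1}" for x
      by (rule bspec[OF vb Fn_in_Sig]) (use that in \<open>simp add: Sig_def\<close>)
  qed
  finally have 1: "(\<integral>x. indicator A x * \<Lambda> m x (\<lambda>z. u (x, z)) \<partial>leb_I) = (\<integral>p. v ((F ^^ m) (fst p, y0)) \<partial>\<mu>)" .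
  have Fm: "(F ^^ m) \<in> \<mu> \<rightarrow>\<^sub>M borel_Sig"
    unfolding measurable_mu measurable_to_borel_Sig by (rule Fn_measurable)
  have "(\<integral>p. v p \<partial>\<mu>) = (\<integral>p. v p \<partial>distr \<mu> borel_Sig (F ^^ m))" by (simp only: Fn_distr)
  also have "\<dots> = (\<integral>p. v ((F ^^ m) p) \<partial>\<mu>)"
    by (rule integral_distr[OF Fm]) (simp add: measurable_borel_Sig v)
  finally have 2: "(\<integral>p. v p \<partial>\<mu>) = (\<integral>p. v ((F ^^ m) p) \<partial>\<mu>)" .
  have m1: "(\<lambda>p. v ((F ^^ m) p)) \<in> borel_measurable \<mu>"
    unfolding measurable_mu by (rule measurable_compose[OF Fn_measurable v])
  have "(\<lambda>p. (fst p, y0)) \<in> leb_I \<Otimes>\<^sub>M borel \<rightarrow>\<^sub>M leb_I \<Otimes>\<^sub>M (borel :: 'k measure)" by simp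
  then have m2: "(\<lambda>p. v ((F ^^ m) (fst p, y0))) \<in> borel_measurable \<mu>"
    unfolding measurable_mu by (rule measurable_compose[OF _ measurable_compose[OF Fn_measurable v]])
  have inS: "(fst p, y0) \<in> Sig" if "p \<in> Sig" for p :: "real \<times> 'k" using that by (auto simp: Sig_def)
  have i1: "integrable \<mu> (\<lambda>p. v ((F ^^ m) p))"
    by (rule integrable_const_bound[OF AE_I2 m1, where B=B]) (use vb Fn_in_Sig mu_space in simp)
  have i2: "integrable \<mu> (\<lambda>p. v ((F ^^ m) (fst p, y0)))"
    by (rule integrable_const_bound[OF AE_I2 m2, where B=B]) (use vb Fn_in_Sig inS mu_space in simp)
  have close: "AE p in \<mu>. \<bar>v ((F ^^ m) (fst p, y0)) - v ((F ^^ m) p)\<bar> \<le> l * ak ^ m"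
    using contraction_along_orbit[of m] AE_space
  proof eventually_elim
    case (elim p)
    define x where "x = fst ((F ^^ m) p)"
    have e: "(F ^^ m) (fst p, y0) = (x, snd ((F ^^ m) (fst p, y0)))" "(F ^^ m) p = (x, snd ((F ^^ m) p))"
      using fst_Fn[of m "fst p" y0 "snd p"] by (simp_all add: x_def prod_eq_iff)
    have "x \<in> {0..1}" using Fn_in_Sig[of p m] elim(2) mu_space by (auto simp: x_def Sig_def)
    then have "\<bar>u (x, snd ((F ^^ m) (fst p, y0))) - u (x, snd ((F ^^ m) p))\<bar> \<le> l * dist (snd ((F ^^ m) (fst p, y0))) (snd ((F ^^ m) p))"
      by (rule l(2))
    also have "\<dots> \<le> l * ak ^ m" by (rule mult_left_mono[OF elim(1) l(1)])
    finally have "\<bar>u (x, snd ((F ^^ m) (fst p, y0))) - u (x, snd ((F ^^ m) p))\<bar> \<le> l * ak ^ m" .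
    moreover have "0 \<le> l * ak ^ m" using l(1) ak_range by simp
    moreover have "v ((F ^^ m) (fst p, y0)) = indicator A x * u (x, snd ((F ^^ m) (fst p, y0)))"
      "v ((F ^^ m) p) = indicator A x * u (x, snd ((F ^^ m) p))"
      by (subst e, simp add: v_def)+
    ultimately show ?case by (simp split: split_indicator)
  qed
  have "\<bar>(\<integral>p. v ((F ^^ m) (fst p, y0)) \<partial>\<mu>) - (\<integral>p. v ((F ^^ m) p) \<partial>\<mu>)\<bar>
     = \<bar>\<integral>p. v ((F ^^ m) (fst p, y0)) - v ((F ^^ m) p) \<partial>\<mu>\<bar>"
    using i1 i2 by simp
  also have "\<dots> \<le> (\<integral>p. \<bar>v ((F ^^ m) (fst p, y0)) - v ((F ^^ m) p)\<bar> \<partial>\<mu>)" by (rule integral_abs_bound)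
  also have "\<dots> \<le> (\<integral>p. l * ak ^ m \<partial>\<mu>)"
    by (rule integral_mono_AE) (use i1 i2 close in auto)
  also have "\<dots> = l * ak ^ m" by (simp add: prob_space)
  finally show ?thesis unfolding 1 2[unfolded v_def] unfolding v_def .
qed

text \<open>The convergence on \<open>D\<close> is pointwise, so the bound for each finite family of
  intervals with endpoints in \<open>D\<close> survives. The limit agrees almost everywhere with
  \<open>d\<close>, and its extension from \<open>D\<close> is the representative of bounded
  variation.\<close>

theorem ess_variation_density_finite:
  fixes u :: "real \<times> 'k \<Rightarrow> real" and d :: "real \<Rightarrow> real"
  assumes u: "u \<in> borel_measurable (leb_I \<Otimes>\<^sub>M borel)" and b: "\<forall>p\<in>Sig. \<bar>u p\<bar> \<le> B"
    and l: "0 \<le> l" "\<And>x z z'. x \<in> {0..1} \<Longrightarrow> \<bar>u (x, z) - u (x, z')\<bar> \<le> l * dist z z'"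
    and lx: "\<And>x x' z. x \<in> {0..1} \<Longrightarrow> x' \<in> {0..1} \<Longrightarrow> \<bar>u (x, z) - u (x', z)\<bar> \<le> l * \<bar>x - x'\<bar>"
    and d: "integrable leb_I d"
      "\<And>A. A \<in> sets leb_I \<Longrightarrow> (\<integral>x. indicator A x * d x \<partial>leb_I) = (\<integral>p. indicator A (fst p) * u p \<partial>\<mu>)"
  shows "ess_variation d < \<infinity>"
proof -
  interpret L: finite_measure leb_I by (rule finite_leb_I)
  define a where "a m x = \<Lambda> m x (\<lambda>z. u (x, z))" for m x
  have D01: "x \<in> D \<Longrightarrow> x \<in> {0..1}" for x using D_sub by force
  have am [measurable]: "a m \<in> borel_measurable leb_I" for m
    unfolding a_def using \<Lambda>_integral[OF u b] by blast
  have bx: "x \<in> D \<Longrightarrow> \<bar>u (x, z)\<bar> \<le> B" for x z using b D01 by (simp add: Sig_def)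
  have ab: "\<bar>a m x\<bar> \<le> M * B" if x: "x \<in> D" for m x
  proof -
    have "\<bar>a m x\<bar> \<le> \<phi> x * B" unfolding a_def by (rule \<Lambda>_le_phi[OF x]) (rule bx[OF x])
    also have "\<dots> \<le> M * B" using phi_le order_trans[OF abs_ge_zero bx[OF x]] by (rule mult_right_mono)
    finally show ?thesis .
  qed
  have conv: "convergent (\<lambda>m. a m x)" if x: "x \<in> D" for x
  proof -
    have "summable (\<lambda>m. a (Suc m) x - a m x)"
    proof (rule summable_comparison_test')
      show "summable (\<lambda>m. \<phi> x * (l * ak ^ m))"
        using ak_range by (intro summable_mult summable_geometric) simp
      show "norm (a (Suc m) x - a m x) \<le> \<phi> x * (l * ak ^ m)" for m
        unfolding a_def real_norm_def by (rule \<Lambda>_Cauchy[OF x l(1)]) (rule l(2)[OF D01[OF x]])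
    qed
    then have "(\<lambda>m. \<Sum>i<m. a (Suc i) x - a i x) \<longlonglongrightarrow> (\<Sum>m. a (Suc m) x - a m x)" by (rule summable_LIMSEQ)
    then have "(\<lambda>m. a m x - a 0 x) \<longlonglongrightarrow> (\<Sum>m. a (Suc m) x - a m x)" by (simp only: sum_lessThan_telescope[of "\<lambda>m. a m x"])
    then have "(\<lambda>m. (a m x - a 0 x) + a 0 x) \<longlonglongrightarrow> (\<Sum>m. a (Suc m) x - a m x) + a 0 x"
      by (rule tendsto_add) simp
    then show ?thesis by (auto simp: convergent_def)
  qed
  define \<psi> where "\<psi> x = lim (\<lambda>m. a m x)" for x
  have \<psi>m [measurable]: "\<psi> \<in> borel_measurable leb_I" unfolding \<psi>_def by measurable
  have lim: "(\<lambda>m. a m x) \<longlonglongrightarrow> \<psi> x" if "x \<in> D" for x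
    using conv[OF that] by (simp add: \<psi>_def convergent_LIMSEQ_iff)
  have \<psi>b: "\<bar>\<psi> x\<bar> \<le> M * B" if "x \<in> D" for x
    by (rule LIMSEQ_le_const2[OF tendsto_rabs[OF lim[OF that]]]) (use ab[OF that] in blast)
  have \<psi>i: "integrable leb_I \<psi>"
    by (rule L.integrable_const_bound[where B="M * B"])
       (use D_full \<psi>b in \<open>auto elim!: eventually_mono\<close>)
  \<comment> \<open>Over a base set, the integrals of \<open>a m\<close> converge to that of
    \<open>\<psi>\<close> by domination and to that of \<open>d\<close> by the contraction of the
    fibres.\<close>
  have eq: "AE x in leb_I. \<psi> x = d x"
  proof (rule density_unique_real[OF \<psi>i d(1)])
    fix A assume A: "A \<in> sets leb_I"
    have "(\<lambda>m. \<integral>x. indicator A x * a m x \<partial>leb_I) \<longlonglongrightarrow> (\<integral>x. indicator A x * \<psi> x \<partial>leb_I)"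
    proof (rule integral_dominated_convergence[where w="\<lambda>_. M * B"])
      show "(\<lambda>x. indicator A x * \<psi> x) \<in> borel_measurable leb_I" using A by measurable
      show "(\<lambda>x. indicator A x * a m x) \<in> borel_measurable leb_I" for m using A by measurable
      show "AE x in leb_I. (\<lambda>m. indicator A x * a m x) \<longlonglongrightarrow> indicator A x * \<psi> x"
        using D_full by (rule eventually_mono) (intro tendsto_mult tendsto_const lim)
      show "AE x in leb_I. norm (indicator A x * a m x) \<le> M * B" for m
        using D_full
      proof (rule eventually_mono)
        fix x assume x: "x \<in> D"
        have "0 \<le> M * B" using order_trans[OF abs_ge_zero ab[OF x]] .
        then show "norm (indicator A x * a m x) \<le> M * B" using ab[OF x] by (simp split: split_indicator)
      qed
    qed simp
    moreover have "(\<lambda>m. \<integral>x. indicator A x * a m x \<partial>leb_I) \<longlonglongrightarrow> (\<integral>p. indicator A (fst p) * u p \<partial>\<mu>)"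
    proof (rule LIM_zero_cancel, rule Lim_null_comparison)
      show "eventually (\<lambda>m. norm ((\<integral>x. indicator A x * a m x \<partial>leb_I) - (\<integral>p. indicator A (fst p) * u p \<partial>\<mu>)) \<le> l * ak ^ m) sequentially"
        unfolding a_def real_norm_def using \<Lambda>_set_integral[OF u b l A] by (intro always_eventually allI)
      show "(\<lambda>m. l * ak ^ m) \<longlonglongrightarrow> 0"
        using ak_range by (intro tendsto_mult_right_zero LIMSEQ_realpow_zero)
    qed
    ultimately have "(\<integral>x. indicator A x * \<psi> x \<partial>leb_I) = (\<integral>p. indicator A (fst p) * u p \<partial>\<mu>)"
      by (rule LIMSEQ_unique)
    then show "(LINT x:A|leb_I. \<psi> x) = (LINT x:A|leb_I. d x)"
      using d(2)[OF A] by (simp add: set_lebesgue_integral_def)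
  qed
  define W where "W = M * l + \<bar>B\<bar> * VP + l * (K_LY / (1 - \<theta>))"
  have "D \<noteq> {}"
  proof
    assume "D = {}"
    then have "AE x in leb_I. False" using D_full by simp
    then have "emeasure leb_I (space leb_I) = 0"
      by (subst (asm) AE_iff_measurable[of "space leb_I"]) (use sets.top[of leb_I] in auto)
    then show False by (simp add: leb_I_def emeasure_restrict_space)
  qed
  have W: "(\<Sum>i\<in>A. \<bar>\<psi> (q i) - \<psi> (p i)\<bar>) \<le> W"
    if no: "nonoverlapping A p q" and pq: "\<forall>i\<in>A. p i \<in> D \<and> q i \<in> D" for A :: "nat set" and p q
  proof -
    have "(\<lambda>m. \<Sum>i\<in>A. \<bar>a m (q i) - a m (p i)\<bar>) \<longlonglongrightarrow> (\<Sum>i\<in>A. \<bar>\<psi> (q i) - \<psi> (p i)\<bar>)"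
      by (intro tendsto_sum tendsto_rabs tendsto_diff lim) (use pq in auto)
    then show ?thesis
    proof (rule LIMSEQ_le_const2)
      have "(\<Sum>i\<in>A. \<bar>a m (q i) - a m (p i)\<bar>) \<le> W" for m
        unfolding a_def W_def
        by (rule var_bound_Lipschitz[OF no, where u="\<lambda>x z. u (x, z)"])
           (use pq bx l lx D01 in auto)
      then show "\<exists>N. \<forall>m\<ge>N. (\<Sum>i\<in>A. \<bar>a m (q i) - a m (p i)\<bar>) \<le> W" by blast
    qed
  qed
  have "D \<subseteq> {0..1}" using D01 by blast
  moreover have "\<forall>(A :: nat set) p q. nonoverlapping A p q \<longrightarrow> (\<forall>i\<in>A. p i \<in> D \<and> q i \<in> D) \<longrightarrow>
      (\<Sum>i\<in>A. \<bar>\<psi> (q i) - \<psi> (p i)\<bar>) \<le> W"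
    using W by blast
  ultimately obtain G where G: "\<And>x. x \<in> D \<Longrightarrow> G x = \<psi> x" "total_variation G \<le> ennreal W"
    using bounded_variation_extension[OF \<open>D \<noteq> {}\<close>, of \<psi> W] by blast
  have "AE x in leb_I. G x = d x"
    using eq D_full by eventually_elim (simp add: G(1))
  then have "ess_variation d \<le> total_variation G"
    unfolding ess_variation_def by (intro INF_lower) simp
  also have "\<dots> < \<infinity>" using le_less_trans[OF G(2)] by simp
  finally show ?thesis .
qed

end

section \<open>The main theorem\<close>

lemma skew_iterate: "(skew f G ^^ n) (x, y) = ((f ^^ n) x, snd ((skew f G ^^ n) (x, y)))"
proof (induction n)
  case (Suc n)
  have "(skew f G ^^ Suc n) (x, y) = skew f G ((f ^^ n) x, snd ((skew f G ^^ n) (x, y)))"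
    using Suc by simp
  then show ?case by (simp add: skew_def)
qed simp

text \<open>Invariance tested on \<open>A \<times> UNIV\<close>: the integral over \<open>A\<close>
  of the transfer operator applied to \<open>\<phi>\<close> is the integral of \<open>\<phi>\<close>
  over the preimage of \<open>A\<close>, hence the mass of the preimage of the cylinder, hence that
  of the cylinder.\<close>

lemma invariant_density_fixed_point:
  fixes \<mu> :: "(real \<times> 'k::polish_space) measure"
  assumes B: "branch_system T T' J C"
    and F: "F \<in> borel_Sig \<rightarrow>\<^sub>M borel_Sig" "\<And>x y. fst (F (x, y)) = T x"
    and \<mu>: "finite_measure \<mu>" "sets \<mu> = sets borel_Sig" "absolutely_continuous leb_I (distr \<mu> leb_I fst)"
      "distr \<mu> borel_Sig F = \<mu>"
    and \<phi>: "\<phi> \<in> borel_measurable leb_I" "\<And>x. 0 \<le> \<phi> x" "\<And>x. \<phi> x \<le> M"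
      "AE x in leb_I. \<phi> x = marginal_density \<mu> x"
  shows "AE y in leb_I. (\<Sum>n. branch_system.w T T' J n y * \<phi> (branch_system.s T J n y)) = \<phi> y"
proof -
  interpret branch_system T T' J C by (rule B)
  interpret L: finite_measure leb_I by (rule finite_leb_I)
  define L where "L y = (\<Sum>n. w n y * \<phi> (s n y))" for y
  have Lm [measurable]: "L \<in> borel_measurable leb_I" unfolding L_def by (rule transfer_measurable[OF \<phi>(1)])
  have \<phi>b: "\<bar>\<phi> x\<bar> \<le> M" for x using \<phi>(2,3)[of x] by simp
  have Li: "integrable leb_I L"
  proof (rule L.integrable_const_bound[OF AE_I2 Lm])
    show "norm (L y) \<le> suminf C * M" for y
      unfolding L_def real_norm_def by (rule w_mult_summable(2)) (rule \<phi>b)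
  qed
  have \<phi>i: "integrable leb_I \<phi>"
    by (rule L.integrable_const_bound[OF AE_I2 \<phi>(1), where B=M]) (use \<phi>b in simp)
  have sp: "space \<mu> = Sig" using sets_eq_imp_space_eq[OF \<mu>(2)] by (simp add: space_borel_Sig)
  have Tm: "T \<in> leb_I \<rightarrow>\<^sub>M leb_I"
  proof -
    have "(\<lambda>x. F (x, undefined)) \<in> leb_I \<rightarrow>\<^sub>M (leb_I \<Otimes>\<^sub>M (borel :: 'k measure))"
      by (rule measurable_compose[OF measurable_Pair2']) (use F(1) in \<open>simp_all add: measurable_borel_Sig measurable_to_borel_Sig\<close>)
    then have "(\<lambda>x. fst (F (x, undefined))) \<in> leb_I \<rightarrow>\<^sub>M leb_I" by (rule measurable_compose[OF _ measurable_fst])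
    then show ?thesis by (simp add: F(2))
  qed
  have \<phi>int: "(\<integral>x. \<phi> x * indicator A x \<partial>leb_I) = measure \<mu> (A \<times> UNIV)" if A: "A \<in> sets leb_I" for A
  proof -
    have "(\<integral>x. \<phi> x * indicator A x \<partial>leb_I) = (\<integral>x. marginal_density \<mu> x * indicator A x \<partial>leb_I)"
    proof (rule integral_cong_AE)
      show "AE x in leb_I. \<phi> x * indicator A x = marginal_density \<mu> x * indicator A x"
        using \<phi>(4) by (rule eventually_mono) simp
    qed (use \<phi>(1) A marginal_density_measurable[OF \<mu>(1-3)] in auto)
    then show ?thesis using integral_marginal_density[OF \<mu>(1-3) A] by simp
  qed
  have "AE y in leb_I. L y = \<phi> y"
  proof (rule density_unique_real[OF Li \<phi>i])
    fix A assume A: "A \<in> sets leb_I"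
    define A' where "A' = T -` A \<inter> space leb_I"
    have A': "A' \<in> sets leb_I" unfolding A'_def by (rule measurable_sets[OF Tm A])
    define u where "u x = \<phi> x * indicator A (T x)" for x :: real
    have u: "u \<in> borel_measurable leb_I"
      unfolding u_def using \<phi>(1) borel_measurable_indicator[OF A]
      by (intro borel_measurable_times measurable_compose[OF Tm]) auto
    have ub: "\<forall>x\<in>{0..1}. \<bar>u x\<bar> \<le> M"
      using \<phi>b order_trans[OF \<phi>(2,3)] by (auto simp: u_def split: split_indicator)
    have "indicator A y * L y = (\<Sum>n. w n y * u (s n y))" for y
    proof -
      have "w n y * u (s n y) = indicator A y * (w n y * \<phi> (s n y))" for n
        using T_s[of y n] by (cases "y \<in> T ` J n") (simp_all add: u_def w_def)
      then have "(\<Sum>n. w n y * u (s n y)) = (\<Sum>n. indicator A y * (w n y * \<phi> (s n y)))" by (simp only:)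
      also have "\<dots> = indicator A y * L y"
        unfolding L_def by (rule suminf_mult[OF w_mult_summable(1)[OF \<phi>b]])
      finally show ?thesis by simp
    qed
    then have "(LINT y:A|leb_I. L y) = (\<integral>x. u x \<partial>leb_I)"
      using transfer_integral[OF u ub] by (simp add: set_lebesgue_integral_def)
    also have "\<dots> = (\<integral>x. \<phi> x * indicator A' x \<partial>leb_I)"
      by (rule Bochner_Integration.integral_cong) (auto simp: u_def A'_def indicator_def)
    also have "\<dots> = measure \<mu> (A' \<times> UNIV)" by (rule \<phi>int[OF A'])
    also have "A' \<times> (UNIV :: 'k set) = F -` (A \<times> UNIV) \<inter> space \<mu>"
    proof -
      have "fst (F p) = T (fst p)" for p using F(2)[of "fst p" "snd p"] by simp
      then show ?thesis by (intro set_eqI) (simp add: A'_def sp Sig_def mem_Times_iff conj_commute)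
    qed
    also have "measure \<mu> (F -` (A \<times> UNIV) \<inter> space \<mu>) = measure (distr \<mu> borel_Sig F) (A \<times> UNIV)"
    proof (rule measure_distr[symmetric])
      show "F \<in> \<mu> \<rightarrow>\<^sub>M borel_Sig" using F(1) measurable_cong_sets[OF \<mu>(2) refl] by blast
      show "A \<times> UNIV \<in> sets (borel_Sig :: (real \<times> 'k) measure)" using A by (simp add: sets_borel_Sig)
    qed
    also have "\<dots> = (\<integral>x. \<phi> x * indicator A x \<partial>leb_I)" unfolding \<mu>(4) by (rule \<phi>int[OF A, symmetric])
    finally show "(LINT y:A|leb_I. L y) = (LINT y:A|leb_I. \<phi> y)"
      by (simp add: set_lebesgue_integral_def mult.commute)
  qed
  then show ?thesis by (simp add: L_def)
qed

text \<open>The complement of \<open>D\<close> is the union of all forward images of the exceptional set.\<close>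

lemma (in branch_system) backward_invariant_core:
  assumes "AE x in leb_I. good x"
  obtains D where "D \<subseteq> {0<..<1}" "\<And>x. x \<in> D \<Longrightarrow> good x" "AE x in leb_I. x \<in> D"
    "\<And>y n. y \<in> D \<Longrightarrow> y \<in> T ` J n \<Longrightarrow> s n y \<in> D"
proof -
  define N0 where "N0 = {x\<in>{0..1}. \<not> good x}"
  define N where "N m = ((\<lambda>S. \<Union>n. T ` (S \<inter> J n)) ^^ m) N0" for m
  have N_0: "N 0 = N0" and N_Suc: "N (Suc m) = (\<Union>n. T ` (N m \<inter> J n))" for m by (simp_all add: N_def)
  have neg: "negligible (N m)" for m
  proof (induction m)
    case 0
    show ?case unfolding N_0 N0_def by (rule negligible_of_AE_leb_I[OF assms])
  next
    case (Suc m)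
    show ?case unfolding N_Suc using negligible_image[OF Suc] by (intro negligible_countable_Union) auto
  qed
  define D where "D = {0<..<1} - (\<Union>m. N m)"
  show thesis
  proof (rule that)
    show "D \<subseteq> {0<..<1}" by (auto simp: D_def)
    show "good x" if "x \<in> D" for x
    proof (rule ccontr)
      assume "\<not> good x"
      then have "x \<in> N 0" using that by (simp add: N_0 N0_def D_def)
      then show False using that by (auto simp: D_def)
    qed
    have "negligible ((\<Union>m. N m) \<union> {0, 1})"
      using neg by (intro negligible_Un negligible_countable_Union) auto
    from AE_leb_I_negligible[OF this] have "AE x in leb_I. x \<notin> (\<Union>m. N m) \<union> {0, 1}" .
    then show "AE x in leb_I. x \<in> D"
      using AE_space by eventually_elim (auto simp: D_def)
    show "s n y \<in> D" if y: "y \<in> D" "y \<in> T ` J n" for y n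
    proof -
      have sJ: "s n y \<in> J n" by (rule s_in[OF y(2)])
      have "s n y \<notin> N m" for m
      proof
        assume "s n y \<in> N m"
        then have "T (s n y) \<in> N (Suc m)" unfolding N_Suc using sJ by blast
        then show False using y by (auto simp: T_s D_def)
      qed
      then show ?thesis using sJ J_sub[of n] by (auto simp: D_def)
    qed
  qed
qed

lemma Lip_times_measure_in_S1:
  fixes f :: "real \<Rightarrow> real" and G :: "real \<times> 'k::polish_space \<Rightarrow> 'k"
    and a b :: "nat \<Rightarrow> real" and \<alpha> :: real and \<mu>0 :: "(real \<times> 'k) measure"
  assumes dist_le_1: "\<And>y z :: 'k. dist y z \<le> 1"
    and F: "skew f G \<in> borel_Sig \<rightarrow>\<^sub>M borel_Sig"
    and T: "class_T a b f" and H1: "H1 \<alpha> G" and H3: "H3 a b \<alpha> f G"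
    and inv: "invariant_S1 (skew f G) \<mu>0"
    and u: "u \<in> Lip_Sig"
  shows "integrable \<mu>0 u \<and> times_measure u \<mu>0 \<in> S1"
proof -
  have \<alpha>: "0 \<le> \<alpha>" "\<alpha> < 1" using H1 by (simp_all add: H1_def)
  note \<mu>sets = invariant_sets[OF F inv] and \<mu>fin = invariant_finite[OF F inv]
    and \<mu>ac = invariant_ac[OF F inv] and \<mu>sp = invariant_space[OF F inv]
  interpret \<mu>0: prob_space \<mu>0 by (rule invariant_prob[OF F inv])
  interpret L: finite_measure leb_I by (rule branch_system.finite_leb_I[OF class_T_branch_system[OF T]])
  obtain k where k: "1 \<le> k"
    and contr: "ereal (\<alpha> ^ k) * esssup (lebesgue_on {0..1}) (\<lambda>x. ereal (1 / \<bar>deriv (f ^^ k) x\<bar>)) < 1"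
    and fibre: "AE x in leb_I. lipschitz_on (\<alpha> ^ k) UNIV (\<lambda>y. snd ((skew f G ^^ k) (x, y)))"
    and base: "\<exists>C. \<forall>J\<in>branch_partition a b f k. \<forall>y. lipschitz_on C J (\<lambda>x. snd ((skew f G ^^ k) (x, y)))"
    using H3 unfolding H3_def by blast
  obtain j where j: "k = Suc j" using k by (cases k) auto
  obtain T' J C where B: "branch_system (f ^^ k) T' J C"
    and part: "\<And>n. J n \<noteq> {} \<Longrightarrow> J n \<in> branch_partition a b f k"
    using iterate_branch_system[OF T, of j] unfolding j by blast
  interpret B: branch_system "f ^^ k" T' J C by (rule B)
  define Fk where "Fk = skew f G ^^ k"
  define g where "g x y = snd (Fk (x, y))" for x y
  have Fk_eq: "Fk (x, y) = ((f ^^ k) x, g x y)" for x y unfolding g_def Fk_def by (rule skew_iterate)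
  have Fk: "Fk \<in> borel_Sig \<rightarrow>\<^sub>M borel_Sig" unfolding Fk_def by (rule iterate_measurable[OF F inv])
  have Fk_inv: "distr \<mu>0 borel_Sig Fk = \<mu>0" unfolding Fk_def by (rule iterate_distr[OF F inv])
  obtain C0 where C0: "\<And>J y. J \<in> branch_partition a b f k \<Longrightarrow> lipschitz_on C0 J (\<lambda>x. g x y)"
    using base unfolding g_def Fk_def by blast
  define Lc where "Lc = max 0 C0"

  \<comment> \<open>A bounded version of the marginal density with monotone control of its
    increments\<close>
  define sd where "sd = signed_density (measure \<mu>0)"
  \<comment> \<open>Membership in \<open>S1\<close> speaks of \<open>signed_density\<close>. With
    the null measure as second term, both densities have the same integrals over base sets.\<close>
  have sd: "AE x in leb_I. sd x = marginal_density \<mu>0 x"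
  proof -
    let ?N = "null_measure (borel_Sig :: (real \<times> 'k) measure)"
    have N: "finite_measure ?N" "sets ?N = sets borel_Sig" by (auto intro: finite_measureI)
    have Nac: "absolutely_continuous leb_I (distr ?N leb_I fst)"
      by (rule marginal_ac_mono[OF \<mu>ac \<mu>sets N(2)]) simp
    have \<eta>: "\<forall>A\<in>sets borel_Sig. measure \<mu>0 A = measure \<mu>0 A - measure ?N A" by (simp add: measure_def)
    note I = integral_signed_density[OF \<mu>fin N(1) \<mu>sets N(2) \<mu>ac Nac \<eta>]
    show ?thesis unfolding sd_def
    proof (rule density_unique_real[OF I(1) marginal_density_integrable[OF \<mu>fin \<mu>sets \<mu>ac]])
      fix A assume A: "A \<in> sets leb_I"
      show "(LINT x:A|leb_I. signed_density (measure \<mu>0) x) = (LINT x:A|leb_I. marginal_density \<mu>0 x)"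
        using I(2)[OF A] integral_marginal_density[OF \<mu>fin \<mu>sets \<mu>ac A]
        by (simp add: set_lebesgue_integral_def mult.commute)
    qed
  qed
  have "ess_variation sd < \<infinity>" using inv by (simp add: invariant_S1_def S1_def BV_m_def sd_def)
  then obtain g0 where g0: "AE x in leb_I. g0 x = sd x" "total_variation g0 < \<infinity>"
    unfolding ess_variation_def by (auto simp: INF_less_iff)
  obtain P V where P: "mono P" "\<And>x. 0 \<le> P x" "\<And>x. P x \<le> V"
    "\<And>x y. 0 \<le> x \<Longrightarrow> x \<le> y \<Longrightarrow> y \<le> 1 \<Longrightarrow> \<bar>g0 y - g0 x\<bar> \<le> P y - P x"
    using total_variation_control[OF g0(2)] by blast
  define M where "M = \<bar>g0 0\<bar> + V"
  have V0: "0 \<le> V" using order_trans[OF P(2,3)] .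
  have M0: "0 \<le> M" using V0 by (simp add: M_def)
  have g0M: "g0 x \<le> M" if "0 \<le> x" "x \<le> 1" for x
    using P(4)[of 0 x] P(2)[of 0] P(3)[of x] that by (simp add: M_def)
  \<comment> \<open>Truncation bounds the density at every point. Almost nowhere does it change the
    value, since there the density equals \<open>g0\<close>, which is at most \<open>M\<close> on
    the interval.\<close>
  define \<phi> where "\<phi> x = min M (marginal_density \<mu>0 x)" for x
  have \<phi>m: "\<phi> \<in> borel_measurable leb_I"
    unfolding \<phi>_def[abs_def] using marginal_density_measurable[OF \<mu>fin \<mu>sets \<mu>ac] by simp
  have \<phi>nn: "0 \<le> \<phi> x" and \<phi>M: "\<phi> x \<le> M" for x
    using M0 marginal_density_nonneg[OF \<mu>fin \<mu>sets \<mu>ac] by (auto simp: \<phi>_def)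
  note \<phi> = \<phi>m \<phi>nn \<phi>M
  have g0marg: "AE x in leb_I. g0 x = marginal_density \<mu>0 x \<and> \<phi> x = marginal_density \<mu>0 x"
    using g0(1) sd AE_space
  proof eventually_elim
    case (elim x)
    then show ?case using g0M[of x] by (simp add: \<phi>_def min_absorb2)
  qed
  have \<phi>marg: "AE x in leb_I. \<phi> x = marginal_density \<mu>0 x" using g0marg by (rule eventually_mono) simp
  have transfer_\<phi>: "AE y in leb_I. (\<Sum>n. B.w n y * \<phi> (B.s n y)) = \<phi> y"
    by (rule invariant_density_fixed_point[OF B Fk _ \<mu>fin \<mu>sets \<mu>ac Fk_inv \<phi> \<phi>marg]) (simp add: Fk_eq)

  \<comment> \<open>The contraction factor and the set of good base points\<close>
  define e where "e = esssup (lebesgue_on {0..1}) (\<lambda>x. ereal (1 / \<bar>deriv (f ^^ k) x\<bar>))"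
  \<comment> \<open>The product is formed before the conversion because \<open>e\<close> may be
    infinite when \<open>\<alpha> = 0\<close>. The maximum with 0 and the bound 1 make the extended
    real finite, so nothing is lost.\<close>
  define \<theta> where "\<theta> = real_of_ereal (max 0 (ereal (\<alpha> ^ k) * e))"
  have q1: "ereal (\<alpha> ^ k) * e < 1" using contr by (simp add: e_def)
  then have \<theta>: "ereal \<theta> = max 0 (ereal (\<alpha> ^ k) * e)"
  proof -
    have "ereal (real_of_ereal t) = t" if "0 \<le> t" "t < 1" for t using that by (cases t) auto
    then show ?thesis unfolding \<theta>_def using q1 by simp
  qed
  have \<theta>01: "0 \<le> \<theta>" "\<theta> < 1"
  proof -
    have "ereal 0 \<le> ereal \<theta>" "ereal \<theta> < ereal 1" unfolding \<theta> using q1 by (auto simp: one_ereal_def zero_ereal_def)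
    then show "0 \<le> \<theta>" "\<theta> < 1" by simp_all
  qed
  have esssup: "AE x in leb_I. ereal (1 / \<bar>deriv (f ^^ k) x\<bar>) \<le> e"
  proof -
    have "AE x in lebesgue_on {0..1}. ereal (1 / \<bar>deriv (f ^^ k) x\<bar>) \<le> e" unfolding e_def by (rule esssup_AE)
    then have "AE x in lebesgue. x \<in> {0..1} \<longrightarrow> ereal (1 / \<bar>deriv (f ^^ k) x\<bar>) \<le> e"
      by (subst (asm) AE_restrict_space_iff) auto
    then have "AE x in lborel. x \<in> {0..1} \<longrightarrow> ereal (1 / \<bar>deriv (f ^^ k) x\<bar>) \<le> e" by (simp add: AE_completion_iff)
    then show ?thesis unfolding leb_I_def by (subst AE_restrict_space_iff) auto
  qed
  \<comment> \<open>All almost sure properties that the locale demands pointwise are gathered, so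
    that one backward invariant set \<open>D\<close> serves them all.\<close>
  define good where "good x \<longleftrightarrow> g0 x = marginal_density \<mu>0 x \<and> \<phi> x = marginal_density \<mu>0 x \<and>
    (\<Sum>n. B.w n x * \<phi> (B.s n x)) = \<phi> x \<and> lipschitz_on (\<alpha> ^ k) UNIV (g x) \<and>
    ereal (1 / \<bar>deriv (f ^^ k) x\<bar>) \<le> e" for x
  have "AE x in leb_I. lipschitz_on (\<alpha> ^ k) UNIV (g x)" using fibre by (simp add: g_def[abs_def] Fk_def)
  then have "AE x in leb_I. good x"
    using g0marg transfer_\<phi> esssup by eventually_elim (simp add: good_def)
  then obtain D where D: "D \<subseteq> {0<..<1}" "\<And>x. x \<in> D \<Longrightarrow> good x" "AE x in leb_I. x \<in> D"
    "\<And>y n. y \<in> D \<Longrightarrow> y \<in> (f ^^ k) ` J n \<Longrightarrow> B.s n y \<in> D"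
    using B.backward_invariant_core by blast
  \<comment> \<open>Any point of the fibre can be the reference point \<open>y0\<close>;
    \<open>undefined\<close> supplies one.\<close>
  interpret S: skew_measure_system "f ^^ k" T' J C g undefined \<phi> P D M V "\<alpha> ^ k" \<theta> Lc Fk \<mu>0
  proof
    show "D \<subseteq> {0<..<1}" by (rule D(1))
    show "B.s n y \<in> D" if "y \<in> D" "y \<in> (f ^^ k) ` J n" for y n by (rule D(4)[OF that])
    show "0 \<le> \<phi> x" "\<phi> x \<le> M" for x by (rule \<phi>(2), rule \<phi>(3))
    show "(\<lambda>n. B.w n y * \<phi> (B.s n y)) sums \<phi> y" if "y \<in> D" for y
    proof -
      have "\<bar>\<phi> (B.s n y)\<bar> \<le> M" for n using \<phi>(2,3)[of "B.s n y"] by simp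
      from B.w_mult_summable(1)[OF this, of y] show ?thesis
        using D(2)[OF that] by (simp add: good_def sums_iff)
    qed
    show "mono P" "0 \<le> P x" "P x \<le> V" for x by (rule P(1), rule P(2), rule P(3))
    show "\<bar>\<phi> y - \<phi> x\<bar> \<le> P y - P x" if "x \<in> D" "y \<in> D" "x \<le> y" for x y
    proof -
      have "0 \<le> x" "y \<le> 1" using D(1) that by (auto simp: subset_iff)
      moreover have "\<phi> x = g0 x" "\<phi> y = g0 y" using D(2)[OF that(1)] D(2)[OF that(2)] by (simp_all add: good_def)
      ultimately show ?thesis using P(4)[of x y] that(3) by simp
    qed
    show "dist (g x z1) (g x z2) \<le> \<alpha> ^ k * dist z1 z2" if "x \<in> D" for x z1 z2
      using D(2)[OF that] by (auto simp: good_def dest: lipschitz_onD)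
    show "0 \<le> \<alpha> ^ k" using \<alpha> by simp
    show "\<alpha> ^ k < 1" using power_decreasing[of 1 k \<alpha>] k \<alpha> by simp
    show "\<alpha> ^ k / T' x \<le> \<theta>" if "x \<in> D" "x \<in> J n" for x n
    proof -
      have dT: "deriv (f ^^ k) x = T' x" using B.T_der[OF that(2)] by (rule DERIV_imp_deriv)
      have "ereal (1 / T' x) \<le> e" using D(2)[OF that(1)] B.T'_pos[OF that(2)] by (simp add: good_def dT)
      then have "ereal (\<alpha> ^ k) * ereal (1 / T' x) \<le> ereal (\<alpha> ^ k) * e"
        by (rule ereal_mult_left_mono) (use \<alpha> in simp)
      also have "\<dots> \<le> ereal \<theta>" unfolding \<theta> by simp
      finally show ?thesis by simp
    qed
    show "0 \<le> \<theta>" "\<theta> < 1" by (rule \<theta>01)+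
    show "dist (g x z) (g x' z) \<le> Lc * \<bar>x - x'\<bar>" if "x \<in> J n" "x' \<in> J n" for x x' z n
    proof -
      have "J n \<noteq> {}" using that by blast
      then have "dist (g x z) (g x' z) \<le> C0 * dist x x'"
        using lipschitz_onD[OF C0[OF part] that] by blast
      also have "\<dots> \<le> Lc * \<bar>x - x'\<bar>" unfolding Lc_def dist_real_def by (rule mult_right_mono) auto
      finally show ?thesis .
    qed
    show "0 \<le> Lc" by (simp add: Lc_def)
    show "dist z1 z2 \<le> 1" for z1 z2 :: 'k by (rule dist_le_1)
    show "Fk (x, y) = ((f ^^ k) x, g x y)" for x y by (rule Fk_eq)
    show "Fk \<in> borel_Sig \<rightarrow>\<^sub>M borel_Sig" by (rule Fk)
    show "sets \<mu>0 = sets borel_Sig" by (rule \<mu>sets)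
    show "absolutely_continuous leb_I (distr \<mu>0 leb_I fst)" by (rule \<mu>ac)
    show "distr \<mu>0 borel_Sig Fk = \<mu>0" by (rule Fk_inv)
    show "\<phi> \<in> borel_measurable leb_I" by (rule \<phi>(1))
    show "AE x in leb_I. \<phi> x = marginal_density \<mu>0 x" by (rule \<phi>marg)
    show "AE x in leb_I. x \<in> D" by (rule D(3))
  qed

  \<comment> \<open>Application to the Lipschitz function \<open>u\<close>\<close>
  define K where "K = lip_norm u"
  have um: "u \<in> borel_measurable borel_Sig" by (rule Lip_Sig_borel_measurable[OF dist_le_1 u])
  have K: "\<forall>p\<in>Sig. \<bar>u p\<bar> \<le> K" "0 \<le> K"
    using Lip_Sig_abs_le[OF dist_le_1 u] lip_norm_nonneg[OF dist_le_1 u] by (simp_all add: K_def)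
  note D = times_measure_difference[OF F inv um K]
  have ac1: "absolutely_continuous leb_I (distr (density \<mu>0 (\<lambda>p. ennreal (u p + K))) leb_I fst)"
    by (rule density_ac[OF F inv D(3,1,5)])
  have ac2: "absolutely_continuous leb_I (distr (density \<mu>0 (\<lambda>p. ennreal K)) leb_I fst)"
    by (rule density_ac[OF F inv D(4,2) eq_refl[OF D(6)]])
  note \<Delta> = D(1-4) ac1 ac2 D(7)
  have L1: "times_measure u \<mu>0 \<in> L1_space" by (rule difference_in_L1_space[OF \<Delta>])
  note I = integral_signed_density[OF \<Delta>]
  have "ess_variation (signed_density (times_measure u \<mu>0)) < \<infinity>"
  proof (rule S.ess_variation_density_finite[where u=u and B=K and l="lip_const u"])
    show "u \<in> borel_measurable (leb_I \<Otimes>\<^sub>M borel)" using um by (simp add: measurable_borel_Sig)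
    show "0 \<le> lip_const u" by (rule Lip_const_nonneg[OF dist_le_1 u])
    show "\<bar>u (x, z) - u (x, z')\<bar> \<le> lip_const u * dist z z'" if "x \<in> {0..1}" for x z z'
      using Lip_Sig_le[OF dist_le_1 u, of "(x, z)" "(x, z')"] that by (simp add: Sig_def d_Sig_def)
    show "\<bar>u (x, z) - u (x', z)\<bar> \<le> lip_const u * \<bar>x - x'\<bar>" if "x \<in> {0..1}" "x' \<in> {0..1}" for x x' z
      using Lip_Sig_le[OF dist_le_1 u, of "(x, z)" "(x', z)"] that by (simp add: Sig_def d_Sig_def dist_real_def)
    show "(\<integral>x. indicator A x * signed_density (times_measure u \<mu>0) x \<partial>leb_I) = (\<integral>p. indicator A (fst p) * u p \<partial>\<mu>0)"
      if A: "A \<in> sets leb_I" for A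
    proof -
      have "(\<integral>x. indicator A x * signed_density (times_measure u \<mu>0) x \<partial>leb_I) = times_measure u \<mu>0 (A \<times> UNIV)"
        using I(2)[OF A] by (simp add: mult.commute)
      also have "\<dots> = (\<integral>p. indicator A (fst p) * u p \<partial>\<mu>0)"
        unfolding times_measure_def set_lebesgue_integral_def
        by (rule Bochner_Integration.integral_cong) (auto simp: indicator_def)
      finally show ?thesis .
    qed
  qed (rule K(1), rule I(1))
  then have "times_measure u \<mu>0 \<in> S1" using L1 I(1) by (simp add: S1_def BV_m_def)
  moreover have "integrable \<mu>0 u"
    by (rule \<mu>0.integrable_const_bound[where B=K])
       (use K um \<mu>sp in \<open>auto simp: measurable_invariant[OF F inv]\<close>)
  ultimately show ?thesis by blast
qed

theorem theoremD:
  fixes f :: "real \<Rightarrow> real" and G :: "real \<times> 'k::polish_space \<Rightarrow> 'k"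
    and a b :: "nat \<Rightarrow> real" and \<alpha> :: real and \<mu>0 :: "(real \<times> 'k) measure"
  assumes "compact (UNIV :: 'k set)" and "diameter (UNIV :: 'k set) = 1"
    and "skew f G \<in> borel_Sig \<rightarrow>\<^sub>M borel_Sig"
    and "class_T a b f"
    and "H1 \<alpha> G"
    and "H3 a b \<alpha> f G"
    and "invariant_S1 (skew f G) \<mu>0"
    and "\<And>\<nu>. invariant_S1 (skew f G) \<nu> \<Longrightarrow> \<nu> = \<mu>0"
  shows "Lip_Sig \<subseteq> Theta1 \<mu>0 \<and>
    (\<forall>l0 U. spectral_gap (skew f G) \<mu>0 l0 U \<longrightarrow>
      (\<forall>u1\<in>Lip_Sig. \<forall>u2\<in>Lip_Sig. \<forall>n\<ge>1.
        ennreal \<bar>(\<integral>p. u1 ((skew f G ^^ n) p) * u2 p \<partial>\<mu>0) - (\<integral>p. u1 p \<partial>\<mu>0) * (\<integral>p. u2 p \<partial>\<mu>0)\<bar>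
          \<le> S1_norm (times_measure u2 \<mu>0) * ennreal (U * lip_norm u1 * l0 ^ n)))"
proof -
  have dist_le_1: "dist y z \<le> 1" for y z :: 'k
    using diameter_bounded_bound[OF compact_imp_bounded[OF assms(1)], of y z] assms(2) by simp
  have S1: "integrable \<mu>0 u \<and> times_measure u \<mu>0 \<in> S1" if "u \<in> Lip_Sig" for u
    by (rule Lip_times_measure_in_S1[OF dist_le_1 assms(3-7) that])
  show ?thesis
  proof (intro conjI allI impI ballI)
    show "Lip_Sig \<subseteq> Theta1 \<mu>0" using S1 by (auto simp: Theta1_def)
    fix l0 U and u1 u2 :: "real \<times> 'k \<Rightarrow> real" and n :: nat
    assume "spectral_gap (skew f G) \<mu>0 l0 U" "u1 \<in> Lip_Sig" "u2 \<in> Lip_Sig" "1 \<le> n"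
    then show "ennreal \<bar>(\<integral>p. u1 ((skew f G ^^ n) p) * u2 p \<partial>\<mu>0) - (\<integral>p. u1 p \<partial>\<mu>0) * (\<integral>p. u2 p \<partial>\<mu>0)\<bar>
          \<le> S1_norm (times_measure u2 \<mu>0) * ennreal (U * lip_norm u1 * l0 ^ n)"
      using S1 by (intro decay_of_correlations[OF assms(3,7) dist_le_1]) auto
  qed
qed

end
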